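(* Each of the oriented closed connected $3$-manifolds $S^1\times S^2$, $\mathbb{R}P^3$ and the lens space $L(3,1)$ has integral simplicial volume equal to $2$; that is, $\|S^1\times S^2\|_{\mathbb{Z}} = \|\mathbb{R}P^3\|_{\mathbb{Z}} = \|L(3,1)\|_{\mathbb{Z}} = 2$.
   Context: For a singular chain $c = \sum_j a_j\cdot\sigma_j$ with integer coefficients in reduced form put $|c|_1 := \sum_j|a_j|$. For an oriented closed connected $n$-manifold $M$, the integral simplicial volume is $\|M\|_{\mathbb{Z}} := \min\{|c|_1 \mid c \in C_n(M;\mathbb{Z}) \text{ is a singular cycle representing the integral fundamental class } [M]_{\mathbb{Z}}\}$. *)

theory Defs
  imports "HOL-Analysis.Analysis" "HOL-Homology.Homology"
begin

definition chain_norm :: "'a chain \<Rightarrow> nat" where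
  "chain_norm c = (\<Sum>\<sigma>\<in>Poly_Mapping.keys c. nat \<bar>Poly_Mapping.lookup c \<sigma>\<bar>)"

text \<open>A connected manifold is nonempty by convention, whereas the library counts the empty space as
  connected.\<close>

definition closed_connected_manifold :: "nat \<Rightarrow> 'a topology \<Rightarrow> bool" where
  "closed_connected_manifold n X \<longleftrightarrow>
     topspace X \<noteq> {} \<and> Hausdorff_space X \<and> second_countable X \<and> compact_space X \<and> connected_space X \<and>
     (\<forall>x\<in>topspace X. \<exists>U V. openin X U \<and> x \<in> U \<and> openin (Euclidean_space n) V \<and>
        subtopology X U homeomorphic_space subtopology (Euclidean_space n) V)"

abbreviation local_homology_group :: "nat \<Rightarrow> 'a topology \<Rightarrow> 'a \<Rightarrow> 'a chain set monoid" where
  "local_homology_group n X x \<equiv> relative_homology_group (int n) X (topspace X - {x})"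

text \<open>An orientation is a choice of a generator of the local homology group at every point that is
  locally induced by a single relative class.\<close>

definition orientation :: "nat \<Rightarrow> 'a topology \<Rightarrow> ('a \<Rightarrow> 'a chain set) \<Rightarrow> bool" where
  "orientation n X \<mu> \<longleftrightarrow>
     (\<forall>x\<in>topspace X.
        \<mu> x \<in> carrier (local_homology_group n X x) \<and>
        subgroup_generated (local_homology_group n X x) {\<mu> x} = local_homology_group n X x) \<and>
     (\<forall>x\<in>topspace X. \<exists>U. openin X U \<and> x \<in> U \<and>
        (\<exists>\<beta>\<in>carrier (relative_homology_group (int n) X (topspace X - U)).
           \<forall>y\<in>U. hom_induced (int n) X (topspace X - U) X (topspace X - {y}) id \<beta> = \<mu> y))"

definition oriented_closed_connected_manifold ::
    "nat \<Rightarrow> 'a topology \<Rightarrow> ('a \<Rightarrow> 'a chain set) \<Rightarrow> bool" where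
  "oriented_closed_connected_manifold n X \<mu> \<longleftrightarrow> closed_connected_manifold n X \<and> orientation n X \<mu>"

text \<open>The integral fundamental class is the (unique) class that restricts to the chosen local
  orientation at every point.\<close>

definition fundamental_class ::
    "nat \<Rightarrow> 'a topology \<Rightarrow> ('a \<Rightarrow> 'a chain set) \<Rightarrow> 'a chain set \<Rightarrow> bool" where
  "fundamental_class n X \<mu> \<alpha> \<longleftrightarrow>
     \<alpha> \<in> carrier (homology_group (int n) X) \<and>
     (\<forall>x\<in>topspace X. hom_induced (int n) X {} X (topspace X - {x}) id \<alpha> = \<mu> x)"

definition fundamental_cycle :: "nat \<Rightarrow> 'a topology \<Rightarrow> ('a \<Rightarrow> 'a chain set) \<Rightarrow> 'a chain \<Rightarrow> bool" where
  "fundamental_cycle n X \<mu> c \<longleftrightarrow>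
     singular_relcycle n X {} c \<and> fundamental_class n X \<mu> (homologous_rel_set n X {} c)"

text \<open>The infimum of a nonempty set of natural numbers is its minimum; the infimum of the empty set
  is \<open>0\<close>, so a positive value also witnesses the existence of a fundamental cycle.\<close>

definition integral_simplicial_volume :: "nat \<Rightarrow> 'a topology \<Rightarrow> ('a \<Rightarrow> 'a chain set) \<Rightarrow> nat" where
  "integral_simplicial_volume n X \<mu> = Inf {chain_norm c | c. fundamental_cycle n X \<mu> c}"

definition quotient_topology :: "'a topology \<Rightarrow> ('a \<Rightarrow> 'b) \<Rightarrow> 'b topology" where
  "quotient_topology X q =
     topology (\<lambda>U. U \<subseteq> q ` topspace X \<and> openin X {x \<in> topspace X. q x \<in> U})"

lemma openin_quotient_topology:
  "openin (quotient_topology X q) U \<longleftrightarrow>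
     U \<subseteq> q ` topspace X \<and> openin X {x \<in> topspace X. q x \<in> U}"
proof -
  let ?P = "\<lambda>U. {x \<in> topspace X. q x \<in> U}"
  have "istopology (\<lambda>U. U \<subseteq> q ` topspace X \<and> openin X (?P U))"
    unfolding istopology_def
  proof (intro conjI allI impI)
    fix S T
    assume S: "S \<subseteq> q ` topspace X \<and> openin X (?P S)"
      and T: "T \<subseteq> q ` topspace X \<and> openin X (?P T)"
    then show "S \<inter> T \<subseteq> q ` topspace X"
      by blast
    have "?P (S \<inter> T) = ?P S \<inter> ?P T"
      by blast
    then show "openin X (?P (S \<inter> T))"
      using S T by (simp only: openin_Int)
  next
    fix K
    assume K: "\<forall>S\<in>K. S \<subseteq> q ` topspace X \<and> openin X (?P S)"
    then show "\<Union>K \<subseteq> q ` topspace X"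
      by blast
    have "?P (\<Union>K) = \<Union>(?P ` K)"
      by blast
    moreover have "openin X (\<Union>(?P ` K))"
      using K by (intro openin_Union) blast
    ultimately show "openin X (?P (\<Union>K))"
      by (simp only:)
  qed
  then show ?thesis
    unfolding quotient_topology_def by (simp only: topology_inverse')
qed

lemma topspace_quotient_topology [simp]: "topspace (quotient_topology X q) = q ` topspace X"
proof
  show "topspace (quotient_topology X q) \<subseteq> q ` topspace X"
    using openin_topspace[of "quotient_topology X q"] unfolding openin_quotient_topology by (rule conjunct1)
  have "{x \<in> topspace X. q x \<in> q ` topspace X} = topspace X"
    by auto
  then have "openin (quotient_topology X q) (q ` topspace X)"
    unfolding openin_quotient_topology by (simp only: openin_topspace order_refl simp_thms)
  then show "q ` topspace X \<subseteq> topspace (quotient_topology X q)"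
    by (rule openin_subset)
qed

lemma quotient_map_quotient_topology: "quotient_map X (quotient_topology X q) q"
  unfolding quotient_map_def openin_quotient_topology by simp

definition real_projective_space :: "nat \<Rightarrow> (nat \<Rightarrow> real) set topology" where
  "real_projective_space n = quotient_topology (nsphere n) (\<lambda>x. {x, \<lambda>i. - x i})"

text \<open>\<open>L(p,q)\<close> is the space of orbits of the unit sphere in \<open>\<complex>\<^sup>2\<close> under the action of the cyclic group
  of order \<open>p\<close> generated by
  \<open>(z,w) \<mapsto> (exp (2\<pi>\<i>/p) z, exp (2\<pi>\<i>q/p) w)\<close>.\<close>

definition lens_orbit :: "nat \<Rightarrow> nat \<Rightarrow> complex \<times> complex \<Rightarrow> (complex \<times> complex) set" where
  "lens_orbit p q = (\<lambda>(z, w).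
     {(cis (2 * pi * real k / real p) * z, cis (2 * pi * real k * real q / real p) * w) | k. k < p})"

definition lens_space :: "nat \<Rightarrow> nat \<Rightarrow> (complex \<times> complex) set topology" where
  "lens_space p q =
     quotient_topology (top_of_set {(z, w). (norm z)\<^sup>2 + (norm w)\<^sup>2 = 1}) (lens_orbit p q)"

end

theory Submission
  imports Defs
begin

text \<open>Upper bound: each of the manifolds is a quotient of a covering space (\<open>S\<^sup>3\<close>, respectively \<open>\<real> \<times> S\<^sup>2\<close>) in which
  there are two explicit 3-simplices \<open>\<tau>\<close> and \<open>\<sigma>\<close> whose faces cancel in the quotient, up to deck
  transformations. At a suitable point \<open>\<tau>\<close> has local degree one and all translates of \<open>\<sigma>\<close> and all other
  translates of \<open>\<tau>\<close> are avoided. Since the manifolds are homogeneous via isotopies, the cycle \<open>\<tau> \<plusminus> \<sigma>\<close> then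
  generates the local homology at every point.

  Lower bound: a cycle of norm one is a single simplex, up to sign. The faces of a simplex that is a cycle are identified
  in such a way that it lifts to a cycle in every covering. For \<open>L(p,1)\<close> the covering by \<open>S\<^sup>3\<close> has degree \<open>p\<close>, so the
  simplex represents a multiple of \<open>p\<close> times the fundamental class, and for \<open>S\<^sup>1 \<times> S\<^sup>2\<close> the universal covering has no
  third homology, so the simplex bounds.\<close>

section \<open>Generators of local homology\<close>

text \<open>The simplex \<sigma> is there to repair the boundary. Two faces of \<tau> cancel against
  each other up to a deck transformation; the other two are taken over by \<sigma>, whose remaining
  faces cancel as well. The image of \<sigma> upstairs lies in a 2-sphere, a circle or a line, so it
  can miss the chosen point and contributes nothing to the local degree there. The local degree of
  \<tau> is found by comparison. One affine simplex, \<open>reference_map\<close>, is shown to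
  generate the homology of R^3 relative to the complement of 0, and \<tau>, read in a chart, is
  joined to it by straight segments. Only the frontier of the simplex matters: the segments must
  miss 0 there. So the position of the point that \<tau> sends to the centre of the chart never has
  to be computed. For the lens spaces the same simplices serve the lower bound. The sum of all deck
  translates of \<tau> + \<sigma> is a cycle in S^3 that generates at one point; a lifted
  one-simplex cycle is a multiple of it, and its projection is \<open>p\<close> times the cycle
  downstairs.\<close>

lemma homologous_rel_set_mult:
  assumes "singular_relcycle n X S a" "singular_relcycle n X S b"
  shows "homologous_rel_set n X S a \<otimes>\<^bsub>relative_homology_group (int n) X S\<^esub> homologous_rel_set n X S b
       = homologous_rel_set n X S (a + b)"
proof -
  have "\<exists>x y. homologous_rel n X S a x \<and> homologous_rel n X S b y \<and> d = x + y"
    if "homologous_rel n X S (a + b) d" for d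
  proof (intro exI conjI)
    show "homologous_rel n X S b (d - a)"
      using that by (simp add: homologous_rel_def algebra_simps)
  qed auto
  then show ?thesis
    by (auto simp: mult_relative_homology_group homologous_rel_add)
qed

lemma homologous_rel_set_carrier:
  "singular_relcycle n X S a \<Longrightarrow> homologous_rel_set n X S a \<in> carrier (relative_homology_group (int n) X S)"
  by (simp add: carrier_relative_homology_group)

lemma homologous_rel_set_nat_pow:
  assumes "singular_relcycle n X S c"
  shows "homologous_rel_set n X S c [^]\<^bsub>relative_homology_group (int n) X S\<^esub> (k::nat)
       = homologous_rel_set n X S (frag_cmul (int k) c)"
proof (induction k)
  case 0
  then show ?case
    using homologous_rel_set_eq_relboundary[of n X S 0] by simp
next
  case (Suc k)
  have "frag_cmul (int (Suc k)) c = frag_cmul (int k) c + c"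
    by (simp add: frag_cmul_distrib)
  then show ?case
    using homologous_rel_set_mult[OF singular_relcycle_cmul[OF assms] assms, of "int k"]
    by (simp only: Group.nat_pow_Suc Suc)
qed

lemma homologous_rel_set_int_pow:
  assumes "singular_relcycle n X S c"
  shows "homologous_rel_set n X S c [^]\<^bsub>relative_homology_group (int n) X S\<^esub> (k::int)
       = homologous_rel_set n X S (frag_cmul k c)"
proof (cases "0 \<le> k")
  case True
  then obtain m where "k = int m" using zero_le_imp_eq_int by blast
  then show ?thesis
    by (simp only: int_pow_int homologous_rel_set_nat_pow[OF assms])
next
  case False
  let ?G = "relative_homology_group (int n) X S"
  define m where "m = nat (- k)"
  have k: "k = - int m" using False by (simp add: m_def)
  have rc: "singular_relcycle n X S (frag_cmul j c)" for j
    using assms by (rule singular_relcycle_cmul)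
  have "homologous_rel_set n X S (frag_cmul k c) \<otimes>\<^bsub>?G\<^esub> homologous_rel_set n X S (frag_cmul (int m) c) = \<one>\<^bsub>?G\<^esub>"
    using homologous_rel_set_mult[OF rc rc, of k "int m"] homologous_rel_set_eq_relboundary[of n X S 0]
    by (simp add: k flip: frag_cmul_distrib)
  then have "inv\<^bsub>?G\<^esub> (homologous_rel_set n X S (frag_cmul (int m) c)) = homologous_rel_set n X S (frag_cmul k c)"
    by (intro group.inv_equality) (auto simp: homologous_rel_set_carrier rc)
  then show ?thesis
    unfolding k group.int_pow_neg_int[OF group_relative_homology_group homologous_rel_set_carrier[OF assms]]
      homologous_rel_set_nat_pow[OF assms] .
qed

text \<open>The class of \<open>c\<close> freely generates an infinite cyclic group. Stated on
  chains, this provides the multiple \<open>k\<close> as an integer, and the last clause makes it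
  unique; the comparison of \<open>k\<close> with 1 and -1 decides the lower bound.\<close>

definition homology_generator :: "nat \<Rightarrow> 'a topology \<Rightarrow> 'a set \<Rightarrow> 'a chain \<Rightarrow> bool" where
  "homology_generator n X S c \<longleftrightarrow> singular_relcycle n X S c \<and>
     (\<forall>a. singular_relcycle n X S a \<longrightarrow> (\<exists>k. homologous_rel n X S a (frag_cmul k c))) \<and>
     (\<forall>k. singular_relboundary n X S (frag_cmul k c) \<longrightarrow> k = 0)"

lemma homology_generator_group:
  assumes "singular_relcycle n X S c"
  shows "homology_generator n X S c \<longleftrightarrow>
    (\<forall>x\<in>carrier (relative_homology_group (int n) X S).
        \<exists>k::int. x = homologous_rel_set n X S c [^]\<^bsub>relative_homology_group (int n) X S\<^esub> k) \<and>
    (\<forall>k::int. homologous_rel_set n X S c [^]\<^bsub>relative_homology_group (int n) X S\<^esub> k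
         = \<one>\<^bsub>relative_homology_group (int n) X S\<^esub> \<longrightarrow> k = 0)"
  using assms
  by (auto simp: homology_generator_def homologous_rel_set_int_pow carrier_relative_homology_group
      homologous_rel_set_eq homologous_rel_set_eq_relboundary)

lemma homology_generator_iso:
  assumes h: "h \<in> iso (relative_homology_group (int n) X S) (relative_homology_group (int m) Y T)"
    and c: "singular_relcycle n X S c" and d: "singular_relcycle m Y T d"
    and hc: "h (homologous_rel_set n X S c) = homologous_rel_set m Y T d"
  shows "homology_generator n X S c \<longleftrightarrow> homology_generator m Y T d"
proof -
  let ?G = "relative_homology_group (int n) X S" and ?H = "relative_homology_group (int m) Y T"
  let ?x = "homologous_rel_set n X S c" and ?y = "homologous_rel_set m Y T d"
  have hom: "h \<in> hom ?G ?H" and bij: "bij_betw h (carrier ?G) (carrier ?H)"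
    using h by (auto simp: iso_def)
  have x: "?x \<in> carrier ?G" using c by (rule homologous_rel_set_carrier)
  have pw: "h (?x [^]\<^bsub>?G\<^esub> k) = ?y [^]\<^bsub>?H\<^esub> k" for k :: int
    using hom_int_pow[OF hom x] by (simp add: hc)
  have xk: "?x [^]\<^bsub>?G\<^esub> k \<in> carrier ?G" for k :: int
    by (simp add: group.int_pow_closed x)
  have inj: "h u = h v \<longleftrightarrow> u = v" if "u \<in> carrier ?G" "v \<in> carrier ?G" for u v
    using bij that by (auto simp: bij_betw_def inj_on_def)
  have one: "h \<one>\<^bsub>?G\<^esub> = \<one>\<^bsub>?H\<^esub>"
    using hom by (intro hom_one) auto
  have oneG: "\<one>\<^bsub>?G\<^esub> \<in> carrier ?G"
    using group_relative_homology_group group.is_monoid monoid.one_closed by blast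
  have a: "(?x [^]\<^bsub>?G\<^esub> k = \<one>\<^bsub>?G\<^esub>) \<longleftrightarrow> (?y [^]\<^bsub>?H\<^esub> k = \<one>\<^bsub>?H\<^esub>)" for k :: int
    using inj[OF xk oneG] pw one by metis
  have b: "(\<forall>u\<in>carrier ?G. \<exists>k::int. u = ?x [^]\<^bsub>?G\<^esub> k) \<longleftrightarrow> (\<forall>v\<in>carrier ?H. \<exists>k::int. v = ?y [^]\<^bsub>?H\<^esub> k)"
  proof
    assume L: "\<forall>u\<in>carrier ?G. \<exists>k::int. u = ?x [^]\<^bsub>?G\<^esub> k"
    show "\<forall>v\<in>carrier ?H. \<exists>k::int. v = ?y [^]\<^bsub>?H\<^esub> k"
    proof
      fix v assume "v \<in> carrier ?H"
      then obtain u where u: "u \<in> carrier ?G" "v = h u"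
        using bij by (auto simp: bij_betw_def)
      then show "\<exists>k::int. v = ?y [^]\<^bsub>?H\<^esub> k"
        using L pw by metis
    qed
  next
    assume R: "\<forall>v\<in>carrier ?H. \<exists>k::int. v = ?y [^]\<^bsub>?H\<^esub> k"
    show "\<forall>u\<in>carrier ?G. \<exists>k::int. u = ?x [^]\<^bsub>?G\<^esub> k"
    proof
      fix u assume u: "u \<in> carrier ?G"
      then have "h u \<in> carrier ?H" using bij by (auto simp: bij_betw_def)
      then obtain k :: int where "h u = ?y [^]\<^bsub>?H\<^esub> k" using R by blast
      then have "u = ?x [^]\<^bsub>?G\<^esub> k" using inj[OF u xk] pw by metis
      then show "\<exists>k::int. u = ?x [^]\<^bsub>?G\<^esub> k" by blast
    qed
  qed
  show ?thesis
    unfolding homology_generator_group[OF c] homology_generator_group[OF d] by (simp only: a b)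
qed

lemma homology_generator_hom_induced_iso:
  assumes "hom_induced (int n) X S Y T f \<in> iso (relative_homology_group (int n) X S) (relative_homology_group (int n) Y T)"
    and "continuous_map X Y f" "f \<in> S \<rightarrow> T" "singular_relcycle n X S c"
  shows "homology_generator n X S c \<longleftrightarrow> homology_generator n Y T (chain_map n f c)"
  by (rule homology_generator_iso[OF assms(1) assms(4) singular_relcycle_chain_map[OF assms(4,2,3)]
        hom_induced_chain_map[OF assms(2-4)]])

lemma homology_generator_homologous:
  assumes "homology_generator n X S c" "homologous_rel n X S c d"
  shows "homology_generator n X S d"
proof -
  have c: "singular_relcycle n X S c" using assms(1) by (simp add: homology_generator_def)
  have d: "singular_relcycle n X S d" using assms(2) c homologous_rel_singular_relcycle by blast
  have eq: "homologous_rel_set n X S c = homologous_rel_set n X S d"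
    using assms(2) by (simp add: homologous_rel_set_eq)
  show ?thesis
    using assms(1) unfolding homology_generator_group[OF c] homology_generator_group[OF d] eq .
qed

text \<open>Excision of the complement of \<open>W\<close>: it is closed and, since \<open>K\<close>
  lies in \<open>W\<close>, contained in the open set \<open>topspace Z - K\<close>.\<close>

lemma homology_open_iso:
  assumes "openin Z W" "closedin Z K" "K \<subseteq> W"
  shows "hom_induced p (subtopology Z W) (W - K) Z (topspace Z - K) id
    \<in> iso (relative_homology_group p (subtopology Z W) (W - K)) (relative_homology_group p Z (topspace Z - K))"
proof -
  have sub: "W \<subseteq> topspace Z" using assms openin_subset by auto
  have eq1: "topspace Z - (topspace Z - W) = W" and eq2: "topspace Z - K - (topspace Z - W) = W - K"
    using sub by auto
  have op: "openin Z (topspace Z - K)" and cl: "closedin Z (topspace Z - W)"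
    using assms by blast+
  have "Z closure_of (topspace Z - W) \<subseteq> Z interior_of (topspace Z - K)"
    using op cl \<open>K \<subseteq> W\<close> by (auto simp: closure_of_closedin interior_of_openin)
  from homology_excision_axiom[OF this, of "topspace Z" p] show ?thesis
    by (simp add: eq1 eq2)
qed

lemma homology_generator_homeomorphic_maps:
  assumes "homeomorphic_maps X Y f g" "f \<in> S \<rightarrow> T" "g \<in> T \<rightarrow> S" "singular_relcycle n X S c"
  shows "homology_generator n X S c \<longleftrightarrow> homology_generator n Y T (chain_map n f c)"
proof (rule homology_generator_hom_induced_iso[OF _ _ assms(2,4)])
  show "hom_induced (int n) X S Y T f \<in> iso (relative_homology_group (int n) X S) (relative_homology_group (int n) Y T)"
    using homeomorphic_maps_relative_homology_group_isomorphisms[OF assms(1-3)] by (rule group_isomorphisms_imp_iso)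
  show "continuous_map X Y f"
    using assms(1) by (simp add: homeomorphic_maps_def)
qed

lemma iso_square:
  assumes i: "i \<in> iso A B" and f: "f \<in> iso A C" and j: "j \<in> iso C D"
    and F: "F \<in> hom B D" and comm: "\<And>u. F (i u) = j (f u)"
  shows "F \<in> iso B D"
proof -
  have bi: "bij_betw i (carrier A) (carrier B)" and bf: "bij_betw f (carrier A) (carrier C)"
    and bj: "bij_betw j (carrier C) (carrier D)"
    using i f j by (simp_all add: iso_def)
  have "F \<circ> i = j \<circ> f"
    by (simp add: fun_eq_iff comm)
  then have "bij_betw (F \<circ> i) (carrier A) (carrier D)"
    using bij_betw_trans[OF bf bj] by simp
  then have "bij_betw F (carrier B) (carrier D)"
    using bij_betw_comp_iff[OF bi, of F "carrier D"] by simp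
  then show ?thesis
    using F by (simp add: iso_def)
qed

text \<open>Both local groups can be computed inside the open sets \<open>U\<close> and
  \<open>V\<close>, between which \<open>f\<close> is a homeomorphism. That \<open>x\<close> is the
  only preimage of \<open>f x\<close> makes \<open>f\<close> a map of pairs on all of
  \<open>X\<close>, and the square formed with the two excisions commutes.\<close>

lemma homology_generator_open_embedding:
  assumes f: "continuous_map X Y f" and U: "openin X U" "x \<in> U" and V: "openin Y V"
    and hm: "homeomorphic_map (subtopology X U) (subtopology Y V) f"
    and HX: "closedin X {x}" and HY: "closedin Y {f x}"
    and ne: "\<And>z. z \<in> topspace X \<Longrightarrow> f z = f x \<Longrightarrow> z = x"
    and c: "singular_relcycle n X (topspace X - {x}) c"
  shows "homology_generator n X (topspace X - {x}) c
     \<longleftrightarrow> homology_generator n Y (topspace Y - {f x}) (chain_map n f c)"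
proof -
  have UX: "U \<subseteq> topspace X" and VY: "V \<subseteq> topspace Y"
    by (simp_all add: U(1) V openin_subset)
  have fx: "f x \<in> V"
    using imageI[OF U(2), of f] homeomorphic_imp_surjective_map[OF hm] UX VY by (simp add: Int_absorb1)
  have isoX: "hom_induced (int n) (subtopology X U) (U - {x}) X (topspace X - {x}) id
      \<in> iso (relative_homology_group (int n) (subtopology X U) (U - {x})) (relative_homology_group (int n) X (topspace X - {x}))"
    (is "?i \<in> iso ?GU ?GX")
    and isoY: "hom_induced (int n) (subtopology Y V) (V - {f x}) Y (topspace Y - {f x}) id
      \<in> iso (relative_homology_group (int n) (subtopology Y V) (V - {f x})) (relative_homology_group (int n) Y (topspace Y - {f x}))"
    (is "?j \<in> iso ?GV ?GY")
    by (rule homology_open_iso; use U V HX HY fx in simp)+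
  have fUV: "f ` (U - {x}) = V - {f x}"
    using homeomorphic_imp_surjective_map[OF hm] homeomorphic_imp_injective_map[OF hm] UX VY U(2)
    by (auto simp: inj_on_def Int_absorb1)
  have fUV': "f z \<in> V \<and> f z \<noteq> f x" if "z \<in> U" "z \<noteq> x" for z
    using fUV that by blast
  have isof: "hom_induced (int n) (subtopology X U) (U - {x}) (subtopology Y V) (V - {f x}) f \<in> iso ?GU ?GV"
    by (rule homeomorphic_map_relative_homology_iso[OF hm _ fUV]) (use UX in auto)
  let ?F = "hom_induced (int n) X (topspace X - {x}) Y (topspace Y - {f x}) f"
  have fS: "f \<in> (topspace X - {x}) \<rightarrow> topspace Y - {f x}"
    using f ne by (auto simp: continuous_map_def)
  have comm: "?F (?i u) = ?j (hom_induced (int n) (subtopology X U) (U - {x}) (subtopology Y V) (V - {f x}) f u)" for u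
  proof -
    have "?F (?i u) = hom_induced (int n) (subtopology X U) (U - {x}) Y (topspace Y - {f x}) (f \<circ> id) u"
    proof (rule hom_induced_compose')
      show "id \<in> U - {x} \<rightarrow> topspace X - {x}" using UX by auto
    qed (simp_all add: f fS continuous_map_from_subtopology)
    moreover have "?j (hom_induced (int n) (subtopology X U) (U - {x}) (subtopology Y V) (V - {f x}) f u)
      = hom_induced (int n) (subtopology X U) (U - {x}) Y (topspace Y - {f x}) (id \<circ> f) u"
    proof (rule hom_induced_compose')
      show "id \<in> V - {f x} \<rightarrow> topspace Y - {f x}" using VY by auto
      show "f \<in> U - {x} \<rightarrow> V - {f x}" using fUV' by auto
      show "continuous_map (subtopology X U) (subtopology Y V) f"
        using hm by (rule homeomorphic_imp_continuous_map)
    qed (simp add: continuous_map_from_subtopology)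
    ultimately show ?thesis by (simp only: comp_id id_comp)
  qed
  have "?F \<in> iso ?GX ?GY"
    by (rule iso_square[OF isoX isof isoY hom_induced_hom comm])
  from homology_generator_hom_induced_iso[OF this f fS c] show ?thesis .
qed

section \<open>The standard simplex generates homology relative to the complement of the
  diagonal\<close>

lemma powertop_real_eq_euclidean: "powertop_real UNIV = (euclidean :: (nat \<Rightarrow> real) topology)"
  by (simp add: euclidean_product_topology)

lemma singular_simplex_top_of_set:
  fixes f :: "(nat \<Rightarrow> real) \<Rightarrow> 'a::topological_space"
  shows "singular_simplex p (top_of_set S) f \<longleftrightarrow>
    continuous_on (standard_simplex p) f \<and> f \<in> standard_simplex p \<rightarrow> S \<and> f \<in> extensional (standard_simplex p)"
  unfolding singular_simplex_def powertop_real_eq_euclidean by (simp add: image_subset_iff_funcset)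

lemma prod_topology_top_of_set: "prod_topology (top_of_set A) (top_of_set B) = top_of_set (A \<times> B)"
  by (simp add: prod_topology_subtopology_eu)

lemma homotopic_with_linear_fun:
  fixes f g :: "'a::topological_space \<Rightarrow> 'b \<Rightarrow> real"
  assumes f: "continuous_on S f" and g: "continuous_on S g"
    and T: "\<And>x t. \<lbrakk>x \<in> S; 0 \<le> t; t \<le> 1\<rbrakk> \<Longrightarrow> (\<lambda>i. (1 - t) * f x i + t * g x i) \<in> T"
    and P: "\<And>t. \<lbrakk>0 \<le> t; t \<le> 1\<rbrakk> \<Longrightarrow> P (\<lambda>x i. (1 - t) * f x i + t * g x i)"
  shows "homotopic_with P (top_of_set S) (top_of_set T) f g"
  unfolding homotopic_with_def
proof (intro exI conjI ballI allI)
  let ?h = "\<lambda>z. \<lambda>i. (1 - fst z) * f (snd z) i + fst z * g (snd z) i"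
  have "continuous_on ({0..1::real} \<times> S) (\<lambda>z. f (snd z))"
    by (rule continuous_on_compose2[OF f continuous_on_snd[OF continuous_on_id]]) auto
  then have cf: "continuous_on ({0..1::real} \<times> S) (\<lambda>z. f (snd z) i)" for i
    by (rule continuous_on_product_then_coordinatewise)
  have "continuous_on ({0..1::real} \<times> S) (\<lambda>z. g (snd z))"
    by (rule continuous_on_compose2[OF g continuous_on_snd[OF continuous_on_id]]) auto
  then have cg: "continuous_on ({0..1::real} \<times> S) (\<lambda>z. g (snd z) i)" for i
    by (rule continuous_on_product_then_coordinatewise)
  have "continuous_on ({0..1::real} \<times> S) ?h"
    by (intro continuous_on_coordinatewise_then_product continuous_intros cf cg)
  moreover have "?h \<in> {0..1} \<times> S \<rightarrow> T"
    using T by auto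
  ultimately show "continuous_map (prod_topology (top_of_set {0..1}) (top_of_set S)) (top_of_set T) ?h"
    by (simp add: prod_topology_top_of_set image_subset_iff_funcset)
  show "P (\<lambda>x. ?h (t, x))" if "t \<in> {0..1}" for t
    using P[of t] that by simp
qed auto

text \<open>Euclidean space of dimension \<open>n + 1\<close>, kept inside the sequences because
  \<open>standard_simplex\<close> lives there for every \<open>n\<close>.\<close>

definition zero_above :: "nat \<Rightarrow> (nat \<Rightarrow> real) set" where
  "zero_above n = {x. \<forall>i>n. x i = 0}"

text \<open>This line meets the standard simplex in its barycentre only. It is the direction that a
  linear map to dimension \<open>n\<close> will collapse, so that its complement corresponds to the
  complement of the origin.\<close>

definition diagonal_line :: "nat \<Rightarrow> (nat \<Rightarrow> real) set" where
  "diagonal_line n = {x \<in> zero_above n. \<forall>i\<le>n. x i = x 0}"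

text \<open>For positive \<open>n\<close> a closed half-plane bounded by the diagonal line, on the
  side away from vertex 0. Its complement is contractible, and face 0 is the only face of the
  simplex that meets it.\<close>

definition diagonal_ray :: "nat \<Rightarrow> (nat \<Rightarrow> real) set" where
  "diagonal_ray n = {x \<in> zero_above n. x 0 \<le> x 1 \<and> (\<forall>i\<in>{1..n}. x i = x 1)}"

lemma standard_simplex_zero_above: "standard_simplex n \<subseteq> zero_above n"
  by (auto simp: standard_simplex_def zero_above_def)

lemma contractible_zero_above: "contractible_space (top_of_set (zero_above n))"
  unfolding contractible_space_def
proof
  show "homotopic_with (\<lambda>x. True) (top_of_set (zero_above n)) (top_of_set (zero_above n)) id (\<lambda>x. (\<lambda>i. 0))"
    by (rule homotopic_with_linear_fun) (auto simp: zero_above_def)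
qed

text \<open>The set is star-shaped about vertex 0. If a point of the segment from \<open>x\<close>
  to that vertex lay on the half-plane, its coordinates from 1 on would agree and bound coordinate 0
  from above; dividing by \<open>1 - t\<close> gives the same for \<open>x\<close>.\<close>

lemma contractible_off_diagonal_ray:
  "contractible_space (top_of_set (zero_above (Suc n) - diagonal_ray (Suc n)))"
  unfolding contractible_space_def
proof
  let ?e = "\<lambda>i. if i = 0 then 1 else (0::real)"
  let ?T = "zero_above (Suc n) - diagonal_ray (Suc n)"
  show "homotopic_with (\<lambda>x. True) (top_of_set ?T) (top_of_set ?T) id (\<lambda>x. ?e)"
  proof (rule homotopic_with_linear_fun)
    fix x and t :: real
    assume x: "x \<in> ?T" and t: "0 \<le> t" "t \<le> 1"
    let ?y = "\<lambda>i. (1 - t) * id x i + t * ?e i"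
    have "?y \<in> zero_above (Suc n)"
      using x by (auto simp: zero_above_def)
    moreover have "?y \<notin> diagonal_ray (Suc n)"
    proof
      assume y: "?y \<in> diagonal_ray (Suc n)"
      then have "?y 0 \<le> ?y 1" and yy: "\<forall>i\<in>{1..Suc n}. ?y i = ?y 1"
        unfolding diagonal_ray_def by blast+
      then have y0: "(1 - t) * x 0 + t \<le> (1 - t) * x 1"
        by simp
      have yi: "(1 - t) * x i = (1 - t) * x 1" if "i \<in> {1..Suc n}" for i
        using bspec[OF yy that] that by simp
      have "t \<noteq> 1" using y0 by auto
      have "x 0 \<le> x 1"
      proof -
        have "(1 - t) * x 0 \<le> (1 - t) * x 1" "0 < 1 - t"
          using y0 t \<open>t \<noteq> 1\<close> by linarith+
        then show ?thesis by simp
      qed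
      moreover have "x i = x 1" if "i \<in> {1..Suc n}" for i
        using yi[OF that] \<open>t \<noteq> 1\<close> by simp
      ultimately show False
        using x unfolding diagonal_ray_def by blast
    qed
    ultimately show "?y \<in> ?T" by simp
  qed auto
qed

lemma diagonal_line_subset_ray: "diagonal_line (Suc n) \<subseteq> diagonal_ray (Suc n)"
proof
  fix x assume x: "x \<in> diagonal_line (Suc n)"
  then have e: "x i = x 0" if "i \<le> Suc n" for i
    using that unfolding diagonal_line_def by blast
  have "x 0 \<le> x 1" by (simp only: e[of 1])
  moreover have "x i = x 1" if "i \<in> {1..Suc n}" for i
    using that e[of i] e[of 1] by simp
  moreover have "x \<in> zero_above (Suc n)"
    using x unfolding diagonal_line_def by blast
  ultimately show "x \<in> diagonal_ray (Suc n)"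
    unfolding diagonal_ray_def by blast
qed

lemma closed_zero_above: "closed (zero_above n)"
proof -
  have "zero_above n = (\<Inter>i\<in>{n<..}. {x. x i = 0})"
    by (auto simp: zero_above_def)
  then show ?thesis
    by (auto intro!: closed_INT closed_Collect_eq continuous_on_product_coordinates)
qed

lemma closed_diagonal_ray: "closed (diagonal_ray n)"
proof -
  have "diagonal_ray n = zero_above n \<inter> ({x. x 0 \<le> x 1} \<inter> (\<Inter>i\<in>{1..n}. {x. x i = x 1}))"
    unfolding diagonal_ray_def by blast
  then show ?thesis
    by (auto intro!: closed_INT closed_Int closed_Collect_eq closed_Collect_le continuous_on_product_coordinates closed_zero_above)
qed

lemma singular_simplex_face_inclusion:
  assumes "k \<le> Suc n" "\<And>t. t \<in> standard_simplex n \<Longrightarrow> simplical_face k t \<in> S"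
  shows "singular_simplex n (top_of_set S) (restrict (simplical_face k) (standard_simplex n))"
proof -
  have "continuous_on (standard_simplex n) (simplical_face k :: _ \<Rightarrow> nat \<Rightarrow> real)"
  proof (rule continuous_on_coordinatewise_then_product)
    fix i
    show "continuous_on (standard_simplex n) (\<lambda>t. simplical_face k t i :: real)"
      by (cases "i < k"; cases "i = k")
        (auto simp: simplical_face_def intro: continuous_on_subset[OF continuous_on_product_coordinates])
  qed
  then show ?thesis
    using assms(2) by (simp add: singular_simplex_top_of_set)
qed

text \<open>Coordinate \<open>k\<close> is zero on this face, so on the half-plane every coordinate
  would be at most zero, although their sum is 1.\<close>

lemma face_off_diagonal_ray:
  assumes "t \<in> standard_simplex n" "1 \<le> k" "k \<le> Suc n"
  shows "simplical_face k t \<in> zero_above (Suc n) - diagonal_ray (Suc n)"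
proof -
  let ?y = "simplical_face k t :: nat \<Rightarrow> real"
  have y: "?y \<in> standard_simplex (Suc n)"
    using simplical_face_in_standard_simplex[of "Suc n" k t] assms by simp
  have "?y \<notin> diagonal_ray (Suc n)"
  proof
    assume r: "?y \<in> diagonal_ray (Suc n)"
    have "?y k = 0" by (simp add: simplical_face_def)
    moreover have "\<forall>i\<in>{1..Suc n}. ?y i = ?y 1" "?y 0 \<le> ?y 1"
      using r unfolding diagonal_ray_def by blast+
    ultimately have y1: "?y 1 = 0" "?y 0 \<le> ?y 1"
      using assms(2,3) by (metis atLeastAtMost_iff)+
    have z: "?y i = 0" if "i \<in> {1..Suc n}" for i
      using r that y1(1) unfolding diagonal_ray_def by fastforce
    then have "?y i \<le> 0" if "i \<le> Suc n" for i
      using that z[of i] y1 by (cases "i = 0") simp_all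
    then have "(\<Sum>i\<le>Suc n. ?y i) \<le> 0"
      by (intro sum_nonpos) auto
    then show False
      using y by (simp add: standard_simplex_def)
  qed
  then show ?thesis
    using y standard_simplex_zero_above by blast
qed

lemma zeroth_homology_generator:
  assumes X: "path_connected_space X" and f: "singular_simplex 0 X f"
  shows "homology_generator 0 X {} (frag_of f)"
proof -
  have c: "singular_relcycle 0 X {} (frag_of f)"
    by (simp add: chain_boundary_def f singular_chain_of singular_cycle)
  have "(\<lambda>k::int. homologous_rel_set 0 X {} (frag_of f) [^]\<^bsub>homology_group 0 X\<^esub> k) \<in> iso integer_group (homology_group 0 X)"
    using iso_integer_zeroth_homology_group[OF X f] by simp
  then have bij: "bij_betw (\<lambda>k::int. homologous_rel_set 0 X {} (frag_of f) [^]\<^bsub>homology_group 0 X\<^esub> k) UNIV (carrier (homology_group 0 X))"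
    by (simp add: iso_def)
  show ?thesis
    unfolding homology_generator_group[OF c] of_nat_0
  proof (intro conjI ballI allI impI)
    fix x assume "x \<in> carrier (homology_group 0 X)"
    then show "\<exists>k::int. x = homologous_rel_set 0 X {} (frag_of f) [^]\<^bsub>homology_group 0 X\<^esub> k"
      using bij_betw_imp_surj_on[OF bij] by blast
  next
    fix k :: int
    assume "homologous_rel_set 0 X {} (frag_of f) [^]\<^bsub>homology_group 0 X\<^esub> k = \<one>\<^bsub>homology_group 0 X\<^esub>"
    then have "homologous_rel_set 0 X {} (frag_of f) [^]\<^bsub>homology_group 0 X\<^esub> k
       = homologous_rel_set 0 X {} (frag_of f) [^]\<^bsub>homology_group 0 X\<^esub> (0::int)"
      by (simp add: int_pow_0)
    then show "k = 0"
      using bij_betw_imp_inj_on[OF bij] by (meson UNIV_I inj_onD)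
  qed
qed

lemma path_connected_contractible_zero_above: "path_connected_space (top_of_set (zero_above n))"
  by (rule contractible_imp_path_connected_space[OF contractible_zero_above])

abbreviation id_simplex :: "nat \<Rightarrow> (nat \<Rightarrow> real) \<Rightarrow> nat \<Rightarrow> real" where
  "id_simplex n \<equiv> restrict id (standard_simplex n)"

lemma singular_simplex_id_simplex: "singular_simplex n (top_of_set (zero_above n)) (id_simplex n)"
  using standard_simplex_zero_above[of n] by (auto simp: singular_simplex_top_of_set)

lemma singular_face_id_simplex:
  assumes "k \<le> Suc n"
  shows "singular_face (Suc n) k (id_simplex (Suc n)) = restrict (simplical_face k) (standard_simplex n)"
proof -
  have "singular_face (Suc n) k (id_simplex (Suc n)) = singular_face (Suc n) k id"
    using assms by (intro singular_face_restrict) auto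
  then show ?thesis
    by (simp add: singular_face_def)
qed

lemma simplical_face_0_off_line:
  assumes "t \<in> standard_simplex n"
  shows "simplical_face 0 t \<in> zero_above (Suc n) - diagonal_line (Suc n)"
proof -
  let ?y = "simplical_face 0 t :: nat \<Rightarrow> real"
  have y: "?y \<in> standard_simplex (Suc n)"
    using simplical_face_in_standard_simplex[of "Suc n" 0 t] assms by simp
  have "?y \<notin> diagonal_line (Suc n)"
  proof
    assume "?y \<in> diagonal_line (Suc n)"
    then have "\<forall>i\<le>Suc n. ?y i = ?y 0" unfolding diagonal_line_def by blast
    moreover have "?y 0 = 0" by (simp add: simplical_face_def)
    ultimately have "(\<Sum>i\<le>Suc n. ?y i) = 0" by simp
    then show False using y by (simp add: standard_simplex_def)
  qed
  then show ?thesis using y standard_simplex_zero_above by blast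
qed

lemma relcycle_id_simplex:
  "singular_relcycle n (top_of_set (zero_above n)) (zero_above n - diagonal_line n) (frag_of (id_simplex n))"
proof (cases n)
  case 0
  then show ?thesis
    using singular_simplex_id_simplex[of 0] by (simp add: singular_relcycle singular_chain_of chain_boundary_def)
next
  case (Suc m)
  let ?S = "zero_above (Suc m) - diagonal_line (Suc m)"
  have "singular_simplex m (top_of_set ?S) (singular_face (Suc m) k (id_simplex (Suc m)))" if "k \<le> Suc m" for k
    unfolding singular_face_id_simplex[OF that]
  proof (rule singular_simplex_face_inclusion[OF that])
    fix t assume t: "t \<in> standard_simplex m"
    show "simplical_face k t \<in> ?S"
    proof (cases "k = 0")
      case True then show ?thesis using simplical_face_0_off_line[OF t] by simp
    next
      case False then show ?thesis
        using face_off_diagonal_ray[OF t, of k] that diagonal_line_subset_ray[of m] by auto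
    qed
  qed
  then have "singular_chain m (top_of_set ?S) (chain_boundary (Suc m) (frag_of (id_simplex (Suc m))))"
    unfolding chain_boundary_of by (auto intro!: singular_chain_sum singular_chain_cmul simp: singular_chain_of simp del: sum.atMost_Suc)
  then show ?thesis
    using singular_simplex_id_simplex[of "Suc m"] Suc
    by (simp add: singular_relcycle singular_chain_of subtopology_subtopology Int_absorb1 Int_Diff)
qed

definition drop_first :: "(nat \<Rightarrow> real) \<Rightarrow> nat \<Rightarrow> real" where
  "drop_first x = (\<lambda>i. x (Suc i))"

text \<open>A section of \<open>drop_first\<close> with values in \<open>low_first n\<close>;
  coordinate 0 is placed one unit below the mean of the others.\<close>

definition add_first :: "nat \<Rightarrow> (nat \<Rightarrow> real) \<Rightarrow> nat \<Rightarrow> real" where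
  "add_first n y = (\<lambda>i. case i of 0 \<Rightarrow> (\<Sum>j\<le>n. y j) / (n + 1) - 1 | Suc j \<Rightarrow> y j)"

text \<open>An open half-space that misses the diagonal line and contains the rest of the
  half-plane, so excision may restrict to it. Its fibres over the coordinates from 1 on are open
  rays, hence forgetting coordinate 0 loses no homology.\<close>

definition low_first :: "nat \<Rightarrow> (nat \<Rightarrow> real) set" where
  "low_first n = {x \<in> zero_above (Suc n). x 0 < (\<Sum>j\<le>n. x (Suc j)) / (n + 1)}"

lemma drop_first_line:
  assumes "x \<in> low_first n"
  shows "drop_first x \<in> diagonal_line n \<longleftrightarrow> x \<in> diagonal_ray (Suc n)"
proof
  assume "drop_first x \<in> diagonal_line n"
  then have "\<forall>i\<le>n. drop_first x i = drop_first x 0"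
    unfolding diagonal_line_def by blast
  then have e: "x (Suc i) = x 1" if "i \<le> n" for i
    using that unfolding drop_first_def One_nat_def by blast
  have "(\<Sum>j\<le>n. x (Suc j)) = (\<Sum>j\<le>n. x 1)"
    by (rule sum.cong[OF refl]) (use e in blast)
  then have "x 0 \<le> x 1"
    using assms by (simp add: low_first_def)
  moreover have "x i = x 1" if "i \<in> {1..Suc n}" for i
  proof -
    obtain j where "i = Suc j" "j \<le> n" using \<open>i \<in> {1..Suc n}\<close> by (cases i) auto
    then show ?thesis using e[of j] by simp
  qed
  ultimately show "x \<in> diagonal_ray (Suc n)"
    using assms unfolding low_first_def diagonal_ray_def by blast
next
  assume x: "x \<in> diagonal_ray (Suc n)"
  then have e: "\<forall>i\<in>{1..Suc n}. x i = x 1" unfolding diagonal_ray_def by blast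
  have "x (Suc i) = x (Suc 0)" if "i \<le> n" for i
    using bspec[OF e, of "Suc i"] that by simp
  moreover have "drop_first x \<in> zero_above n"
    using x by (simp add: drop_first_def diagonal_ray_def zero_above_def)
  ultimately show "drop_first x \<in> diagonal_line n"
    unfolding diagonal_line_def drop_first_def by blast
qed

lemma low_first_off_line: "low_first n \<inter> diagonal_line (Suc n) = {}"
proof -
  have False if x: "x \<in> low_first n" and l: "x \<in> diagonal_line (Suc n)" for x
  proof -
    have e: "\<forall>i\<le>Suc n. x i = x 0" using l unfolding diagonal_line_def by blast
    have "(\<Sum>j\<le>n. x (Suc j)) = (\<Sum>j\<le>n. x 0)"
      by (rule sum.cong[OF refl]) (use e in \<open>meson atMost_iff Suc_le_mono\<close>)
    then show False using x by (simp add: low_first_def)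
  qed
  then show ?thesis by blast
qed

lemma ray_minus_line_low_first: "diagonal_ray (Suc n) - diagonal_line (Suc n) \<subseteq> low_first n"
proof
  fix x assume x: "x \<in> diagonal_ray (Suc n) - diagonal_line (Suc n)"
  have e: "\<forall>i\<in>{1..Suc n}. x i = x 1" and le: "x 0 \<le> x 1" and z: "x \<in> zero_above (Suc n)"
    using x unfolding diagonal_ray_def by blast+
  have "x 0 \<noteq> x 1"
  proof
    assume eq: "x 0 = x 1"
    have "x i = x 0" if "i \<le> Suc n" for i
      using bspec[OF e, of i] that eq by (cases "i = 0") simp_all
    then show False using x z unfolding diagonal_line_def by blast
  qed
  moreover have "(\<Sum>j\<le>n. x (Suc j)) = (\<Sum>j\<le>n. x 1)"
  proof (rule sum.cong[OF refl])
    fix j assume "j \<in> {..n}"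
    then have "Suc j \<in> {1..Suc n}" by simp
    then show "x (Suc j) = x 1" using e by blast
  qed
  ultimately show "x \<in> low_first n"
    using le z by (simp add: low_first_def)
qed

lemma continuous_on_coordinate [continuous_intros]: "continuous_on S (\<lambda>x. (x i :: real))"
  by (rule continuous_on_subset[OF continuous_on_product_coordinates]) auto

lemma convex_lower_less:
  fixes a m t :: real
  assumes "a < m" "0 \<le> t" "t \<le> 1"
  shows "(1 - t) * (m - 1) + t * a < m"
proof (cases "t = 0")
  case False
  then have "t * a < t * m" using assms by simp
  then show ?thesis using assms by (simp add: algebra_simps)
qed simp

text \<open>Along the segment from \<open>add_first n (drop_first x)\<close> to \<open>x\<close>
  only coordinate 0 moves, and it stays below the mean. Inside \<open>low_first n\<close> it depends
  on \<open>drop_first x\<close> alone whether \<open>x\<close> is on the half-plane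
  (\<open>drop_first_line\<close>), so the homotopy respects the pair.\<close>

lemma hom_induced_drop_first_iso:
  "hom_induced p (top_of_set (low_first n)) (low_first n - diagonal_ray (Suc n))
     (top_of_set (zero_above n)) (zero_above n - diagonal_line n) drop_first
   \<in> iso (relative_homology_group p (top_of_set (low_first n)) (low_first n - diagonal_ray (Suc n)))
         (relative_homology_group p (top_of_set (zero_above n)) (zero_above n - diagonal_line n))"
proof (rule homotopy_equivalence_relative_homology_group_isomorphism)
  have d: "drop_first \<in> low_first n \<rightarrow> zero_above n"
    by (auto simp: drop_first_def low_first_def zero_above_def)
  have a: "add_first n \<in> zero_above n \<rightarrow> low_first n"
    by (auto simp: add_first_def low_first_def zero_above_def split: nat.split)
  have da: "drop_first (add_first n y) = y" for y
    by (simp add: drop_first_def add_first_def)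
  have cd: "continuous_on S drop_first" for S
    unfolding drop_first_def by (intro continuous_on_coordinatewise_then_product continuous_intros)
  have ca: "continuous_on S (add_first n)" for S
  proof (rule continuous_on_coordinatewise_then_product)
    fix i show "continuous_on S (\<lambda>y. add_first n y i)"
      by (cases i) (auto simp: add_first_def intro!: continuous_intros)
  qed
  show "continuous_map (top_of_set (low_first n)) (top_of_set (zero_above n)) drop_first"
    using cd d by (simp add: image_subset_iff_funcset)
  show "drop_first \<in> low_first n - diagonal_ray (Suc n) \<rightarrow> zero_above n - diagonal_line n"
    using d drop_first_line by auto
  show "continuous_map (top_of_set (zero_above n)) (top_of_set (low_first n)) (add_first n)"
    using ca a by (simp add: image_subset_iff_funcset)
  show "add_first n \<in> zero_above n - diagonal_line n \<rightarrow> low_first n - diagonal_ray (Suc n)"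
    using a drop_first_line[of "add_first n _"] by (auto simp: da)
  show "homotopic_with (\<lambda>k. k \<in> zero_above n - diagonal_line n \<rightarrow> zero_above n - diagonal_line n)
     (top_of_set (zero_above n)) (top_of_set (zero_above n)) (drop_first \<circ> add_first n) id"
    by (simp add: comp_def da id_def)
  let ?L = "low_first n" and ?R = "diagonal_ray (Suc n)"
  have lin: "(\<lambda>i. (1 - t) * (add_first n \<circ> drop_first) x i + t * id x i) \<in> low_first n" (is "?y \<in> _")
    and lind: "drop_first (\<lambda>i. (1 - t) * (add_first n \<circ> drop_first) x i + t * id x i) = drop_first x"
    if x: "x \<in> low_first n" and t: "0 \<le> t" "t \<le> 1" for x and t :: real
  proof -
    have s: "?y (Suc i) = x (Suc i)" for i
      by (simp add: add_first_def drop_first_def algebra_simps)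
    let ?m = "(\<Sum>j\<le>n. x (Suc j)) / (n + 1)"
    have "?y 0 = (1 - t) * (?m - 1) + t * x 0"
      by (simp add: add_first_def drop_first_def)
    also have "\<dots> < ?m"
    proof -
      have lt: "x 0 < ?m" using x by (simp add: low_first_def)
      then show ?thesis using t by (rule convex_lower_less)
    qed
    finally have y0: "?y 0 < ?m" .
    have z: "?y \<in> zero_above (Suc n)"
      unfolding zero_above_def
    proof (intro CollectI allI impI)
      fix i assume "Suc n < i"
      then show "?y i = 0" using s[of "i - 1"] x by (simp add: low_first_def zero_above_def)
    qed
    show "?y \<in> low_first n"
      unfolding low_first_def mem_Collect_eq s using y0 z by blast
    show "drop_first ?y = drop_first x"
      using s by (simp add: drop_first_def)
  qed
  show "homotopic_with (\<lambda>h. h \<in> ?L - ?R \<rightarrow> ?L - ?R) (top_of_set ?L) (top_of_set ?L) (add_first n \<circ> drop_first) id"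
  proof (rule homotopic_with_linear_fun)
    show "continuous_on ?L (add_first n \<circ> drop_first)"
      by (intro continuous_on_compose cd ca)
    show "(\<lambda>x i. (1 - t) * (add_first n \<circ> drop_first) x i + t * id x i) \<in> ?L - ?R \<rightarrow> ?L - ?R"
      if "0 \<le> t" "t \<le> 1" for t
    proof
      fix x assume x: "x \<in> ?L - ?R"
      let ?y = "\<lambda>i. (1 - t) * (add_first n \<circ> drop_first) x i + t * id x i"
      have "?y \<in> ?L" using lin[OF _ that] x by blast
      moreover have "?y \<notin> ?R"
        using drop_first_line[OF \<open>?y \<in> ?L\<close>] drop_first_line[of x n] lind[OF _ that, of x] x by simp
      ultimately show "?y \<in> ?L - ?R" by blast
    qed
  qed (use lin in \<open>auto simp: continuous_on_id\<close>)
qed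

lemma openin_low_first: "openin (top_of_set (zero_above (Suc n) - diagonal_line (Suc n))) (low_first n)"
proof -
  have "low_first n = (zero_above (Suc n) - diagonal_line (Suc n)) \<inter> {x. x 0 < (\<Sum>j\<le>n. x (Suc j)) / (n + 1)}"
    using low_first_off_line[of n] by (auto simp: low_first_def)
  moreover have "open {x :: nat \<Rightarrow> real. x 0 < (\<Sum>j\<le>n. x (Suc j)) / (n + 1)}"
    by (intro open_Collect_less continuous_intros) auto
  ultimately show ?thesis by auto
qed

text \<open>Induction on the dimension. Let E be the ambient space, L the line and R the half-plane.
  The boundary map of the triple (E, E - L, E - R) is an isomorphism because E and E - R are
  contractible. It sends the simplex to its face 0, as the other faces lie in E - R. Excision to
  \<open>low_first n\<close> and \<open>drop_first\<close> turn face 0 into the simplex one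
  dimension lower.\<close>

theorem homology_generator_id_simplex:
  "homology_generator n (top_of_set (zero_above n)) (zero_above n - diagonal_line n) (frag_of (id_simplex n))"
proof (induction n)
  case 0
  \<comment> \<open>In dimension zero the line is the whole space, and the relative group is the
    absolute one of a path-connected space.\<close>
  have "zero_above 0 - diagonal_line 0 = {}"
    by (auto simp: diagonal_line_def)
  then show ?case
    using zeroth_homology_generator[OF path_connected_contractible_zero_above singular_simplex_id_simplex]
    by (simp only:)
next
  case (Suc n)
  let ?X = "top_of_set (zero_above (Suc n))"
  let ?S = "zero_above (Suc n) - diagonal_line (Suc n)"
  let ?T = "zero_above (Suc n) - diagonal_ray (Suc n)"
  let ?K = "diagonal_ray (Suc n) - diagonal_line (Suc n)"
  let ?U = "low_first n"
  let ?f = "restrict (simplical_face 0) (standard_simplex n) :: _ \<Rightarrow> nat \<Rightarrow> real"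
  have TS: "?T \<subseteq> ?S" using diagonal_line_subset_ray by blast
  have sub: "subtopology ?X ?S = top_of_set ?S" and subT: "subtopology ?X ?T = top_of_set ?T"
    by (simp_all add: subtopology_subtopology Int_absorb1)
  have subST: "subtopology (top_of_set ?S) ?T = top_of_set ?T"
    using TS by (simp add: subtopology_subtopology Int_absorb1)
  have US: "?U \<subseteq> ?S" using low_first_off_line[of n] by (auto simp: low_first_def)
  have subU: "subtopology (top_of_set ?S) ?U = top_of_set ?U"
    using US by (simp add: subtopology_subtopology Int_absorb1)
  have f_in: "simplical_face 0 t \<in> ?U" if t: "t \<in> standard_simplex n" for t
  proof -
    have "simplical_face 0 t \<in> zero_above (Suc n)"
      using simplical_face_0_off_line[OF t] by blast
    moreover have "(\<Sum>j\<le>n. t j) = 1" using t by (simp add: standard_simplex_def)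
    ultimately show ?thesis by (simp add: low_first_def simplical_face_def)
  qed
  have fU: "singular_simplex n (top_of_set ?U) ?f"
    by (rule singular_simplex_face_inclusion) (use f_in in auto)
  have drop_f: "simplex_map n drop_first ?f = id_simplex n"
    by (auto simp: simplex_map_def drop_first_def simplical_face_def fun_eq_iff)
  have bd: "chain_boundary (Suc n) (frag_of (id_simplex (Suc n)))
      = (\<Sum>k\<le>Suc n. frag_cmul ((-1)^k) (frag_of (restrict (simplical_face k) (standard_simplex n))))"
  proof -
    have "(\<Sum>k\<le>Suc n. frag_cmul ((-1)^k) (frag_of (singular_face (Suc n) k (id_simplex (Suc n)))))
      = (\<Sum>k\<le>Suc n. frag_cmul ((-1)^k) (frag_of (restrict (simplical_face k) (standard_simplex n))))"
      by (rule sum.cong[OF refl]) (simp only: atMost_iff singular_face_id_simplex)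
    then show ?thesis unfolding chain_boundary_of by simp
  qed
  let ?r = "\<Sum>k\<in>{1..Suc n}. frag_cmul ((-1)^k) (frag_of (restrict (simplical_face k) (standard_simplex n))) :: (nat \<Rightarrow> real) chain"
  have bd2: "chain_boundary (Suc n) (frag_of (id_simplex (Suc n))) = frag_of ?f + ?r"
  proof -
    have "{..Suc n} = insert 0 {1..Suc n}" by auto
    then show ?thesis unfolding bd by (simp del: sum.atMost_Suc)
  qed
  have r: "singular_chain n (top_of_set ?T) ?r"
    by (intro singular_chain_sum singular_chain_cmul)
      (auto simp: singular_chain_of intro!: singular_simplex_face_inclusion dest: face_off_diagonal_ray)
  \<comment> \<open>The boundary of a boundary vanishes, so the boundary of face 0 is minus that of
    \<open>?r\<close>, which lies off the half-plane.\<close>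
  have cf: "singular_chain (n - 1) (top_of_set ?T) (chain_boundary n (frag_of ?f))"
  proof -
    have "chain_boundary n (frag_of ?f + ?r) = 0"
      using chain_boundary_boundary_alt[of n ?X "frag_of (id_simplex (Suc n))"] singular_simplex_id_simplex[of "Suc n"]
      by (simp only: bd2[symmetric] singular_chain_of)
    then have "chain_boundary n (frag_of ?f) = - chain_boundary n ?r"
      by (simp only: chain_boundary_add eq_neg_iff_add_eq_0)
    then show ?thesis
      using singular_chain_boundary[OF r] by (simp only: singular_chain_minus One_nat_def)
  qed
  have fS: "singular_chain n (top_of_set ?S) (frag_of ?f)"
    using fU singular_chain_mono[of n euclidean ?U "frag_of ?f" ?S] US by (simp add: singular_chain_of)
  have rcS: "singular_relcycle n (top_of_set ?S) ?T (frag_of ?f)"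
    unfolding singular_relcycle subST using fS cf by simp
  have "singular_chain (n - 1) (top_of_set (?U \<inter> ?T)) (chain_boundary n (frag_of ?f))"
  proof -
    have "singular_chain (n - 1) (top_of_set ?U) (chain_boundary n (frag_of ?f))"
      using singular_chain_boundary[of n "top_of_set ?U" "frag_of ?f"] fU by (simp add: singular_chain_of)
    then show ?thesis
      using cf by (simp add: singular_chain_subtopology[of _ euclidean])
  qed
  moreover have UT: "?U \<inter> ?T = ?U - diagonal_ray (Suc n)"
    by (auto simp: low_first_def)
  ultimately have rcU: "singular_relcycle n (top_of_set ?U) (?U - diagonal_ray (Suc n)) (frag_of ?f)"
    using fU by (simp add: singular_relcycle singular_chain_of subtopology_subtopology Int_absorb1 Diff_subset)
  have "homology_generator n (top_of_set ?U) (?U - diagonal_ray (Suc n)) (frag_of ?f)"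
  proof (rule homology_generator_hom_induced_iso[OF hom_induced_drop_first_iso _ _ rcU, THEN iffD2])
    show "continuous_map (top_of_set ?U) (top_of_set (zero_above n)) drop_first"
      unfolding drop_first_def
      by (auto simp: low_first_def zero_above_def intro!: continuous_on_coordinatewise_then_product continuous_intros)
    show "drop_first \<in> ?U - diagonal_ray (Suc n) \<rightarrow> zero_above n - diagonal_line n"
      using drop_first_line by (auto simp: low_first_def zero_above_def drop_first_def)
    show "homology_generator n (top_of_set (zero_above n)) (zero_above n - diagonal_line n) (chain_map n drop_first (frag_of ?f))"
      using Suc.IH by (simp only: chain_map_of drop_f)
  qed
  moreover have "hom_induced n (top_of_set ?U) (?U - diagonal_ray (Suc n)) (top_of_set ?S) ?T id
    \<in> iso (relative_homology_group n (top_of_set ?U) (?U - diagonal_ray (Suc n))) (relative_homology_group n (top_of_set ?S) ?T)"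
  proof -
    have "?K = ?S \<inter> diagonal_ray (Suc n)" unfolding diagonal_ray_def by blast
    then have cl: "closedin (top_of_set ?S) ?K"
      using closedin_closed_Int[OF closed_diagonal_ray] by metis
    have e1: "?U - ?K = ?U - diagonal_ray (Suc n)" using low_first_off_line[of n] by blast
    have e2: "?S - ?K = ?T" using diagonal_line_subset_ray[of n] by blast
    from homology_open_iso[OF openin_low_first cl ray_minus_line_low_first, of "int n"]
    show ?thesis
      unfolding topspace_euclidean_subtopology e1 e2 subU .
  qed
  ultimately have genS: "homology_generator n (top_of_set ?S) ?T (frag_of ?f)"
  proof (subst (asm) homology_generator_hom_induced_iso[of n _ _ "top_of_set ?S" ?T id])
    show "continuous_map (top_of_set ?U) (top_of_set ?S) id" using US by auto
    show "id \<in> ?U - diagonal_ray (Suc n) \<rightarrow> ?T" by (auto simp: low_first_def)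
    show "homology_generator n (top_of_set ?S) ?T (chain_map n id (frag_of ?f)) \<Longrightarrow> ?thesis"
      using fU by (simp add: chain_map_ident[of _ "top_of_set ?U"] singular_chain_of)
  qed (use rcU in auto)
  have iso: "hom_relboundary (int (Suc n)) ?X ?S ?T
      \<in> iso (relative_homology_group (int (Suc n)) ?X ?S) (relative_homology_group (int n) (top_of_set ?S) ?T)"
  proof -
    have ne: "topspace ?X \<inter> ?T \<noteq> {}"
      using face_off_diagonal_ray[of _ n 1] nonempty_standard_simplex[of n] by fastforce
    show ?thesis
      using iso_hom_relboundary_contractible[of ?X ?T ?S "int (Suc n)", unfolded subT sub,
          OF contractible_zero_above contractible_off_diagonal_ray TS ne] by simp
  qed
  have "hom_relboundary (int (Suc n)) ?X ?S ?T (homologous_rel_set (Suc n) ?X ?S (frag_of (id_simplex (Suc n))))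
      = homologous_rel_set n (top_of_set ?S) ?T (frag_of ?f)"
  proof -
    have e: "int (Suc n) - 1 = int n" by simp
    have 1: "hom_boundary (int (Suc n)) ?X ?S (homologous_rel_set (Suc n) ?X ?S (frag_of (id_simplex (Suc n))))
       = homologous_rel_set n (top_of_set ?S) {} (frag_of ?f + ?r)"
      using hom_boundary_chain_boundary[OF relcycle_id_simplex[of "Suc n"]] unfolding sub bd2 by simp
    have "singular_chain n (top_of_set ?S) (frag_of ?f + ?r)"
      using relcycle_id_simplex[of "Suc n"] unfolding singular_relcycle sub bd2 by simp
    moreover have "chain_boundary n (frag_of ?f + ?r) = 0"
      using chain_boundary_boundary_alt[of n ?X "frag_of (id_simplex (Suc n))"] singular_simplex_id_simplex[of "Suc n"]
      by (simp only: bd2[symmetric] singular_chain_of)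
    ultimately have cyc: "singular_relcycle n (top_of_set ?S) {} (frag_of ?f + ?r)"
      by (simp only: singular_cycle)
    have 2: "hom_induced (int n) (top_of_set ?S) {} (top_of_set ?S) ?T id (homologous_rel_set n (top_of_set ?S) {} (frag_of ?f + ?r))
       = homologous_rel_set n (top_of_set ?S) ?T (frag_of ?f + ?r)"
    proof -
      have "chain_map n id (frag_of ?f + ?r) = frag_of ?f + ?r"
        by (rule chain_map_ident[OF \<open>singular_chain n (top_of_set ?S) (frag_of ?f + ?r)\<close>])
      then show ?thesis
        using hom_induced_chain_map[OF _ _ cyc, of "top_of_set ?S" id ?T]
        by (simp only: continuous_map_id empty_subsetI Pi_empty UNIV_I)
    qed
    have "homologous_rel n (top_of_set ?S) ?T (frag_of ?f + ?r) (frag_of ?f)"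
      using r by (auto simp: homologous_rel_def subST intro!: singular_chain_imp_relboundary)
    then show ?thesis
      by (simp only: hom_relboundary_def comp_def 1 sub 2 homologous_rel_set_eq e)
  qed
  from homology_generator_iso[OF iso relcycle_id_simplex rcS this] genS show ?case by blast
qed

section \<open>Local degree by comparison with an affine simplex\<close>

text \<open>With kernel exactly the diagonal line and a section \<open>s\<close>, the map
  \<open>l\<close> is a homotopy equivalence of pairs: the segment between \<open>s (l x)\<close>
  and \<open>x\<close> is mapped by \<open>l\<close> to a single point, so it never enters the line
  from outside.\<close>

lemma homology_generator_linear:
  fixes l :: "(nat \<Rightarrow> real) \<Rightarrow> 'a::real_normed_vector" and s :: "'a \<Rightarrow> nat \<Rightarrow> real"
  assumes cl: "continuous_on (zero_above n) l" and cs: "continuous_on UNIV s"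
    and s: "\<And>v. s v \<in> zero_above n" "\<And>v. l (s v) = v"
    and ker: "\<And>x. x \<in> zero_above n \<Longrightarrow> l x = 0 \<longleftrightarrow> x \<in> diagonal_line n"
    and lin: "\<And>x y t. l (\<lambda>i. (1 - t) * x i + t * y i) = (1 - t) *\<^sub>R l x + t *\<^sub>R l y"
  shows "homology_generator n euclidean (UNIV - {0}) (frag_of (restrict l (standard_simplex n)))"
proof -
  let ?E = "zero_above n" and ?D = "diagonal_line n"
  have cl': "continuous_map (top_of_set ?E) euclidean l" using cl by simp
  have lD: "l \<in> ?E - ?D \<rightarrow> UNIV - {0}" using ker by auto
  have iso: "hom_induced (int n) (top_of_set ?E) (?E - ?D) euclidean (UNIV - {0}) l
    \<in> iso (relative_homology_group (int n) (top_of_set ?E) (?E - ?D)) (relative_homology_group (int n) euclidean (UNIV - {0}))"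
  proof (rule homotopy_equivalence_relative_homology_group_isomorphism[OF cl' lD])
    show "continuous_map euclidean (top_of_set ?E) s"
      using cs s by (auto simp: continuous_map_in_subtopology)
    show "s \<in> UNIV - {0} \<rightarrow> ?E - ?D"
      using s ker[OF s(1)] by auto
    show "homotopic_with (\<lambda>k. k \<in> UNIV - {0} \<rightarrow> UNIV - {0}) euclidean euclidean (l \<circ> s) id"
      by (simp add: comp_def s(2) id_def)
    show "homotopic_with (\<lambda>h. h \<in> ?E - ?D \<rightarrow> ?E - ?D) (top_of_set ?E) (top_of_set ?E) (s \<circ> l) id"
    proof (rule homotopic_with_linear_fun)
      show "continuous_on ?E (s \<circ> l)"
        by (intro continuous_on_compose cl continuous_on_subset[OF cs]) auto
      show "continuous_on ?E id" by simp
      show in_E: "(\<lambda>i. (1 - t) * (s \<circ> l) x i + t * id x i) \<in> ?E" if "x \<in> ?E" for x and t :: real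
        using s(1)[of "l x"] that by (simp add: zero_above_def)
      have "l (\<lambda>i. (1 - t) * (s \<circ> l) x i + t * id x i) = l x" for x t
        unfolding lin by (simp add: s(2) flip: scaleR_add_left)
      then show "(\<lambda>x i. (1 - t) * (s \<circ> l) x i + t * id x i) \<in> ?E - ?D \<rightarrow> ?E - ?D" for t
        using in_E[of _ t] ker by (metis (no_types, lifting) Diff_iff Pi_I)
    qed
  qed
  have e: "simplex_map n l (id_simplex n) = restrict l (standard_simplex n)"
    by (auto simp: simplex_map_def)
  have "homology_generator n euclidean (UNIV - {0}) (chain_map n l (frag_of (id_simplex n)))"
    using homology_generator_hom_induced_iso[OF iso cl' lD relcycle_id_simplex] homology_generator_id_simplex by blast
  then show ?thesis unfolding chain_map_of e .
qed

text \<open>The vertices go to (-1, -1), (1 - i, 0), (1 + i, 0) and (-1, 1), a tetrahedron around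
  the origin. The last coordinate vanishes for \<open>t 3 = t 0\<close> and the imaginary part for
  \<open>t 1 = t 2\<close>; the comparisons below come down mainly to the sign of the remaining real
  part at such points.\<close>

definition reference_map :: "(nat \<Rightarrow> real) \<Rightarrow> complex \<times> real" where
  "reference_map t = (Complex (t 1 + t 2 - t 0 - t 3) (t 2 - t 1), t 3 - t 0)"

lemma le_3_cases: "i \<le> (3::nat) \<longleftrightarrow> i = 0 \<or> i = 1 \<or> i = 2 \<or> i = 3"
  by auto

lemma homology_generator_reference_map:
  "homology_generator 3 euclidean (UNIV - {0}) (frag_of (restrict reference_map (standard_simplex 3)))"
proof (rule homology_generator_linear)
  \<comment> \<open>The preimage normalized by \<open>t 0 + t 3 = 0\<close>.\<close>
  let ?s = "\<lambda>v::complex \<times> real. \<lambda>i::nat. if i = 0 then - snd v / 2 else if i = 1 then (Re (fst v) - Im (fst v)) / 2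
     else if i = 2 then (Re (fst v) + Im (fst v)) / 2 else if i = 3 then snd v / 2 else 0"
  show "continuous_on (zero_above 3) reference_map"
    unfolding reference_map_def by (intro continuous_intros continuous_on_Complex)
  show "continuous_on UNIV ?s"
  proof (rule continuous_on_coordinatewise_then_product)
    fix i show "continuous_on UNIV (\<lambda>v. ?s v i)"
      by (cases "i = 0"; cases "i = 1"; cases "i = 2"; cases "i = 3") (auto intro!: continuous_intros)
  qed
  show "?s v \<in> zero_above 3" for v by (auto simp: zero_above_def)
  show "reference_map (?s v) = v" for v
    by (cases v) (simp add: reference_map_def complex_eq_iff field_simps)
  show "reference_map x = 0 \<longleftrightarrow> x \<in> diagonal_line 3" if "x \<in> zero_above 3" for x
  proof
    assume "reference_map x = 0"
    then have e: "x 1 = x 0" "x 2 = x 0" "x 3 = x 0"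
      by (auto simp: reference_map_def zero_prod_def complex_eq_iff)
    have "x i = x 0" if "i \<le> 3" for i
      using that e unfolding le_3_cases by auto
    then show "x \<in> diagonal_line 3" using that unfolding diagonal_line_def by blast
  next
    assume "x \<in> diagonal_line 3"
    then have "\<forall>i\<le>3. x i = x 0" unfolding diagonal_line_def by blast
    then have "x 1 = x 0" "x 2 = x 0" "x 3 = x 0" by (metis le_3_cases)+
    then show "reference_map x = 0" by (simp add: reference_map_def zero_prod_def complex_eq_iff)
  qed
  show "reference_map (\<lambda>i. (1 - t) * x i + t * y i) = (1 - t) *\<^sub>R reference_map x + t *\<^sub>R reference_map y" for x y t
    by (simp add: reference_map_def complex_eq_iff algebra_simps)
qed

definition simplex_frontier :: "nat \<Rightarrow> (nat \<Rightarrow> real) set" where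
  "simplex_frontier n = {t \<in> standard_simplex n. \<exists>i\<le>n. t i = 0}"

lemma simplical_face_frontier:
  assumes "t \<in> standard_simplex n" "k \<le> Suc n"
  shows "simplical_face k t \<in> simplex_frontier (Suc n)"
proof -
  have "simplical_face k t \<in> standard_simplex (Suc n)"
    using simplical_face_in_standard_simplex[of "Suc n" k t] assms by simp
  moreover have "(simplical_face k t :: nat \<Rightarrow> real) k = 0"
    by (simp add: simplical_face_def)
  ultimately show ?thesis using assms unfolding simplex_frontier_def by blast
qed

lemma relcycle_id_simplex_frontier:
  "singular_relcycle (Suc n) (top_of_set (standard_simplex (Suc n))) (simplex_frontier (Suc n)) (frag_of (id_simplex (Suc n)))"
proof -
  let ?F = "simplex_frontier (Suc n)"
  have F: "?F \<subseteq> standard_simplex (Suc n)" by (auto simp: simplex_frontier_def)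
  have "singular_simplex n (top_of_set ?F) (singular_face (Suc n) k (id_simplex (Suc n)))" if "k \<le> Suc n" for k
    unfolding singular_face_id_simplex[OF that]
    by (rule singular_simplex_face_inclusion[OF that]) (use simplical_face_frontier that in blast)
  then have "singular_chain n (top_of_set ?F) (chain_boundary (Suc n) (frag_of (id_simplex (Suc n))))"
    unfolding chain_boundary_of by (auto intro!: singular_chain_sum singular_chain_cmul simp: singular_chain_of simp del: sum.atMost_Suc)
  moreover have "singular_simplex (Suc n) (top_of_set (standard_simplex (Suc n))) (id_simplex (Suc n))"
    by (auto simp: singular_simplex_top_of_set)
  ultimately show ?thesis
    using F by (simp add: singular_relcycle singular_chain_of subtopology_subtopology Int_absorb1)
qed

text \<open>Homotopy invariance, applied to the identity simplex as a relative cycle of the simplex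
  modulo its frontier.\<close>

lemma homologous_rel_simplex_homotopy:
  fixes f g :: "(nat \<Rightarrow> real) \<Rightarrow> 'b::topological_space"
  assumes "homotopic_with (\<lambda>h. h \<in> simplex_frontier (Suc n) \<rightarrow> V) (top_of_set (standard_simplex (Suc n))) Y f g"
  shows "homologous_rel (Suc n) Y V (frag_of (restrict f (standard_simplex (Suc n)))) (frag_of (restrict g (standard_simplex (Suc n))))"
proof -
  have e: "simplex_map (Suc n) h (id_simplex (Suc n)) = restrict h (standard_simplex (Suc n))" for h :: "_ \<Rightarrow> 'b"
    by (auto simp: simplex_map_def)
  show ?thesis
    using homotopic_imp_homologous_rel_chain_maps[OF assms relcycle_id_simplex_frontier] by (simp only: chain_map_of e)
qed

text \<open>The chart carries \<open>reference_map\<close> to a generator at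
  \<open>\<phi> 0\<close>. Two homotopies lead from there to \<tau>: segments inside the chart,
  which must avoid 0 for frontier points only, and then \<open>hom\<close>, which takes place in
  \<open>S\<close> and may leave the chart.\<close>

lemma homology_generator_chart:
  fixes \<phi> :: "complex \<times> real \<Rightarrow> 'b::t1_space" and f :: "(nat \<Rightarrow> real) \<Rightarrow> complex \<times> real"
  assumes V: "openin (top_of_set S) V" and hm: "homeomorphism UNIV V \<phi> \<psi>"
    and f: "continuous_on (standard_simplex 3) f"
    and ne: "\<And>t s. \<lbrakk>t \<in> simplex_frontier 3; 0 \<le> s; s \<le> 1\<rbrakk> \<Longrightarrow> (1 - s) *\<^sub>R f t + s *\<^sub>R reference_map t \<noteq> 0"
    and hom: "homotopic_with (\<lambda>h. h \<in> simplex_frontier 3 \<rightarrow> S - {\<phi> 0}) (top_of_set (standard_simplex 3)) (top_of_set S) (\<phi> \<circ> f) \<tau>"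
  shows "homology_generator 3 (top_of_set S) (S - {\<phi> 0}) (frag_of (restrict \<tau> (standard_simplex 3)))"
proof -
  let ?D = "standard_simplex 3" and ?F = "simplex_frontier 3"
  have VS: "V \<subseteq> S" using V openin_imp_subset by blast
  have c\<phi>: "continuous_map euclidean (top_of_set S) \<phi>"
    using hm VS by (auto simp: homeomorphism_def continuous_map_in_subtopology)
  have inj: "\<phi> v = \<phi> 0 \<longleftrightarrow> v = 0" for v
    using hm by (metis UNIV_I homeomorphism_apply1)
  have \<phi>S: "\<phi> v \<in> S" for v
    using hm VS by (auto simp: homeomorphism_def)
  have hmap: "homeomorphic_map (subtopology euclidean UNIV) (subtopology (top_of_set S) V) \<phi>"
  proof -
    have "homeomorphic_maps (top_of_set UNIV) (top_of_set V) \<phi> \<psi>"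
      using hm by (simp only: homeomorphic_maps_iff_homeomorphism)
    then show ?thesis
      using VS by (auto simp: homeomorphic_map_maps subtopology_subtopology Int_absorb1)
  qed
  have rc: "singular_relcycle 3 euclidean (topspace euclidean - {0}) (frag_of (restrict reference_map ?D))"
    using homology_generator_reference_map by (simp add: homology_generator_def)
  have "homology_generator 3 (top_of_set S) (topspace (top_of_set S) - {\<phi> 0}) (chain_map 3 \<phi> (frag_of (restrict reference_map ?D)))"
  proof (rule homology_generator_open_embedding[OF c\<phi> _ _ V hmap _ _ _ rc, THEN iffD1])
    show "homology_generator 3 euclidean (topspace euclidean - {0}) (frag_of (restrict reference_map ?D))"
      using homology_generator_reference_map by simp
    have "closedin (top_of_set S) (S \<inter> {\<phi> 0})" by (intro closedin_closed_Int) auto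
    then show "closedin (top_of_set S) {\<phi> 0}" using \<phi>S by simp
  qed (use inj in auto)
  moreover have "chain_map 3 \<phi> (frag_of (restrict reference_map ?D)) = frag_of (restrict (\<phi> \<circ> reference_map) ?D)"
    by (auto simp: simplex_map_def fun_eq_iff intro!: arg_cong[of _ _ frag_of])
  ultimately have gen: "homology_generator 3 (top_of_set S) (S - {\<phi> 0}) (frag_of (restrict (\<phi> \<circ> reference_map) ?D))"
    by simp
  have "homotopic_with (\<lambda>h. h \<in> ?F \<rightarrow> UNIV - {0}) (top_of_set ?D) euclidean f reference_map"
    unfolding homotopic_with_def
  proof (intro exI conjI ballI allI)
    let ?h = "\<lambda>z. (1 - fst z) *\<^sub>R f (snd z) + fst z *\<^sub>R reference_map (snd z)"
    have cr: "continuous_on ?D reference_map"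
      unfolding reference_map_def by (intro continuous_intros continuous_on_Complex)
    have "continuous_on ({0..1::real} \<times> ?D) ?h"
      by (intro continuous_intros continuous_on_compose2[OF f] continuous_on_compose2[OF cr]) auto
    then show "continuous_map (prod_topology (top_of_set {0..1}) (top_of_set ?D)) euclidean ?h"
      by (simp add: prod_topology_top_of_set)
    show "(\<lambda>x. ?h (s, x)) \<in> ?F \<rightarrow> UNIV - {0}" if "s \<in> {0..1}" for s
      using ne[of _ s] that by auto
  qed auto
  then have "homotopic_with (\<lambda>h. h \<in> ?F \<rightarrow> S - {\<phi> 0}) (top_of_set ?D) (top_of_set S) (\<phi> \<circ> f) (\<phi> \<circ> reference_map)"
  proof (rule homotopic_with_compose_continuous_map_left[OF _ c\<phi>])
    show "\<phi> \<circ> j \<in> ?F \<rightarrow> S - {\<phi> 0}" if "j \<in> ?F \<rightarrow> UNIV - {0}" for j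
      using that inj \<phi>S by (auto simp: Pi_iff)
  qed
  then have "homotopic_with (\<lambda>h. h \<in> ?F \<rightarrow> S - {\<phi> 0}) (top_of_set ?D) (top_of_set S) (\<phi> \<circ> reference_map) \<tau>"
    by (rule homotopic_with_trans[OF homotopic_with_symD hom])
  then have "homologous_rel 3 (top_of_set S) (S - {\<phi> 0}) (frag_of (restrict (\<phi> \<circ> reference_map) ?D)) (frag_of (restrict \<tau> ?D))"
    using homologous_rel_simplex_homotopy[of 2 "S - {\<phi> 0}" "top_of_set S"] by (simp add: eval_nat_numeral)
  with gen show ?thesis by (rule homology_generator_homologous)
qed

section \<open>Local generators on the 3-sphere\<close>

lemma sgn_eq_iff_norm1:
  fixes x y :: "'a::real_normed_vector"
  assumes "norm y = 1" "x \<noteq> 0"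
  shows "sgn x = y \<longleftrightarrow> x = norm x *\<^sub>R y"
proof
  assume "sgn x = y"
  then have "norm x *\<^sub>R y = norm x *\<^sub>R (x /\<^sub>R norm x)" by (simp add: sgn_div_norm)
  then show "x = norm x *\<^sub>R y" using assms by simp
next
  assume "x = norm x *\<^sub>R y"
  then have "sgn x = sgn (norm x *\<^sub>R y)" by simp
  also have "\<dots> = y" using assms by (simp add: sgn_scaleR) (simp add: sgn_div_norm)
  finally show "sgn x = y" .
qed

text \<open>Central projection between the open hemisphere around \<open>(0, u)\<close> and its
  tangent space at \<open>(0, u)\<close>; the inverse divides by the component along
  \<open>u\<close>.\<close>

lemma sphere_chart:
  fixes u :: complex
  assumes u: "norm u = 1"
  shows "openin (top_of_set (sphere 0 1)) {y \<in> sphere (0 :: complex \<times> complex) 1. 0 < Re (snd y * cnj u)}" (is "openin _ ?V")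
    and "homeomorphism UNIV {y \<in> sphere (0 :: complex \<times> complex) 1. 0 < Re (snd y * cnj u)}
       (\<lambda>q :: complex \<times> real. sgn (fst q, Complex 1 (snd q) * u))
       (\<lambda>y. (fst y /\<^sub>R Re (snd y * cnj u), Im (snd y * cnj u) / Re (snd y * cnj u)))"
      (is "homeomorphism _ _ ?\<phi> ?\<psi>")
proof -
  have uu: "u * cnj u = 1" using u by (simp add: complex_norm_square[symmetric])
  have Veq: "?V = sphere 0 1 \<inter> {y. 0 < Re (snd y * cnj u)}" by auto
  have op: "open {y :: complex \<times> complex. 0 < Re (snd y * cnj u)}"
    by (intro open_Collect_less continuous_intros)
  show "openin (top_of_set (sphere 0 1)) ?V"
    unfolding Veq by (rule openin_open_Int[OF op])
  have ne: "(fst q, Complex 1 (snd q) * u) \<noteq> 0" for q :: "complex \<times> real"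
  proof
    assume eq: "(fst q, Complex 1 (snd q) * u) = 0"
    have "Complex 1 (snd q) * u = 0" using arg_cong[OF eq, of snd] by (simp only: snd_conv snd_zero)
    moreover have "u \<noteq> 0" using u by auto
    ultimately have "Complex 1 (snd q) = 0" using mult_eq_0_iff by blast
    then show False by (simp only: Complex_eq_0) simp
  qed
  have pos: "0 < norm (fst q, Complex 1 (snd q) * u)" for q :: "complex \<times> real"
    using ne[of q] by (simp only: zero_less_norm_iff not_False_eq_True)
  have val: "?\<phi> q = (fst q /\<^sub>R norm (fst q, Complex 1 (snd q) * u), (Complex 1 (snd q) * u) /\<^sub>R norm (fst q, Complex 1 (snd q) * u))" for q
    by (simp only: sgn_div_norm scaleR_Pair)
  have wq: "snd (?\<phi> q) * cnj u = Complex 1 (snd q) /\<^sub>R norm (fst q, Complex 1 (snd q) * u)" for q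
    by (simp only: val snd_conv mult_scaleR_left mult.assoc uu mult_1_right)
  show "homeomorphism UNIV ?V ?\<phi> ?\<psi>"
  proof (rule homeomorphismI)
    show "continuous_on UNIV ?\<phi>"
      by (intro continuous_intros continuous_on_Complex) (use ne in blast)
    show "continuous_on ?V ?\<psi>"
      by (intro continuous_intros) auto
    show "?\<phi> ` UNIV \<subseteq> ?V"
    proof (rule image_subsetI)
      fix q :: "complex \<times> real"
      have "norm (?\<phi> q) = 1" using ne[of q] by (simp only: norm_sgn if_False)
      moreover have "0 < Re (snd (?\<phi> q) * cnj u)"
        unfolding wq using pos[of q] by simp
      ultimately show "?\<phi> q \<in> ?V" by simp
    qed
    show "?\<psi> ` ?V \<subseteq> UNIV" by simp
    show "?\<psi> (?\<phi> q) = q" for q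
    proof -
      have "Re (snd (?\<phi> q) * cnj u) = 1 / norm (fst q, Complex 1 (snd q) * u)"
        "Im (snd (?\<phi> q) * cnj u) = snd q / norm (fst q, Complex 1 (snd q) * u)"
        unfolding wq by (simp_all add: field_simps)
      moreover have "fst (?\<phi> q) = fst q /\<^sub>R norm (fst q, Complex 1 (snd q) * u)" by (simp add: val)
      ultimately show ?thesis
        using pos[of q] by (cases q) simp
    qed
    show "?\<phi> (?\<psi> y) = y" if y: "y \<in> ?V" for y
    proof -
      let ?r = "Re (snd y * cnj u)"
      have r: "0 < ?r" and n1: "norm y = 1" using y by auto
      have "Complex 1 (Im (snd y * cnj u) / ?r) = (snd y * cnj u) /\<^sub>R ?r"
        using r by (simp add: complex_eq_iff divide_inverse mult.commute)
      then have "Complex 1 (Im (snd y * cnj u) / ?r) * u = (snd y * (u * cnj u)) /\<^sub>R ?r"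
        by (simp only: mult_scaleR_left mult.assoc mult.commute[of "cnj u" u])
      then have "(fst (?\<psi> y), Complex 1 (snd (?\<psi> y)) * u) = (fst y /\<^sub>R ?r, snd y /\<^sub>R ?r)"
        by (simp only: uu fst_conv snd_conv mult_1_right)
      then have "(fst (?\<psi> y), Complex 1 (snd (?\<psi> y)) * u) = y /\<^sub>R ?r"
        by (simp only: scaleR_Pair[symmetric] prod.collapse)
      moreover have "sgn (y /\<^sub>R ?r) = y"
        using r n1 by (simp only: sgn_scaleR) (simp add: sgn_div_norm)
      ultimately show ?thesis by (simp only:)
    qed
  qed
qed

text \<open>The sign \<open>\<kappa>\<close> allows charts of either orientation.\<close>

lemma homology_generator_sphere:
  fixes Z :: "(nat \<Rightarrow> real) \<Rightarrow> complex" and a v :: "(nat \<Rightarrow> real) \<Rightarrow> real" and u :: complex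
  assumes u: "norm u = 1" and \<kappa>: "\<kappa> = 1 \<or> \<kappa> = - 1"
    and cont: "continuous_on (standard_simplex 3) Z" "continuous_on (standard_simplex 3) a" "continuous_on (standard_simplex 3) v"
    and a: "\<And>t. t \<in> standard_simplex 3 \<Longrightarrow> 0 \<le> a t"
    and ne: "\<And>t. t \<in> standard_simplex 3 \<Longrightarrow> Z t \<noteq> 0 \<or> a t \<noteq> 0 \<or> v t \<noteq> 0"
    and bd: "\<And>t s. \<lbrakk>t \<in> simplex_frontier 3; 0 \<le> s; s \<le> 1\<rbrakk> \<Longrightarrow> (1 - s) *\<^sub>R (Z t, v t) + s *\<^sub>R reference_map t \<noteq> 0"
  shows "homology_generator 3 (top_of_set (sphere 0 1)) (sphere 0 1 - {(0, u)})
     (frag_of (restrict (\<lambda>t. sgn (Z t, Complex (a t) (\<kappa> * v t) * u)) (standard_simplex 3)))"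
proof -
  let ?D = "standard_simplex 3" and ?F = "simplex_frontier 3"
  let ?c = "\<lambda>q. (fst q, \<kappa> * snd q) :: complex \<times> real"
  let ?\<phi> = "(\<lambda>q. sgn (fst q, Complex 1 (snd q) * u)) \<circ> ?c"
  define V :: "(complex \<times> complex) set" where "V = {y \<in> sphere 0 1. 0 < Re (snd y * cnj u)}"
  have FD: "?F \<subseteq> ?D" by (auto simp: simplex_frontier_def)
  have \<phi>0: "?\<phi> 0 = (0, u)"
    using u by (simp add: sgn_div_norm norm_Pair flip: one_complex.code)
  have "homeomorphism UNIV UNIV ?c ?c"
    by (rule homeomorphismI) (use \<kappa> in \<open>auto intro!: continuous_intros\<close>)
  from homeomorphism_compose[OF this sphere_chart(2)[OF u]]
  obtain \<psi> where hm: "homeomorphism UNIV V ?\<phi> \<psi>"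
    unfolding V_def by blast
  have V: "openin (top_of_set (sphere 0 1)) V"
    unfolding V_def by (rule sphere_chart(1)[OF u])
  \<comment> \<open>Moving the component along \<open>u\<close> from 1 to \<open>a\<close> joins the
    chart image of \<open>(Z, v)\<close> to the given simplex. Since \<open>a\<close> is
    non-negative, this component can vanish only for \<open>s = 1\<close>, where \<open>ne\<close>
    applies. On the frontier \<open>(0, u)\<close> is missed throughout because
    \<open>(Z, v)\<close> has no zero there, which is \<open>bd\<close> at parameter 0.\<close>
  let ?H = "\<lambda>z. sgn (Z (snd z), Complex ((1 - fst z) + fst z * a (snd z)) (\<kappa> * v (snd z)) * u)"
  have u0: "u \<noteq> 0" using u by auto
  have nz: "(Z t, Complex ((1 - s) + s * a t) (\<kappa> * v t) * u) \<noteq> 0" if "t \<in> ?D" "0 \<le> s" "s \<le> 1" for s t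
  proof
    assume "(Z t, Complex ((1 - s) + s * a t) (\<kappa> * v t) * u) = 0"
    then have e: "Z t = 0" "(1 - s) + s * a t = 0" "v t = 0"
      using u0 \<kappa> by (auto simp: zero_prod_def complex_eq_iff[of "Complex _ _"])
    have "0 \<le> s * a t" using a that by simp
    then have "s = 1" using e(2) that(3) by linarith
    then have "a t = 0" using e(2) by simp
    then show False using ne[OF that(1)] e(1,3) by blast
  qed
  have "homotopic_with (\<lambda>h. h \<in> ?F \<rightarrow> sphere 0 1 - {?\<phi> 0}) (top_of_set ?D) (top_of_set (sphere 0 1))
     (?\<phi> \<circ> (\<lambda>t. (Z t, v t))) (\<lambda>t. sgn (Z t, Complex (a t) (\<kappa> * v t) * u))"
    unfolding homotopic_with_def
  proof (intro exI conjI ballI allI)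
    have c: "continuous_on ({0..1::real} \<times> ?D) (\<lambda>z. Z (snd z))" "continuous_on ({0..1::real} \<times> ?D) (\<lambda>z. a (snd z))"
      "continuous_on ({0..1::real} \<times> ?D) (\<lambda>z. v (snd z))"
      by (rule continuous_on_compose2[OF _ continuous_on_snd[OF continuous_on_id]], rule cont, force)+
    have "continuous_on ({0..1::real} \<times> ?D) ?H"
      by (intro continuous_intros continuous_on_Complex c) (use nz in force)
    moreover have "?H z \<in> sphere 0 1" if "z \<in> {0..1} \<times> ?D" for z
      using nz[of "snd z" "fst z"] that by (auto simp: norm_sgn)
    ultimately show "continuous_map (prod_topology (top_of_set {0..1}) (top_of_set ?D)) (top_of_set (sphere 0 1)) ?H"
      by (auto simp: prod_topology_top_of_set)
    show "(\<lambda>x. ?H (s, x)) \<in> ?F \<rightarrow> sphere 0 1 - {?\<phi> 0}" if s: "s \<in> {0..1}" for s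
    proof
      fix t assume t: "t \<in> ?F"
      then have tD: "t \<in> ?D" using FD by blast
      let ?x = "(Z t, Complex ((1 - s) + s * a t) (\<kappa> * v t) * u)"
      have x0: "?x \<noteq> 0" using nz[OF tD] s by simp
      have "sgn ?x \<noteq> (0, u)"
      proof
        assume "sgn ?x = (0, u)"
        moreover have "norm (0 :: complex, u) = 1" using u by (simp add: norm_Pair)
        ultimately obtain r where r: "?x = r *\<^sub>R (0, u)"
          using sgn_eq_iff_norm1 x0 by blast
        have "Z t = 0" using arg_cong[OF r, of fst] by simp
        have "Complex ((1 - s) + s * a t) (\<kappa> * v t) * u = complex_of_real r * u"
          using arg_cong[OF r, of snd] by (simp add: scaleR_conv_of_real)
        then have "Complex ((1 - s) + s * a t) (\<kappa> * v t) = complex_of_real r"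
          using u0 mult_cancel_right by blast
        then have "Im (Complex ((1 - s) + s * a t) (\<kappa> * v t)) = Im (complex_of_real r)"
          by (rule arg_cong)
        then have "v t = 0" using \<kappa> by auto
        with \<open>Z t = 0\<close> show False using bd[OF t, of 0] by (simp add: zero_prod_def)
      qed
      moreover have "norm (sgn ?x) = 1" using x0 by (simp only: norm_sgn if_False)
      ultimately show "?H (s, t) \<in> sphere 0 1 - {?\<phi> 0}" unfolding \<phi>0 by simp
    qed
  qed simp_all
  from homology_generator_chart[OF V hm _ bd this] cont show ?thesis
    unfolding \<phi>0 by (auto intro: continuous_on_Pair)
qed

section \<open>Orientations and fundamental cycles\<close>

lemma hom_induced_id_class:
  assumes c: "singular_relcycle n X T c" and TS: "T \<subseteq> S"
  shows "hom_induced (int n) X T X S id (homologous_rel_set n X T c) = homologous_rel_set n X S c"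
proof -
  have "singular_chain n X c"
    using c by (simp add: singular_relcycle)
  then have "chain_map n id c = c"
    by (rule chain_map_ident)
  then show ?thesis
    using hom_induced_chain_map[OF _ _ c, of X id S] TS
    by (simp add: Pi_iff subset_iff)
qed

lemma relcycle_weaken:
  assumes "singular_relcycle n X T c" "T \<subseteq> S"
  shows "singular_relcycle n X S c"
  using assms singular_chain_mono unfolding singular_relcycle by blast

lemma relboundary_weaken:
  assumes "singular_relboundary n X T c" "T \<subseteq> S"
  shows "singular_relboundary n X S c"
  using assms singular_chain_mono unfolding singular_relboundary_alt by blast

lemma homologous_rel_weaken:
  "homologous_rel n X T a b \<Longrightarrow> T \<subseteq> S \<Longrightarrow> homologous_rel n X S a b"
  unfolding homologous_rel_def by (rule relboundary_weaken)

lemma homologous_rel_cmul: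
  assumes "homologous_rel n X S a b"
  shows "homologous_rel n X S (frag_cmul k a) (frag_cmul k b)"
proof -
  have "frag_cmul k a - frag_cmul k b = frag_cmul k (a - b)"
    by (rule poly_mapping_eqI) (simp add: lookup_minus algebra_simps)
  then show ?thesis
    using assms singular_relboundary_cmul unfolding homologous_rel_def by metis
qed

lemma homology_generator_cmul_unique:
  assumes "homology_generator n X S c" "homologous_rel n X S (frag_cmul k c) (frag_cmul m c)"
  shows "k = m"
proof -
  have "frag_cmul k c - frag_cmul m c = frag_cmul (k - m) c"
    by (simp only: frag_cmul_diff_distrib)
  then show ?thesis
    using assms unfolding homology_generator_def homologous_rel_def by (metis eq_iff_diff_eq_0)
qed

lemma carrier_subgroup_generated_homology:
  assumes "singular_relcycle n X S c"
  shows "carrier (subgroup_generated (relative_homology_group (int n) X S) {homologous_rel_set n X S c})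
     = range (\<lambda>k. homologous_rel_set n X S (frag_cmul k c))"
proof -
  have "carrier (subgroup_generated (relative_homology_group (int n) X S) {homologous_rel_set n X S c})
     = range (\<lambda>k::int. homologous_rel_set n X S c [^]\<^bsub>relative_homology_group (int n) X S\<^esub> k)"
    by (rule group.carrier_subgroup_generated_by_singleton[OF group_relative_homology_group homologous_rel_set_carrier[OF assms]])
  then show ?thesis
    by (simp only: homologous_rel_set_int_pow[OF assms])
qed

lemma subgroup_generated_eq_iff:
  "subgroup_generated G B = G \<longleftrightarrow> carrier (subgroup_generated G B) = carrier G"
proof
  assume c: "carrier (subgroup_generated G B) = carrier G"
  then have "generate G (carrier G \<inter> B) = carrier G"
    unfolding subgroup_generated_def by simp
  then show "subgroup_generated G B = G"
    unfolding subgroup_generated_def by simp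
qed simp

text \<open>From a cycle that generates at every point one reads off an orientation, then every
  orientation, and a fundamental cycle for each of them.\<close>

locale global_generator =
  fixes n :: nat and X :: "'a topology" and c :: "'a chain"
  assumes cycle: "singular_relcycle n X {} c"
    and gen: "\<And>x. x \<in> topspace X \<Longrightarrow> homology_generator n X (topspace X - {x}) c"
begin

definition local_class :: "'a \<Rightarrow> 'a chain set" where
  "local_class x = homologous_rel_set n X (topspace X - {x}) c"

lemma cycle_rel: "singular_relcycle n X S c"
  using relcycle_weaken[OF cycle] by simp

lemma orientation_local_class: "orientation n X local_class"
  unfolding orientation_def
proof (intro conjI ballI)
  fix x assume x: "x \<in> topspace X"
  let ?G = "local_homology_group n X x"
  show "local_class x \<in> carrier ?G"
    unfolding local_class_def by (rule homologous_rel_set_carrier[OF cycle_rel])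
  show "subgroup_generated ?G {local_class x} = ?G"
    unfolding subgroup_generated_eq_iff local_class_def carrier_subgroup_generated_homology[OF cycle_rel]
  proof
    show "range (\<lambda>k. homologous_rel_set n X (topspace X - {x}) (frag_cmul k c)) \<subseteq> carrier ?G"
      using homologous_rel_set_carrier[OF singular_relcycle_cmul[OF cycle_rel]] by blast
    show "carrier ?G \<subseteq> range (\<lambda>k. homologous_rel_set n X (topspace X - {x}) (frag_cmul k c))"
    proof
      fix \<alpha> assume "\<alpha> \<in> carrier ?G"
      then obtain a where a: "singular_relcycle n X (topspace X - {x}) a" "\<alpha> = homologous_rel_set n X (topspace X - {x}) a"
        unfolding carrier_relative_homology_group by blast
      then obtain k where "homologous_rel n X (topspace X - {x}) a (frag_cmul k c)"
        using gen[OF x] unfolding homology_generator_def by blast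
      then have "\<alpha> = homologous_rel_set n X (topspace X - {x}) (frag_cmul k c)"
        unfolding a(2) by (simp only: homologous_rel_set_eq)
      then show "\<alpha> \<in> range (\<lambda>k. homologous_rel_set n X (topspace X - {x}) (frag_cmul k c))" by blast
    qed
  qed
next
  fix x assume x: "x \<in> topspace X"
  show "\<exists>U. openin X U \<and> x \<in> U \<and> (\<exists>\<beta>\<in>carrier (relative_homology_group (int n) X (topspace X - U)).
           \<forall>y\<in>U. hom_induced (int n) X (topspace X - U) X (topspace X - {y}) id \<beta> = local_class y)"
  proof (intro exI conjI bexI ballI)
    show "openin X (topspace X)" by simp
    show "x \<in> topspace X" by (rule x)
    fix y assume "y \<in> topspace X"
    show "hom_induced (int n) X (topspace X - topspace X) X (topspace X - {y}) id
        (homologous_rel_set n X (topspace X - topspace X) c) = local_class y"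
      unfolding local_class_def by (rule hom_induced_id_class[OF cycle_rel]) simp
  next
    show "homologous_rel_set n X (topspace X - topspace X) c \<in> carrier (relative_homology_group (int n) X (topspace X - topspace X))"
      by (rule homologous_rel_set_carrier[OF cycle_rel])
  qed
qed

text \<open>The class \<open>\<mu> x\<close> is \<open>k\<close> times that of \<open>c\<close>, and
  as it generates, \<open>c\<close> is \<open>m\<close> times \<open>\<mu> x\<close>. Infinite order
  gives \<open>m * k = 1\<close>, so \<open>k\<close> is a sign.\<close>

lemma orientation_pointwise:
  assumes "orientation n X \<mu>" and x: "x \<in> topspace X"
  shows "\<exists>e. (e = 1 \<or> e = - 1) \<and> \<mu> x = homologous_rel_set n X (topspace X - {x}) (frag_cmul e c)"
proof -
  let ?S = "topspace X - {x}" and ?G = "local_homology_group n X x"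
  have "\<mu> x \<in> carrier ?G" and sg: "subgroup_generated ?G {\<mu> x} = ?G"
    using assms unfolding orientation_def by blast+
  then obtain a where a: "singular_relcycle n X ?S a" "\<mu> x = homologous_rel_set n X ?S a"
    unfolding carrier_relative_homology_group by blast
  obtain k where k: "homologous_rel n X ?S a (frag_cmul k c)"
    using gen[OF x] a(1) unfolding homology_generator_def by blast
  have "homologous_rel_set n X ?S c \<in> carrier (subgroup_generated ?G {\<mu> x})"
    unfolding sg by (rule homologous_rel_set_carrier[OF cycle_rel])
  then obtain m where "homologous_rel_set n X ?S c = homologous_rel_set n X ?S (frag_cmul m a)"
    unfolding a(2) carrier_subgroup_generated_homology[OF a(1)] by blast
  then have "homologous_rel n X ?S c (frag_cmul m a)"
    by (simp only: homologous_rel_set_eq)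
  then have "homologous_rel n X ?S c (frag_cmul m (frag_cmul k c))"
    using homologous_rel_trans[OF homologous_rel_cmul[OF k]] by blast
  then have "homologous_rel n X ?S (frag_cmul 1 c) (frag_cmul (m * k) c)"
    by simp
  then have "1 = m * k"
    by (rule homology_generator_cmul_unique[OF gen[OF x]])
  then have "k = 1 \<or> k = - 1"
    using pos_zmult_eq_1_iff_lemma[of k m] by (simp add: mult.commute)
  moreover have "\<mu> x = homologous_rel_set n X ?S (frag_cmul k c)"
    unfolding a(2) using k by (simp only: homologous_rel_set_eq)
  ultimately show ?thesis by blast
qed

text \<open>A chain that bounds off a point also bounds off all nearby points, since the support of a chain
  is compact.\<close>

lemma orientation_locally_constant:
  assumes H: "Hausdorff_space X" and or: "orientation n X \<mu>" and x: "x \<in> topspace X"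
    and e: "\<mu> x = homologous_rel_set n X (topspace X - {x}) (frag_cmul e c)"
  shows "\<exists>W. openin X W \<and> x \<in> W \<and> (\<forall>y\<in>W. \<mu> y = homologous_rel_set n X (topspace X - {y}) (frag_cmul e c))"
proof -
  obtain U \<beta> where U: "openin X U" "x \<in> U" and \<beta>: "\<beta> \<in> carrier (relative_homology_group (int n) X (topspace X - U))"
    and \<beta>\<mu>: "\<forall>y\<in>U. hom_induced (int n) X (topspace X - U) X (topspace X - {y}) id \<beta> = \<mu> y"
    using or x unfolding orientation_def by blast
  obtain b where b: "singular_relcycle n X (topspace X - U) b" "\<beta> = homologous_rel_set n X (topspace X - U) b"
    using \<beta> unfolding carrier_relative_homology_group by blast
  have \<mu>b: "\<mu> y = homologous_rel_set n X (topspace X - {y}) b" if "y \<in> U" for y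
  proof -
    have "topspace X - U \<subseteq> topspace X - {y}" using that by blast
    from hom_induced_id_class[OF b(1) this] show ?thesis
      using \<beta>\<mu> that unfolding b(2) by simp
  qed
  have "homologous_rel n X (topspace X - {x}) b (frag_cmul e c)"
    using trans[OF \<mu>b[OF U(2), symmetric] e] by (simp only: homologous_rel_set_eq)
  then obtain d s where d: "singular_chain (Suc n) X d" and s: "singular_chain n (subtopology X (topspace X - {x})) s"
    and ds: "chain_boundary (Suc n) d = (b - frag_cmul e c) + s"
    unfolding homologous_rel_def singular_relboundary_alt by blast
  define K where "K = (\<Union>f\<in>Poly_Mapping.keys s. f ` standard_simplex n)"
  have sX: "singular_chain n X s" and sx: "\<And>f. f \<in> Poly_Mapping.keys s \<Longrightarrow> f ` standard_simplex n \<subseteq> topspace X - {x}"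
    using s unfolding singular_chain_subtopology by blast+
  have "closedin X (f ` standard_simplex n)" if "f \<in> Poly_Mapping.keys s" for f
  proof -
    have "singular_simplex n X f"
      using sX that unfolding singular_chain_def by blast
    then have "continuous_map (subtopology (powertop_real UNIV) (standard_simplex n)) X f"
      unfolding singular_simplex_def by blast
    moreover have "compactin (subtopology (powertop_real UNIV) (standard_simplex n)) (standard_simplex n)"
      using compactin_standard_simplex by (simp add: compactin_subtopology)
    ultimately show ?thesis
      using image_compactin compactin_imp_closedin[OF H] by blast
  qed
  then have "closedin X K"
    unfolding K_def by (intro closedin_Union) auto
  show ?thesis
  proof (intro exI conjI ballI)
    show "openin X (U - K)"
      using U(1) \<open>closedin X K\<close> by (rule openin_diff)
    show "x \<in> U - K"
      using U(2) sx unfolding K_def by blast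
    fix y assume y: "y \<in> U - K"
    have "\<forall>f\<in>Poly_Mapping.keys s. f ` standard_simplex n \<subseteq> topspace X - {y}"
      using y sx unfolding K_def by blast
    then have "singular_chain n (subtopology X (topspace X - {y})) s"
      using sX unfolding singular_chain_subtopology by blast
    then have "homologous_rel n X (topspace X - {y}) b (frag_cmul e c)"
      using d ds unfolding homologous_rel_def singular_relboundary_alt by blast
    then show "\<mu> y = homologous_rel_set n X (topspace X - {y}) (frag_cmul e c)"
      using \<mu>b y by (simp only: homologous_rel_set_eq Diff_iff)
  qed
qed

text \<open>The sign is locally constant, and the open sets belonging to the two signs are disjoint
  because the local groups have infinite order. A connected space is therefore one of the two
  sets.\<close>

lemma orientation_cases:
  assumes H: "Hausdorff_space X" and con: "connected_space X" and or: "orientation n X \<mu>"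
  shows "\<exists>e. (e = 1 \<or> e = - 1) \<and> (\<forall>x\<in>topspace X. \<mu> x = homologous_rel_set n X (topspace X - {x}) (frag_cmul e c))"
proof -
  define P where "P e = {x \<in> topspace X. \<mu> x = homologous_rel_set n X (topspace X - {x}) (frag_cmul e c)}" for e
  have op: "openin X (P e)" for e
  proof (subst openin_subopen, intro ballI)
    fix x assume "x \<in> P e"
    then have x: "x \<in> topspace X" "\<mu> x = homologous_rel_set n X (topspace X - {x}) (frag_cmul e c)"
      unfolding P_def by blast+
    obtain W where "openin X W" "x \<in> W" "\<forall>y\<in>W. \<mu> y = homologous_rel_set n X (topspace X - {y}) (frag_cmul e c)"
      using orientation_locally_constant[OF H or x] by blast
    moreover from this(1) have "W \<subseteq> topspace X" by (rule openin_subset)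
    ultimately show "\<exists>T. openin X T \<and> x \<in> T \<and> T \<subseteq> P e"
      unfolding P_def by blast
  qed
  have cover: "topspace X \<subseteq> P 1 \<union> P (- 1)"
    using orientation_pointwise[OF or] unfolding P_def by blast
  have "P 1 \<inter> P (- 1) = {}"
  proof -
    have False if x: "x \<in> topspace X" and "homologous_rel_set n X (topspace X - {x}) (frag_cmul 1 c)
       = homologous_rel_set n X (topspace X - {x}) (frag_cmul (- 1) c)" for x
    proof -
      have "homologous_rel n X (topspace X - {x}) (frag_cmul 1 c) (frag_cmul (- 1) c)"
        using that(2) by (simp only: homologous_rel_set_eq)
      from homology_generator_cmul_unique[OF gen[OF x] this] show False by simp
    qed
    then show ?thesis unfolding P_def by force
  qed
  then have "P 1 = {} \<or> P (- 1) = {}"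
    using con cover op unfolding connected_space_def by blast
  then have "topspace X \<subseteq> P 1 \<or> topspace X \<subseteq> P (- 1)"
    using cover by blast
  then show ?thesis unfolding P_def by blast
qed

lemma fundamental_cycle_cmul:
  assumes "\<forall>x\<in>topspace X. \<mu> x = homologous_rel_set n X (topspace X - {x}) (frag_cmul e c)"
  shows "fundamental_cycle n X \<mu> (frag_cmul e c)"
proof -
  have rc: "singular_relcycle n X {} (frag_cmul e c)"
    by (rule singular_relcycle_cmul[OF cycle])
  show ?thesis
    unfolding fundamental_cycle_def fundamental_class_def
    using rc homologous_rel_set_carrier[OF rc] hom_induced_id_class[OF rc] assms by auto
qed

end

section \<open>Chain norms and a criterion for volume two\<close>

lemma chain_norm_superset:
  assumes "finite A" "Poly_Mapping.keys c \<subseteq> A"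
  shows "chain_norm c = (\<Sum>\<sigma>\<in>A. nat \<bar>Poly_Mapping.lookup c \<sigma>\<bar>)"
  unfolding chain_norm_def by (rule sum.mono_neutral_left) (use assms in \<open>auto simp: in_keys_iff\<close>)

lemma chain_norm_cmul_sign:
  assumes "e = 1 \<or> e = - 1"
  shows "chain_norm (frag_cmul e c) = chain_norm c"
proof -
  have "Poly_Mapping.keys (- c) = Poly_Mapping.keys c" by simp
  then show ?thesis using assms by (auto simp: chain_norm_def)
qed

text \<open>If the two simplices coincide, their coefficients add up to 2 or 0; otherwise each of
  them contributes 1.\<close>

lemma chain_norm_two_le:
  assumes "e = 1 \<or> e = - 1"
  shows "chain_norm (frag_of \<sigma> + frag_cmul e (frag_of \<tau>)) \<le> 2"
proof -
  have keys: "Poly_Mapping.keys (frag_of \<sigma> + frag_cmul e (frag_of \<tau>)) \<subseteq> {\<sigma>, \<tau>}"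
    using keys_add[of "frag_of \<sigma>" "frag_cmul e (frag_of \<tau>)"] assms by auto
  show ?thesis
    unfolding chain_norm_superset[OF _ keys, simplified] using assms
    by (cases "\<sigma> = \<tau>") (auto simp: lookup_add)
qed

lemma chain_norm_0:
  assumes "chain_norm c = 0"
  shows "c = 0"
proof (rule poly_mapping_eqI)
  fix x
  have "nat \<bar>Poly_Mapping.lookup c x\<bar> = 0" if "x \<in> Poly_Mapping.keys c"
    using assms that unfolding chain_norm_def by (meson finite_keys sum_eq_0_iff)
  then show "Poly_Mapping.lookup c x = Poly_Mapping.lookup 0 x"
    by (cases "x \<in> Poly_Mapping.keys c") (auto simp: in_keys_iff)
qed

lemma chain_norm_1:
  assumes "chain_norm c = 1"
  shows "\<exists>\<sigma> e. (e = 1 \<or> e = - 1) \<and> c = frag_cmul e (frag_of \<sigma>)"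
proof -
  let ?f = "\<lambda>\<sigma>. nat \<bar>Poly_Mapping.lookup c \<sigma>\<bar>"
  have sum: "(\<Sum>\<sigma>\<in>Poly_Mapping.keys c. ?f \<sigma>) = 1" using assms by (simp add: chain_norm_def)
  then obtain \<sigma> where \<sigma>: "\<sigma> \<in> Poly_Mapping.keys c" "?f \<sigma> = 1" "\<forall>\<tau>\<in>Poly_Mapping.keys c. \<sigma> \<noteq> \<tau> \<longrightarrow> ?f \<tau> = 0"
    using sum_eq_1_iff[OF finite_keys[of c], of ?f] by blast
  have "Poly_Mapping.lookup c \<tau> = 0" if "\<tau> \<noteq> \<sigma>" for \<tau>
    using \<sigma>(3) that by (cases "\<tau> \<in> Poly_Mapping.keys c") (auto simp: in_keys_iff)
  moreover have "Poly_Mapping.lookup c \<sigma> = 1 \<or> Poly_Mapping.lookup c \<sigma> = - 1"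
    using \<sigma>(2) by linarith
  ultimately have "c = frag_cmul (Poly_Mapping.lookup c \<sigma>) (frag_of \<sigma>)"
    by (intro poly_mapping_eqI) auto
  then show ?thesis using \<open>Poly_Mapping.lookup c \<sigma> = 1 \<or> Poly_Mapping.lookup c \<sigma> = - 1\<close> by blast
qed

text \<open>A certificate for volume two that is invariant under homeomorphism and mentions no
  orientation: a cycle of two simplices that generates everywhere, and one point at which no
  one-simplex cycle represents this class or its negative.\<close>

definition volume_two :: "'a topology \<Rightarrow> bool" where
  "volume_two X \<longleftrightarrow> closed_connected_manifold 3 X \<and>
     (\<exists>\<sigma> \<tau> e c. (e = 1 \<or> e = - 1) \<and> c = frag_of \<sigma> + frag_cmul e (frag_of \<tau>) \<and> singular_relcycle 3 X {} c \<and>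
       (\<forall>x\<in>topspace X. homology_generator 3 X (topspace X - {x}) c) \<and>
       (\<exists>x\<in>topspace X. \<forall>\<rho>. singular_relcycle 3 X {} (frag_of \<rho>) \<longrightarrow>
          (\<exists>k. k \<noteq> 1 \<and> k \<noteq> - 1 \<and> homologous_rel 3 X (topspace X - {x}) (frag_of \<rho>) (frag_cmul k c))))"

lemma volume_two_imp_integral_simplicial_volume:
  assumes "volume_two X"
  shows "(\<exists>\<mu>. oriented_closed_connected_manifold 3 X \<mu>) \<and>
    (\<forall>\<mu>. oriented_closed_connected_manifold 3 X \<mu> \<longrightarrow> integral_simplicial_volume 3 X \<mu> = 2)"
proof -
  obtain \<sigma> \<tau> e c x where M: "closed_connected_manifold 3 X" and e: "e = 1 \<or> e = - 1"
    and c: "c = frag_of \<sigma> + frag_cmul e (frag_of \<tau>)" and cyc: "singular_relcycle 3 X {} c"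
    and gen: "\<And>x. x \<in> topspace X \<Longrightarrow> homology_generator 3 X (topspace X - {x}) c"
    and x: "x \<in> topspace X"
    and low: "\<And>\<rho>. singular_relcycle 3 X {} (frag_of \<rho>) \<Longrightarrow>
       \<exists>k. k \<noteq> 1 \<and> k \<noteq> - 1 \<and> homologous_rel 3 X (topspace X - {x}) (frag_of \<rho>) (frag_cmul k c)"
    using assms unfolding volume_two_def by blast
  interpret global_generator 3 X c
    by unfold_locales (use cyc gen in auto)
  have H: "Hausdorff_space X" and con: "connected_space X"
    using M unfolding closed_connected_manifold_def by blast+
  have "integral_simplicial_volume 3 X \<mu> = 2" if or: "orientation 3 X \<mu>" for \<mu>
  proof -
    obtain s where s: "s = 1 \<or> s = - 1"
      and \<mu>: "\<forall>x\<in>topspace X. \<mu> x = homologous_rel_set 3 X (topspace X - {x}) (frag_cmul s c)"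
      using orientation_cases[OF H con or] by blast
    have fc: "fundamental_cycle 3 X \<mu> (frag_cmul s c)"
      by (rule fundamental_cycle_cmul[OF \<mu>])
    have le: "chain_norm (frag_cmul s c) \<le> 2"
      unfolding chain_norm_cmul_sign[OF s] c by (rule chain_norm_two_le[OF e])
    \<comment> \<open>At \<open>x\<close> a cycle of norm at most one is \<open>k\<close> times
      \<open>c\<close> with \<open>k\<close> not a sign, while a fundamental cycle is
      \<open>s\<close> times \<open>c\<close> with \<open>s\<close> a sign. Uniqueness of the
      multiple gives the contradiction; norm zero corresponds to \<open>k = 0\<close>.\<close>
    have lower: "2 \<le> chain_norm d" if d: "fundamental_cycle 3 X \<mu> d" for d
    proof (rule ccontr)
      assume "\<not> 2 \<le> chain_norm d"
      then consider "chain_norm d = 0" | "chain_norm d = 1" by linarith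
      then obtain k \<rho> where k: "k \<noteq> 1" "k \<noteq> - 1" "homologous_rel 3 X (topspace X - {x}) d (frag_cmul k c)"
      proof cases
        case 1
        then have "d = 0" by (rule chain_norm_0)
        then show ?thesis using that[of 0] by simp
      next
        case 2
        then obtain \<rho> r where r: "r = 1 \<or> r = - 1" "d = frag_cmul r (frag_of \<rho>)"
          using chain_norm_1 by blast
        have "singular_relcycle 3 X {} d"
          using d unfolding fundamental_cycle_def by blast
        \<comment> \<open>The sign \<open>r\<close> squares to 1, so a second factor
          \<open>r\<close> recovers the bare simplex.\<close>
        then have "singular_relcycle 3 X {} (frag_cmul r d)"
          by (rule singular_relcycle_cmul)
        then have "singular_relcycle 3 X {} (frag_of \<rho>)"
          using r by auto
        then obtain k where k: "k \<noteq> 1" "k \<noteq> - 1" "homologous_rel 3 X (topspace X - {x}) (frag_of \<rho>) (frag_cmul k c)"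
          using low by blast
        have "homologous_rel 3 X (topspace X - {x}) d (frag_cmul (r * k) c)"
          using homologous_rel_cmul[OF k(3), of r] r(2) by simp
        moreover have "r * k \<noteq> 1" "r * k \<noteq> - 1" using k r by auto
        ultimately show ?thesis using that by blast
      qed
      have dc: "singular_relcycle 3 X {} d"
        and "hom_induced (int 3) X {} X (topspace X - {x}) id (homologous_rel_set 3 X {} d) = \<mu> x"
        using d x unfolding fundamental_cycle_def fundamental_class_def by auto
      then have "homologous_rel_set 3 X (topspace X - {x}) d = homologous_rel_set 3 X (topspace X - {x}) (frag_cmul s c)"
        using hom_induced_id_class[OF dc, of "topspace X - {x}"] \<mu> x by simp
      then have "homologous_rel 3 X (topspace X - {x}) d (frag_cmul s c)"
        by (simp only: homologous_rel_set_eq)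
      then have "homologous_rel 3 X (topspace X - {x}) (frag_cmul k c) (frag_cmul s c)"
        using k(3) homologous_rel_sym homologous_rel_trans by metis
      then have "k = s" by (rule homology_generator_cmul_unique[OF gen[OF x]])
      then show False using k s by blast
    qed
    let ?N = "{chain_norm c |c. fundamental_cycle 3 X \<mu> c}"
    have "2 \<in> ?N" using fc le lower[OF fc] by (metis (mono_tags, lifting) le_antisym mem_Collect_eq)
    then show ?thesis
      unfolding integral_simplicial_volume_def using lower
      by (intro cInf_eq_minimum) auto
  qed
  moreover have "oriented_closed_connected_manifold 3 X local_class"
    unfolding oriented_closed_connected_manifold_def using M orientation_local_class by blast
  ultimately show ?thesis
    unfolding oriented_closed_connected_manifold_def by blast
qed

section \<open>Transport along homeomorphisms and isotopies\<close>

lemma inverse_funcsets_minus_point: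
  assumes f: "\<And>y. y \<in> A \<Longrightarrow> f y \<in> B \<and> g (f y) = y" and g: "\<And>y. y \<in> B \<Longrightarrow> g y \<in> A \<and> f (g y) = y"
    and x: "x \<in> A"
  shows "f \<in> A - {x} \<rightarrow> B - {f x}" "g \<in> B - {f x} \<rightarrow> A - {x}"
proof -
  show "f \<in> A - {x} \<rightarrow> B - {f x}"
  proof
    fix y assume y: "y \<in> A - {x}"
    have "f y \<noteq> f x"
    proof
      assume "f y = f x"
      then have "g (f y) = g (f x)" by (rule arg_cong)
      then show False using f[of y] f[OF x] y by simp
    qed
    then show "f y \<in> B - {f x}" using f[of y] y by blast
  qed
  show "g \<in> B - {f x} \<rightarrow> A - {x}"
  proof
    fix y assume y: "y \<in> B - {f x}"
    have "g y \<noteq> x" using g[of y] y by auto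
    then show "g y \<in> A - {x}" using g[of y] y by blast
  qed
qed

text \<open>The homeomorphism \<open>f\<close> carries the local group at \<open>x\<close> to the
  one at \<open>f x\<close>, and, being homotopic to the identity, it sends \<open>c\<close> to a
  homologous cycle.\<close>

lemma homology_generator_isotopy:
  assumes c: "singular_relcycle n X {} c" and hm: "homeomorphic_maps X X f g"
    and hom: "homotopic_with (\<lambda>_. True) X X id f" and x: "x \<in> topspace X"
  shows "homology_generator n X (topspace X - {x}) c \<longleftrightarrow> homology_generator n X (topspace X - {f x}) c"
proof -
  have fX: "f y \<in> topspace X \<and> g (f y) = y" "g y \<in> topspace X \<and> f (g y) = y" if "y \<in> topspace X" for y
    using hm that by (auto simp: homeomorphic_maps_def continuous_map_def)
  have f: "f \<in> topspace X - {x} \<rightarrow> topspace X - {f x}" and g: "g \<in> topspace X - {f x} \<rightarrow> topspace X - {x}"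
    by (rule inverse_funcsets_minus_point[OF fX(1) fX(2) x]; assumption)+
  have rc: "singular_relcycle n X (topspace X - {x}) c"
    using relcycle_weaken[OF c] by blast
  have "homotopic_with (\<lambda>h. h \<in> {} \<rightarrow> {}) X X id f"
    using hom by simp
  from homotopic_imp_homologous_rel_chain_maps[OF this c]
  have "homologous_rel n X {} (chain_map n id c) (chain_map n f c)" .
  moreover have "chain_map n id c = c"
    using c by (intro chain_map_ident[of n X]) (simp add: singular_relcycle)
  ultimately have h: "homologous_rel n X (topspace X - {f x}) c (chain_map n f c)"
    using homologous_rel_weaken by (metis empty_subsetI)
  have "homology_generator n X (topspace X - {x}) c \<longleftrightarrow> homology_generator n X (topspace X - {f x}) (chain_map n f c)"
    by (rule homology_generator_homeomorphic_maps[OF hm f g rc])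
  also have "\<dots> \<longleftrightarrow> homology_generator n X (topspace X - {f x}) c"
    using h homology_generator_homologous homologous_rel_sym by metis
  finally show ?thesis .
qed

lemma closed_connected_manifold_homeomorphic:
  assumes "X homeomorphic_space Y" "closed_connected_manifold n X"
  shows "closed_connected_manifold n Y"
proof -
  obtain f g where fg: "homeomorphic_maps X Y f g" using assms(1) unfolding homeomorphic_space_def by blast
  have hf: "homeomorphic_map X Y f" and hg: "homeomorphic_map Y X g"
    using fg homeomorphic_maps_map by blast+
  have X: "topspace X \<noteq> {}" "Hausdorff_space X" "second_countable X" "compact_space X" "connected_space X"
    and ch: "\<forall>x\<in>topspace X. \<exists>U V. openin X U \<and> x \<in> U \<and> openin (Euclidean_space n) V \<and>
        subtopology X U homeomorphic_space subtopology (Euclidean_space n) V"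
    using assms(2) unfolding closed_connected_manifold_def by blast+
  have "topspace Y \<noteq> {}"
    using X(1) homeomorphic_imp_surjective_map[OF hf] by blast
  moreover have "Hausdorff_space Y" using X(2) homeomorphic_Hausdorff_space[OF assms(1)] by blast
  moreover have "second_countable Y" using X(3) homeomorphic_space_second_countability[OF assms(1)] by blast
  moreover have "compact_space Y" using X(4) homeomorphic_compact_space[OF assms(1)] by blast
  moreover have "connected_space Y" using X(5) homeomorphic_connected_space[OF assms(1)] by blast
  moreover have "\<exists>U V. openin Y U \<and> y \<in> U \<and> openin (Euclidean_space n) V \<and>
        subtopology Y U homeomorphic_space subtopology (Euclidean_space n) V" if y: "y \<in> topspace Y" for y
  proof -
    have gy: "g y \<in> topspace X" "f (g y) = y"
      using fg y by (auto simp: homeomorphic_maps_def continuous_map_def)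
    obtain U V where U: "openin X U" "g y \<in> U" and V: "openin (Euclidean_space n) V"
      and UV: "subtopology X U homeomorphic_space subtopology (Euclidean_space n) V"
      using ch gy(1) by blast
    have UX: "U \<subseteq> topspace X" using U(1) by (rule openin_subset)
    have "homeomorphic_map (subtopology X U) (subtopology Y (f ` U)) f"
      by (rule homeomorphic_map_subtopologies[OF hf]) (use UX homeomorphic_imp_surjective_map[OF hf] in blast)
    then have "subtopology Y (f ` U) homeomorphic_space subtopology X U"
      using homeomorphic_map_imp_homeomorphic_space homeomorphic_space_sym by blast
    then have "subtopology Y (f ` U) homeomorphic_space subtopology (Euclidean_space n) V"
      using UV homeomorphic_space_trans by blast
    moreover have "openin Y (f ` U)"
      using homeomorphic_map_openness_eq[OF hf] U(1) by blast
    moreover have "y \<in> f ` U" using U(2) gy(2) by (metis imageI)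
    ultimately show ?thesis using V by blast
  qed
  ultimately show ?thesis unfolding closed_connected_manifold_def by blast
qed

lemma volume_two_homeomorphic:
  assumes XY: "X homeomorphic_space Y" and X: "volume_two X"
  shows "volume_two Y"
proof -
  obtain f g where fg: "homeomorphic_maps X Y f g" using XY unfolding homeomorphic_space_def by blast
  have cf: "continuous_map X Y f" and cg: "continuous_map Y X g"
    and gf: "\<And>x. x \<in> topspace X \<Longrightarrow> g (f x) = x" and fg': "\<And>y. y \<in> topspace Y \<Longrightarrow> f (g y) = y"
    using fg unfolding homeomorphic_maps_def by blast+
  have fY: "\<And>x. x \<in> topspace X \<Longrightarrow> f x \<in> topspace Y" and gX: "\<And>y. y \<in> topspace Y \<Longrightarrow> g y \<in> topspace X"
    using continuous_map_funspace[OF cf] continuous_map_funspace[OF cg] by blast+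
  obtain \<sigma> \<tau> e c x where M: "closed_connected_manifold 3 X" and e: "e = 1 \<or> e = - 1"
    and c: "c = frag_of \<sigma> + frag_cmul e (frag_of \<tau>)" and cyc: "singular_relcycle 3 X {} c"
    and gen: "\<And>x. x \<in> topspace X \<Longrightarrow> homology_generator 3 X (topspace X - {x}) c"
    and x: "x \<in> topspace X"
    and low: "\<And>\<rho>. singular_relcycle 3 X {} (frag_of \<rho>) \<Longrightarrow>
       \<exists>k. k \<noteq> 1 \<and> k \<noteq> - 1 \<and> homologous_rel 3 X (topspace X - {x}) (frag_of \<rho>) (frag_cmul k c)"
    using X unfolding volume_two_def by blast
  have maps: "f \<in> topspace X - {x} \<rightarrow> topspace Y - {f x}" "g \<in> topspace Y - {f x} \<rightarrow> topspace X - {x}"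
    if x: "x \<in> topspace X" for x
  proof -
    have 1: "f y \<in> topspace Y \<and> g (f y) = y" if "y \<in> topspace X" for y
      using fY gf that by blast
    have 2: "g y \<in> topspace X \<and> f (g y) = y" if "y \<in> topspace Y" for y
      using gX fg' that by blast
    show "f \<in> topspace X - {x} \<rightarrow> topspace Y - {f x}" "g \<in> topspace Y - {f x} \<rightarrow> topspace X - {x}"
      by (rule inverse_funcsets_minus_point[OF 1 2 x]; assumption)+
  qed
  let ?d = "frag_of (simplex_map 3 f \<sigma>) + frag_cmul e (frag_of (simplex_map 3 f \<tau>))"
  have d: "?d = chain_map 3 f c"
    by (simp only: c chain_map_add chain_map_cmul chain_map_of)
  have dcyc: "singular_relcycle 3 Y {} ?d"
    unfolding d by (rule singular_relcycle_chain_map[OF cyc cf]) simp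
  have dgen: "homology_generator 3 Y (topspace Y - {y}) ?d" if y: "y \<in> topspace Y" for y
  proof -
    have "singular_relcycle 3 X (topspace X - {g y}) c"
      using relcycle_weaken[OF cyc] by blast
    from homology_generator_homeomorphic_maps[OF fg maps[OF gX[OF y]] this] gen[OF gX[OF y]]
    show ?thesis unfolding d fg'[OF y] by blast
  qed
  have dlow: "\<exists>k. k \<noteq> 1 \<and> k \<noteq> - 1 \<and> homologous_rel 3 Y (topspace Y - {f x}) (frag_of \<rho>) (frag_cmul k ?d)"
    if \<rho>: "singular_relcycle 3 Y {} (frag_of \<rho>)" for \<rho>
  proof -
    have "singular_relcycle 3 X {} (chain_map 3 g (frag_of \<rho>))"
      by (rule singular_relcycle_chain_map[OF \<rho> cg]) simp
    then obtain k where k: "k \<noteq> 1" "k \<noteq> - 1"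
      and h: "homologous_rel 3 X (topspace X - {x}) (chain_map 3 g (frag_of \<rho>)) (frag_cmul k c)"
      using low unfolding chain_map_of by blast
    have "homologous_rel 3 Y (topspace Y - {f x}) (chain_map 3 f (chain_map 3 g (frag_of \<rho>))) (chain_map 3 f (frag_cmul k c))"
      using singular_relboundary_chain_map[OF h[unfolded homologous_rel_def] cf maps(1)[OF x]]
      by (simp only: homologous_rel_def chain_map_diff)
    moreover have "chain_map 3 f (chain_map 3 g (frag_of \<rho>)) = frag_of \<rho>"
    proof -
      have "singular_chain 3 Y (frag_of \<rho>)" using \<rho> by (simp add: singular_relcycle)
      from chain_map_id_gen[OF this, of "f \<circ> g"] show ?thesis
        using fg' by (simp only: chain_map_compose comp_apply)
    qed
    ultimately show ?thesis using k unfolding d chain_map_cmul by metis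
  qed
  show ?thesis
    unfolding volume_two_def
    using closed_connected_manifold_homeomorphic[OF XY M] e dcyc dgen dlow fY[OF x] by blast
qed

section \<open>Cycles consisting of one 3-simplex\<close>

lemma chain_boundary_3:
  "chain_boundary 3 (frag_of \<sigma>) = frag_of (singular_face 3 0 \<sigma>) - frag_of (singular_face 3 1 \<sigma>)
      + frag_of (singular_face 3 2 \<sigma>) - frag_of (singular_face 3 3 \<sigma>)"
proof -
  have "{..3::nat} = {0, 1, 2, 3}" by auto
  then show ?thesis by (simp add: chain_boundary_of)
qed

text \<open>The faces enter with alternating signs, so faces 0 and 2 can only cancel against faces 1
  and 3, which leaves two ways of pairing them.\<close>

lemma singular_3_simplex_cycle_iff:
  "singular_relcycle 3 X {} (frag_of \<sigma>) \<longleftrightarrow> singular_simplex 3 X \<sigma> \<and>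
     (singular_face 3 0 \<sigma> = singular_face 3 1 \<sigma> \<and> singular_face 3 2 \<sigma> = singular_face 3 3 \<sigma> \<or>
      singular_face 3 0 \<sigma> = singular_face 3 3 \<sigma> \<and> singular_face 3 1 \<sigma> = singular_face 3 2 \<sigma>)"
proof -
  have "(frag_of a - frag_of b + frag_of c - frag_of d = 0) \<longleftrightarrow> (a = b \<and> c = d \<or> a = d \<and> b = c)"
    for a b c d :: "(nat \<Rightarrow> real) \<Rightarrow> 'a"
  proof
    assume eq: "frag_of a - frag_of b + frag_of c - frag_of d = 0"
    have l: "(if x = a then 1 else 0) - (if x = b then 1 else 0) + (if x = c then 1 else 0) - (if x = d then 1 else 0) = (0::int)" for x
      using arg_cong[OF eq, of "\<lambda>p. Poly_Mapping.lookup p x"]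
      by (simp only: lookup_minus lookup_add lookup_frag_of lookup_zero)
    show "a = b \<and> c = d \<or> a = d \<and> b = c"
      using l[of a] l[of b] l[of c] l[of d] by (auto split: if_splits)
  qed auto
  then show ?thesis
    unfolding singular_cycle chain_boundary_3 singular_chain_of by blast
qed

section \<open>Lifting simplices and moving points\<close>

text \<open>Turns the exponential covering of the punctured plane into a covering of its product
  with the 2-sphere. The sheets over \<open>T \<times> K\<close> are the sheets over
  \<open>T\<close>, multiplied by \<open>K\<close>.\<close>

lemma covering_space_Times_id:
  assumes "covering_space C p S"
  shows "covering_space (C \<times> K) (\<lambda>z. (p (fst z), snd z)) (S \<times> K)"
proof
  have cp: "continuous_on C p" and pS: "p ` C = S"
    using assms by (simp_all add: covering_space_imp_continuous covering_space_imp_surjective)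
  show "continuous_on (C \<times> K) (\<lambda>z. (p (fst z), snd z))"
    by (intro continuous_on_Pair continuous_on_compose2[OF cp] continuous_on_fst continuous_on_snd continuous_on_id) auto
  show "(\<lambda>z. (p (fst z), snd z)) ` (C \<times> K) = S \<times> K"
    using pS by force
  fix x assume x: "x \<in> S \<times> K"
  obtain T v where T: "fst x \<in> T" "openin (top_of_set S) T" and v: "\<Union>v = C \<inter> p -` T"
    "\<forall>u\<in>v. openin (top_of_set C) u" "pairwise disjnt v" "\<forall>u\<in>v. \<exists>q. homeomorphism u T p q"
    using assms x unfolding covering_space_def by (metis SigmaE fst_conv)
  show "\<exists>T. x \<in> T \<and> openin (top_of_set (S \<times> K)) T \<and>
      (\<exists>v. \<Union>v = (C \<times> K) \<inter> (\<lambda>z. (p (fst z), snd z)) -` T \<and> (\<forall>u\<in>v. openin (top_of_set (C \<times> K)) u) \<and>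
        pairwise disjnt v \<and> (\<forall>u\<in>v. \<exists>q. homeomorphism u T (\<lambda>z. (p (fst z), snd z)) q))"
  proof (rule exI[of _ "T \<times> K"], intro conjI, rule_tac [3] exI[of _ "(\<lambda>u. u \<times> K) ` v"], rule_tac [3] conjI,
      rule_tac [4] conjI, rule_tac [5] conjI, rule_tac [4] ballI, rule_tac [6] ballI)
    show "x \<in> T \<times> K" using x T(1) by (cases x) auto
    show "openin (top_of_set (S \<times> K)) (T \<times> K)"
      using T(2) by (intro openin_Times) auto
    show "\<Union>((\<lambda>u. u \<times> K) ` v) = (C \<times> K) \<inter> (\<lambda>z. (p (fst z), snd z)) -` (T \<times> K)"
    proof -
      have "\<Union>((\<lambda>u. u \<times> K) ` v) = \<Union>v \<times> K" by blast
      then show ?thesis unfolding v(1) by auto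
    qed
    show "pairwise disjnt ((\<lambda>u. u \<times> K) ` v)"
      using v(3) unfolding pairwise_def disjnt_def by blast
    show "openin (top_of_set (C \<times> K)) w" if w: "w \<in> (\<lambda>u. u \<times> K) ` v" for w
    proof -
      obtain u where u: "u \<in> v" "w = u \<times> K" using w by blast
      then show ?thesis using v(2) by (simp add: openin_Times)
    qed
    fix w assume "w \<in> (\<lambda>u. u \<times> K) ` v"
    then obtain u where u: "u \<in> v" "w = u \<times> K" by blast
    obtain q where q: "homeomorphism u T p q" using v(4) u(1) by blast
    have cu: "continuous_on u p" and cq: "continuous_on T q" and im: "p ` u = T" "q ` T = u"
      and inv: "\<And>x. x \<in> u \<Longrightarrow> q (p x) = x" "\<And>y. y \<in> T \<Longrightarrow> p (q y) = y"
      using q unfolding homeomorphism_def by blast+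
    have "homeomorphism w (T \<times> K) (\<lambda>z. (p (fst z), snd z)) (\<lambda>z. (q (fst z), snd z))"
    proof (rule homeomorphismI)
      show "continuous_on w (\<lambda>z. (p (fst z), snd z))" unfolding u(2)
        by (intro continuous_on_Pair continuous_on_compose2[OF cu] continuous_on_fst continuous_on_snd continuous_on_id) auto
      show "continuous_on (T \<times> K) (\<lambda>z. (q (fst z), snd z))"
        by (intro continuous_on_Pair continuous_on_compose2[OF cq] continuous_on_fst continuous_on_snd continuous_on_id) auto
      show "(\<lambda>z. (p (fst z), snd z)) ` w \<subseteq> T \<times> K" unfolding u(2) using im by auto
      show "(\<lambda>z. (q (fst z), snd z)) ` (T \<times> K) \<subseteq> w" unfolding u(2) using im by auto
    qed (use inv u(2) in auto)
    then show "\<exists>q. homeomorphism w (T \<times> K) (\<lambda>z. (p (fst z), snd z)) q" by blast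
  qed
qed

text \<open>Inverse of the affine coordinates that drop coordinate 0. They present the standard
  simplex as a convex subset of a normed space, where maps lift along coverings.\<close>

definition affine_to_simplex :: "complex \<times> real \<Rightarrow> nat \<Rightarrow> real" where
  "affine_to_simplex v = (\<lambda>i. if i = 0 then 1 - Re (fst v) - Im (fst v) - snd v else if i = 1 then Re (fst v)
     else if i = 2 then Im (fst v) else if i = 3 then snd v else 0)"

lemma affine_to_simplex_inverse:
  assumes "t \<in> standard_simplex 3"
  shows "affine_to_simplex (Complex (t 1) (t 2), t 3) = t"
proof
  fix i
  have "(\<Sum>i\<le>3. t i) = 1" and z: "\<And>i. i > 3 \<Longrightarrow> t i = 0" using assms by (auto simp: standard_simplex_def)
  then have "t 0 + t 1 + t 2 + t 3 = 1" by (simp add: eval_nat_numeral)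
  moreover have "t i = 0" if "i \<noteq> 0" "i \<noteq> 1" "i \<noteq> 2" "i \<noteq> 3"
    using z[of i] that by linarith
  ultimately show "affine_to_simplex (Complex (t 1) (t 2), t 3) i = t i"
    by (auto simp: affine_to_simplex_def)
qed

lemma singular_simplex_3_lift:
  fixes p :: "'a::real_normed_vector \<Rightarrow> 'b::real_normed_vector"
  assumes cov: "covering_space C p S" and \<sigma>: "singular_simplex 3 (top_of_set S) \<sigma>"
  shows "\<exists>\<rho>. singular_simplex 3 (top_of_set C) \<rho> \<and> simplex_map 3 p \<rho> = \<sigma>"
proof -
  let ?D = "standard_simplex 3" and ?m = affine_to_simplex
  let ?j = "\<lambda>t::nat \<Rightarrow> real. (Complex (t 1) (t 2), t 3)"
  define K where "K = {v. ?m v \<in> ?D}"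
  have cont: "continuous_on ?D \<sigma>" and im: "\<sigma> \<in> ?D \<rightarrow> S" and sext: "\<sigma> \<in> extensional ?D"
    using \<sigma> unfolding singular_simplex_top_of_set by blast+
  have cm: "continuous_on A ?m" for A
  proof (rule continuous_on_coordinatewise_then_product)
    fix i show "continuous_on A (\<lambda>v. ?m v i)"
      unfolding affine_to_simplex_def
      by (cases "i = 0"; cases "i = 1"; cases "i = 2"; cases "i = 3") (auto intro!: continuous_intros)
  qed
  have "convex K"
  proof (rule convexI)
    fix x y :: "complex \<times> real" and u v :: real
    assume xy: "x \<in> K" "y \<in> K" and uv: "0 \<le> u" "0 \<le> v" "u + v = 1"
    have v: "v = 1 - u" using uv by simp
    have "?m (u *\<^sub>R x + v *\<^sub>R y) = (\<lambda>i. (1 - v) * ?m x i + v * ?m y i)"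
      by (rule ext) (simp add: affine_to_simplex_def v algebra_simps)
    moreover have "(\<lambda>i. (1 - v) * ?m x i + v * ?m y i) \<in> ?D"
      using xy uv unfolding K_def by (intro convex_standard_simplex) auto
    ultimately show "u *\<^sub>R x + v *\<^sub>R y \<in> K" unfolding K_def by simp
  qed
  then have K: "simply_connected K" "locally path_connected K"
    by (simp_all add: convex_imp_simply_connected convex_imp_locally_path_connected)
  have "continuous_on K (\<sigma> \<circ> ?m)"
    by (intro continuous_on_compose cm continuous_on_subset[OF cont]) (auto simp: K_def)
  moreover have "\<sigma> \<circ> ?m \<in> K \<rightarrow> S" using im by (auto simp: K_def)
  ultimately obtain g where g: "continuous_on K g" "g \<in> K \<rightarrow> C" "\<And>v. v \<in> K \<Longrightarrow> p (g v) = (\<sigma> \<circ> ?m) v"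
    using covering_space_lift[OF cov K] by blast
  have jK: "?j t \<in> K" if "t \<in> ?D" for t
    using affine_to_simplex_inverse[OF that] that unfolding K_def by simp
  let ?\<rho> = "restrict (g \<circ> ?j) ?D"
  have cj: "continuous_on ?D ?j"
    by (intro continuous_intros continuous_on_Complex)
  have "continuous_on ?D (g \<circ> ?j)"
    by (intro continuous_on_compose cj continuous_on_subset[OF g(1)]) (use jK in auto)
  then have "singular_simplex 3 (top_of_set C) ?\<rho>"
    using g(2) jK by (auto simp: singular_simplex_top_of_set)
  moreover have "simplex_map 3 p ?\<rho> = \<sigma>"
  proof
    fix t
    show "simplex_map 3 p ?\<rho> t = \<sigma> t"
    proof (cases "t \<in> ?D")
      case True
      then show ?thesis using g(3)[OF jK[OF True]] affine_to_simplex_inverse[OF True] by (simp add: simplex_map_def)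
    next
      case False
      then show ?thesis using extensional_arb[OF sext False] by (simp add: simplex_map_def)
    qed
  qed
  ultimately show ?thesis by blast
qed

lemma singular_simplex_lift_unique:
  fixes p :: "'a::real_normed_vector \<Rightarrow> 'b::real_normed_vector"
  assumes cov: "covering_space C p S" and \<alpha>: "singular_simplex n (top_of_set C) \<alpha>" and \<beta>: "singular_simplex n (top_of_set C) \<beta>"
    and eq: "simplex_map n p \<alpha> = simplex_map n p \<beta>" and a: "a \<in> standard_simplex n" "\<alpha> a = \<beta> a"
  shows "\<alpha> = \<beta>"
proof
  fix x
  have c: "continuous_on (standard_simplex n) \<alpha>" "\<alpha> \<in> standard_simplex n \<rightarrow> C" "\<alpha> \<in> extensional (standard_simplex n)"
    "continuous_on (standard_simplex n) \<beta>" "\<beta> \<in> standard_simplex n \<rightarrow> C" "\<beta> \<in> extensional (standard_simplex n)"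
    using \<alpha> \<beta> unfolding singular_simplex_top_of_set by blast+
  have p\<beta>: "p (\<alpha> t) = p (\<beta> t)" if "t \<in> standard_simplex n" for t
    using fun_cong[OF eq, of t] that by (simp add: simplex_map_def)
  have con: "connected (standard_simplex n)"
    using connectedin_standard_simplex[of n] unfolding powertop_real_eq_euclidean by simp
  have cp: "continuous_on (standard_simplex n) (\<lambda>t. p (\<alpha> t))"
    by (rule continuous_on_compose2[OF covering_space_imp_continuous[OF cov] c(1)]) (use c(2) in blast)
  have pS: "(\<lambda>t. p (\<alpha> t)) \<in> standard_simplex n \<rightarrow> S"
    using covering_space_imp_surjective[OF cov] c(2) by blast
  show "\<alpha> x = \<beta> x"
  proof (cases "x \<in> standard_simplex n")
    case True
    show ?thesis
      by (rule covering_space_lift_unique[OF cov a(2) cp pS c(1,2) refl c(4,5) p\<beta> con a(1) True])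
  next
    case False
    then show ?thesis using extensional_arb c(3,6) by metis
  qed
qed

abbreviation vertex :: "nat \<Rightarrow> nat \<Rightarrow> real" where
  "vertex i \<equiv> (\<lambda>j. if j = i then 1 else 0)"

lemma singular_face_vertex:
  assumes "i \<le> n"
  shows "singular_face (Suc n) k \<rho> (vertex i) = \<rho> (vertex (if i < k then i else Suc i))"
proof -
  have "simplical_face k (vertex i) = vertex (if i < k then i else Suc i)"
    by (auto simp: simplical_face_def fun_eq_iff)
  then show ?thesis using assms by (simp add: singular_face_def)
qed

text \<open>If all faces of a 3-simplex are identified in pairs so as to form a cycle, then the identification
  space is simply connected; hence the simplex lifts to a cycle in every covering.\<close>

lemma singular_3_simplex_cycle_lift:
  fixes p :: "'a::real_normed_vector \<Rightarrow> 'b::real_normed_vector"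
  assumes cov: "covering_space C p S" and \<sigma>: "singular_relcycle 3 (top_of_set S) {} (frag_of \<sigma>)"
  shows "\<exists>\<rho>. singular_relcycle 3 (top_of_set C) {} (frag_of \<rho>) \<and> simplex_map 3 p \<rho> = \<sigma>"
proof -
  have s: "singular_simplex 3 (top_of_set S) \<sigma>" and cyc:
     "singular_face 3 0 \<sigma> = singular_face 3 1 \<sigma> \<and> singular_face 3 2 \<sigma> = singular_face 3 3 \<sigma> \<or>
      singular_face 3 0 \<sigma> = singular_face 3 3 \<sigma> \<and> singular_face 3 1 \<sigma> = singular_face 3 2 \<sigma>"
    using \<sigma> unfolding singular_3_simplex_cycle_iff by blast+
  obtain \<rho> where \<rho>: "singular_simplex 3 (top_of_set C) \<rho>" and p\<rho>: "simplex_map 3 p \<rho> = \<sigma>"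
    using singular_simplex_3_lift[OF cov s] by blast
  have face: "singular_simplex 2 (top_of_set C) (singular_face 3 k \<rho>)" if "k \<le> 3" for k
    using singular_simplex_singular_face[OF \<rho>, of k] that by simp
  have pface: "simplex_map 2 p (singular_face 3 k \<rho>) = singular_face 3 k \<sigma>" if "k \<le> 3" for k
  proof -
    have "singular_face 3 k (simplex_map 3 p \<rho>) = simplex_map 2 p (\<rho> \<circ> simplical_face k)"
      using singular_face_simplex_map[of 3 k p \<rho>] that by simp
    moreover have "simplex_map 2 p (singular_face 3 k \<rho>) = simplex_map 2 p (\<rho> \<circ> simplical_face k)"
      by (simp add: simplex_map_def singular_face_def fun_eq_iff)
    ultimately show ?thesis using p\<rho> by simp
  qed
  have uniq: "singular_face 3 j \<rho> = singular_face 3 k \<rho>"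
    if "j \<le> 3" "k \<le> 3" "singular_face 3 j \<sigma> = singular_face 3 k \<sigma>" "i \<le> 2"
      "singular_face 3 j \<rho> (vertex i) = singular_face 3 k \<rho> (vertex i)" for i j k
  proof (rule singular_simplex_lift_unique[OF cov face[OF that(1)] face[OF that(2)] _ _ that(5)])
    show "simplex_map 2 p (singular_face 3 j \<rho>) = simplex_map 2 p (singular_face 3 k \<rho>)"
      unfolding pface[OF that(1)] pface[OF that(2)] by (rule that(3))
    show "vertex i \<in> standard_simplex 2" using that(4) by simp
  qed
  have vf: "singular_face 3 k \<rho> (vertex i) = \<rho> (vertex (if i < k then i else Suc i))" if "i \<le> 2" for i k
    using singular_face_vertex[of i 2 k \<rho>] that by (simp add: eval_nat_numeral)
  from cyc have "singular_face 3 0 \<rho> = singular_face 3 1 \<rho> \<and> singular_face 3 2 \<rho> = singular_face 3 3 \<rho> \<or>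
      singular_face 3 0 \<rho> = singular_face 3 3 \<rho> \<and> singular_face 3 1 \<rho> = singular_face 3 2 \<rho>"
  proof
    assume a: "singular_face 3 0 \<sigma> = singular_face 3 1 \<sigma> \<and> singular_face 3 2 \<sigma> = singular_face 3 3 \<sigma>"
    \<comment> \<open>Vertex 1 of face 0 and of face 1 is vertex 2 of the simplex, and vertex 0 of
      faces 2 and 3 is its vertex 0. So the lifts of paired faces share a value in matching
      position.\<close>
    have "singular_face 3 0 \<rho> = singular_face 3 1 \<rho>"
      by (rule uniq[of _ _ 1]) (use a vf[of 1 0] vf[of 1 1] in simp_all)
    moreover have "singular_face 3 2 \<rho> = singular_face 3 3 \<rho>"
      by (rule uniq[of _ _ 0]) (use a vf[of 0 2] vf[of 0 3] in simp_all)
    ultimately show ?thesis by blast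
  next
    assume a: "singular_face 3 0 \<sigma> = singular_face 3 3 \<sigma> \<and> singular_face 3 1 \<sigma> = singular_face 3 2 \<sigma>"
    \<comment> \<open>Faces 1 and 2 share vertex 0. Their equality, read at vertex 1, makes
      \<open>\<rho>\<close> agree at vertices 2 and 1 of the simplex; these are vertex 1 of faces 0
      and 3, which provides the common value that this second pair needs.\<close>
    have f12: "singular_face 3 1 \<rho> = singular_face 3 2 \<rho>"
      by (rule uniq[of _ _ 0]) (use a vf[of 0 1] vf[of 0 2] in simp_all)
    have "\<rho> (vertex 2) = \<rho> (vertex 1)"
      using fun_cong[OF f12, of "vertex 1"] vf[of 1 1] vf[of 1 2] by (simp add: numeral_2_eq_2)
    then have "singular_face 3 0 \<rho> = singular_face 3 3 \<rho>"
      by (intro uniq[of _ _ 1]) (use a vf[of 1 0] vf[of 1 3] in \<open>simp_all add: numeral_2_eq_2\<close>)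
    then show ?thesis using f12 by blast
  qed
  then have "singular_relcycle 3 (top_of_set C) {} (frag_of \<rho>)"
    using \<rho> unfolding singular_3_simplex_cycle_iff by blast
  then show ?thesis using p\<rho> by blast
qed

section \<open>Homogeneous spaces and their charts\<close>

definition isotopic_to_id :: "'a topology \<Rightarrow> 'a \<Rightarrow> 'a \<Rightarrow> bool" where
  "isotopic_to_id X x y \<longleftrightarrow> (\<exists>f g. homeomorphic_maps X X f g \<and> homotopic_with (\<lambda>_. True) X X id f \<and> f x = y)"

text \<open>At every time \<open>F\<close> respects the fibres of \<open>q\<close>, so it descends
  to a homotopy of \<open>X\<close>. Continuity downstairs holds because the product of
  \<open>q\<close> with the interval, a continuous surjection from a compact onto a Hausdorff space,
  is a quotient map again. In the same way \<open>G\<close> descends to the inverse of the final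
  map.\<close>

lemma isotopic_to_id_quotient:
  assumes q: "continuous_map T X q" "q ` topspace T = topspace X" and T: "compact_space T" and X: "Hausdorff_space X"
    and F: "continuous_map (prod_topology (top_of_set {0..1::real}) T) T F" and F0: "\<And>y. y \<in> topspace T \<Longrightarrow> F (0, y) = y"
    and Fq: "\<And>t y y'. \<lbrakk>t \<in> {0..1}; y \<in> topspace T; y' \<in> topspace T; q y = q y'\<rbrakk> \<Longrightarrow> q (F (t, y)) = q (F (t, y'))"
    and G: "continuous_map T T G" and GF: "\<And>y. y \<in> topspace T \<Longrightarrow> G (F (1, y)) = y" "\<And>y. y \<in> topspace T \<Longrightarrow> F (1, G y) = y"
    and Gq: "\<And>y y'. \<lbrakk>y \<in> topspace T; y' \<in> topspace T; q y = q y'\<rbrakk> \<Longrightarrow> q (G y) = q (G y')"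
    and y0: "y0 \<in> topspace T"
  shows "isotopic_to_id X (q y0) (q (F (1, y0)))"
proof -
  let ?I = "top_of_set {0..1::real}"
  let ?Q = "\<lambda>z. (fst z, q (snd z))"
  have FT: "F (t, y) \<in> topspace T" if "t \<in> {0..1}" "y \<in> topspace T" for t y
    using continuous_map_funspace[OF F] that by auto
  have GT: "G y \<in> topspace T" if "y \<in> topspace T" for y
    using continuous_map_funspace[OF G] that by auto
  have qX: "q y \<in> topspace X" if "y \<in> topspace T" for y using q(2) that by blast
  have cpt: "compact_space (prod_topology ?I T)"
    using T compact_Icc by (simp add: compact_space_prod_topology compact_space_subtopology)
  have haus: "Hausdorff_space (prod_topology ?I X)"
    using X by (simp add: Hausdorff_space_prod_topology Hausdorff_space_subtopology)
  have QM: "quotient_map (prod_topology ?I T) (prod_topology ?I X) ?Q"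
  proof (rule continuous_imp_quotient_map[OF _ cpt haus])
    show "continuous_map (prod_topology ?I T) (prod_topology ?I X) ?Q"
      by (intro continuous_map_pairedI continuous_map_fst continuous_map_compose[OF continuous_map_snd q(1), unfolded comp_def])
    show "?Q ` topspace (prod_topology ?I T) = topspace (prod_topology ?I X)"
    proof
      show "?Q ` topspace (prod_topology ?I T) \<subseteq> topspace (prod_topology ?I X)"
        using qX by auto
      show "topspace (prod_topology ?I X) \<subseteq> ?Q ` topspace (prod_topology ?I T)"
      proof
        fix z assume z: "z \<in> topspace (prod_topology ?I X)"
        then have "snd z \<in> topspace X" by auto
        then obtain y where "y \<in> topspace T" "snd z = q y" using q(2) by (metis imageE)
        then show "z \<in> ?Q ` topspace (prod_topology ?I T)"
          using z by (intro image_eqI[of _ _ "(fst z, y)"]) (auto simp: prod_eq_iff)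
      qed
    qed
  qed
  have CM: "continuous_map (prod_topology ?I T) X (\<lambda>z. q (F z))"
    using continuous_map_compose[OF F q(1)] by (simp add: comp_def)
  have EQ: "q (F z) = q (F z')" if "z \<in> topspace (prod_topology ?I T)" "z' \<in> topspace (prod_topology ?I T)" "?Q z = ?Q z'" for z z'
    using Fq[of "fst z" "snd z" "snd z'"] that by (cases z; cases z') auto
  obtain H where H: "continuous_map (prod_topology ?I X) X H"
      "\<And>z. z \<in> topspace (prod_topology ?I T) \<Longrightarrow> H (?Q z) = q (F z)"
    apply (rule quotient_map_lift_exists[OF QM CM], erule (2) EQ)
    subgoal premises prems for h by (rule prems(1)[OF prems(2)]) (rule prems(4))
    done
  have Hq: "H (t, q y) = q (F (t, y))" if "t \<in> {0..1}" "y \<in> topspace T" for t y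
    using H(2)[of "(t, y)"] that by simp
  have QM': "quotient_map T X q"
    by (rule continuous_imp_quotient_map[OF q(1) T X q(2)])
  have CM': "continuous_map T X (\<lambda>y. q (G y))"
    using continuous_map_compose[OF G q(1)] by (simp add: comp_def)
  obtain g where g: "continuous_map X X g" "\<And>y. y \<in> topspace T \<Longrightarrow> g (q y) = q (G y)"
    apply (rule quotient_map_lift_exists[OF QM' CM'], erule (2) Gq)
    subgoal premises prems for h by (rule prems(1)[OF prems(2)]) (rule prems(4))
    done
  define f where "f = (\<lambda>x. H (1, x))"
  have "continuous_map X (prod_topology ?I X) (\<lambda>x. (1, x))"
    by (intro continuous_map_pairedI) auto
  then have f: "continuous_map X X f"
    unfolding f_def using continuous_map_compose[OF _ H(1)] by (simp add: comp_def)
  have fq: "f (q y) = q (F (1, y))" if "y \<in> topspace T" for y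
    unfolding f_def using Hq that by simp
  have lift: "\<exists>y\<in>topspace T. x = q y" if "x \<in> topspace X" for x
    using q(2) that by (metis imageE)
  have "homeomorphic_maps X X f g"
    unfolding homeomorphic_maps_def
  proof (intro conjI ballI f g(1))
    fix x assume "x \<in> topspace X"
    then obtain y where y: "y \<in> topspace T" "x = q y" using lift by blast
    show "g (f x) = x" using y fq g(2) FT GF by simp
    show "f (g x) = x" using y fq g(2) GT GF by simp
  qed
  moreover have "homotopic_with (\<lambda>_. True) X X id f"
  proof -
    have "H (0, x) = x" if x: "x \<in> topspace X" for x
    proof -
      obtain y where y: "y \<in> topspace T" "x = q y" using lift[OF x] by blast
      then show ?thesis using Hq[of 0 y] F0 by simp
    qed
    then show ?thesis
      using H(1) by (subst homotopic_with) (auto simp: f_def intro!: exI[of _ H])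
  qed
  ultimately show ?thesis
    unfolding isotopic_to_id_def using fq[OF y0] by blast
qed

lemma homology_generator_homogeneous:
  assumes c: "singular_relcycle n X {} c" and iso: "\<And>x. x \<in> topspace X \<Longrightarrow> isotopic_to_id X x0 x"
    and x0: "x0 \<in> topspace X" and x1: "x1 \<in> topspace X" "homology_generator n X (topspace X - {x1}) c" and x: "x \<in> topspace X"
  shows "homology_generator n X (topspace X - {x}) c"
proof -
  have "homology_generator n X (topspace X - {x0}) c \<longleftrightarrow> homology_generator n X (topspace X - {y}) c" if "y \<in> topspace X" for y
    using iso[OF that] homology_generator_isotopy[OF c _ _ x0] unfolding isotopic_to_id_def by blast
  then show ?thesis using x1 x by blast
qed

definition euclidean_chart :: "nat \<Rightarrow> 'a topology \<Rightarrow> 'a \<Rightarrow> bool" where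
  "euclidean_chart n X x \<longleftrightarrow> (\<exists>U V. openin X U \<and> x \<in> U \<and> openin (Euclidean_space n) V \<and>
        subtopology X U homeomorphic_space subtopology (Euclidean_space n) V)"

lemma euclidean_chart_homeomorphic:
  assumes fg: "homeomorphic_maps X Y f g" and c: "euclidean_chart n X x"
  shows "euclidean_chart n Y (f x)"
proof -
  have hf: "homeomorphic_map X Y f" using fg homeomorphic_maps_map by blast
  obtain U V where U: "openin X U" "x \<in> U" and V: "openin (Euclidean_space n) V"
    and UV: "subtopology X U homeomorphic_space subtopology (Euclidean_space n) V"
    using c unfolding euclidean_chart_def by blast
  have UX: "U \<subseteq> topspace X" using U(1) by (rule openin_subset)
  have "homeomorphic_map (subtopology X U) (subtopology Y (f ` U)) f"
    by (rule homeomorphic_map_subtopologies[OF hf]) (use UX homeomorphic_imp_surjective_map[OF hf] in blast)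
  then have "subtopology Y (f ` U) homeomorphic_space subtopology X U"
    using homeomorphic_map_imp_homeomorphic_space homeomorphic_space_sym by blast
  then have "subtopology Y (f ` U) homeomorphic_space subtopology (Euclidean_space n) V"
    using UV homeomorphic_space_trans by blast
  moreover have "openin Y (f ` U)"
    using homeomorphic_map_openness_eq[OF hf] U(1) by blast
  ultimately show ?thesis using U(2) V unfolding euclidean_chart_def by blast
qed

text \<open>The chart travels from \<open>x1\<close> back to the base point \<open>x0\<close>, and
  from there to \<open>x\<close>.\<close>

lemma euclidean_chart_homogeneous:
  assumes iso: "\<And>x. x \<in> topspace X \<Longrightarrow> isotopic_to_id X x0 x" and x0: "x0 \<in> topspace X"
    and x1: "x1 \<in> topspace X" "euclidean_chart n X x1" and x: "x \<in> topspace X"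
  shows "euclidean_chart n X x"
proof -
  obtain f g where fg: "homeomorphic_maps X X f g" "f x0 = x1"
    using iso[OF x1(1)] unfolding isotopic_to_id_def by blast
  have "homeomorphic_maps X X g f" using fg(1) homeomorphic_maps_sym by blast
  then have "euclidean_chart n X (g x1)" using x1(2) by (rule euclidean_chart_homeomorphic)
  moreover have "g x1 = x0" using fg x0 unfolding homeomorphic_maps_def by blast
  moreover obtain f' g' where "homeomorphic_maps X X f' g'" "f' x0 = x"
    using iso[OF x] unfolding isotopic_to_id_def by blast
  ultimately show ?thesis using euclidean_chart_homeomorphic by metis
qed

lemma euclidean_chart_of_homeomorphism:
  fixes \<phi> :: "complex \<times> real \<Rightarrow> 'b::topological_space"
  assumes "openin (top_of_set S) V" "homeomorphism W V \<phi> \<psi>" "open W" "x \<in> V"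
  shows "euclidean_chart 3 (top_of_set S) x"
proof -
  have VS: "V \<subseteq> S" using assms(1) openin_imp_subset by blast
  obtain f :: "(nat \<Rightarrow> real) \<Rightarrow> complex \<times> real" and g where fg: "homeomorphic_maps (Euclidean_space 3) euclidean f g"
    using homeomorphic_maps_Euclidean_space_euclidean[where 'n = "complex \<times> real"] by (metis DIM_complex DIM_prod DIM_real numeral_plus_one semiring_norm(5))
  then have hg: "homeomorphic_map euclidean (Euclidean_space 3) g"
    using homeomorphic_maps_map by blast
  have "homeomorphic_map (subtopology euclidean W) (subtopology (Euclidean_space 3) (g ` W)) g"
    by (rule homeomorphic_map_subtopologies[OF hg]) (use homeomorphic_imp_surjective_map[OF hg] in auto)
  then have "top_of_set W homeomorphic_space subtopology (Euclidean_space 3) (g ` W)"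
    using homeomorphic_map_imp_homeomorphic_space by blast
  moreover have "top_of_set V homeomorphic_space top_of_set W"
  proof -
    have "homeomorphic_maps (top_of_set V) (top_of_set W) \<psi> \<phi>"
      using homeomorphism_symD[OF assms(2)] by (simp only: homeomorphic_maps_iff_homeomorphism)
    then show ?thesis unfolding homeomorphic_space_def by blast
  qed
  ultimately have "top_of_set V homeomorphic_space subtopology (Euclidean_space 3) (g ` W)"
    using homeomorphic_space_trans by blast
  moreover have "subtopology (top_of_set S) V = top_of_set V"
    using VS by (simp add: subtopology_subtopology Int_absorb1)
  moreover have "openin (Euclidean_space 3) (g ` W)"
    using homeomorphic_map_openness_eq[OF hg] assms(3) by simp
  ultimately show ?thesis
    using assms(1,4) unfolding euclidean_chart_def by metis
qed

text \<open>The chart is cut down to its overlap with the sheet \<open>U\<close> and then pushed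
  forward along \<open>q\<close>.\<close>

lemma euclidean_chart_local_homeomorphism:
  fixes \<phi> :: "complex \<times> real \<Rightarrow> 'a::topological_space" and q :: "'a \<Rightarrow> 'b::topological_space"
  assumes V: "openin (top_of_set S) V" "homeomorphism UNIV V \<phi> \<psi>"
    and U: "openin (top_of_set S) U" "openin (top_of_set R) U'" "homeomorphism U U' q r"
    and y: "y \<in> U" "y \<in> V"
  shows "euclidean_chart 3 (top_of_set R) (q y)"
proof -
  define W where "W = U \<inter> V"
  have WU: "W \<subseteq> U" and WV: "W \<subseteq> V" by (auto simp: W_def)
  have WS: "openin (top_of_set S) W" unfolding W_def by (rule openin_Int[OF U(1) V(1)])
  have oV: "openin (top_of_set V) W" by (rule openin_subset_trans[OF WS WV openin_imp_subset[OF V(1)]])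
  have oU: "openin (top_of_set U) W" by (rule openin_subset_trans[OF WS WU openin_imp_subset[OF U(1)]])
  have oW: "open (\<psi> ` W)"
    using homeomorphism_imp_open_map[OF homeomorphism_symD[OF V(2)] oV] by (simp only: subtopology_UNIV open_openin)
  have hW: "homeomorphism (\<psi> ` W) W \<phi> \<psi>"
  proof (rule homeomorphism_of_subsets[OF V(2)])
    show "\<phi> ` \<psi> ` W = W" using homeomorphism_apply2[OF V(2)] WV by (force simp: image_image)
  qed (use WV in simp_all)
  have hq: "homeomorphism W (q ` W) q r"
    by (rule homeomorphism_of_subsets[OF U(3) WU]) (use homeomorphism_image1[OF U(3)] WU in blast)+
  show ?thesis
    by (rule euclidean_chart_of_homeomorphism[OF openin_trans[OF homeomorphism_imp_open_map[OF U(3) oU] U(2)]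
          homeomorphism_compose[OF hW hq] oW]) (use y in \<open>simp add: W_def\<close>)
qed

section \<open>Quotients of the 3-sphere\<close>

abbreviation S3 :: "(complex \<times> complex) set" where
  "S3 \<equiv> sphere 0 1"

definition scale :: "complex \<Rightarrow> complex \<times> complex \<Rightarrow> complex \<times> complex" where
  "scale \<zeta> y = (\<zeta> * fst y, \<zeta> * snd y)"

lemma scale_scale: "scale a (scale b y) = scale (a * b) y"
  by (simp add: scale_def mult.assoc)

lemma scale_1 [simp]: "scale 1 y = y"
  by (simp add: scale_def)

lemma norm_scale: "norm (scale \<zeta> y) = norm \<zeta> * norm y"
  by (cases y) (simp add: scale_def norm_Pair norm_mult power_mult_distrib real_sqrt_mult flip: distrib_left)

lemma dist_scale: "dist (scale \<zeta> x) (scale \<zeta> y) = norm \<zeta> * dist x y"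
proof -
  have "scale \<zeta> x - scale \<zeta> y = scale \<zeta> (x - y)"
    by (simp add: scale_def algebra_simps minus_prod_def)
  then show ?thesis by (simp add: dist_norm norm_scale)
qed

lemma dist_scale_left: "dist (scale a y) (scale b y) = norm (a - b) * norm y"
proof -
  have "scale a y - scale b y = scale (a - b) y"
    by (simp add: scale_def algebra_simps minus_prod_def)
  then show ?thesis by (simp add: dist_norm norm_scale)
qed

lemma continuous_on_scale: "continuous_on A (scale \<zeta>)"
  unfolding scale_def by (intro continuous_intros)

text \<open>Left multiplication of unit quaternions; it commutes with complex scalars acting on both coordinates.\<close>

definition qmult :: "complex \<times> complex \<Rightarrow> complex \<times> complex \<Rightarrow> complex \<times> complex" where
  "qmult s y = (fst s * fst y - cnj (snd s) * snd y, snd s * fst y + cnj (fst s) * snd y)"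

definition qinv :: "complex \<times> complex \<Rightarrow> complex \<times> complex" where
  "qinv s = (cnj (fst s), - snd s)"

lemma qmult_scale: "qmult s (scale \<zeta> y) = scale \<zeta> (qmult s y)"
  by (simp add: qmult_def scale_def algebra_simps)

text \<open>The complex form of the norm equation, which reduces the quaternion identities below to
  commutative ring arithmetic.\<close>

lemma mem_S3: "y \<in> S3 \<longleftrightarrow> fst y * cnj (fst y) + snd y * cnj (snd y) = 1"
proof -
  have "norm y = 1 \<longleftrightarrow> (norm (fst y))\<^sup>2 + (norm (snd y))\<^sup>2 = 1"
    by (cases y) (simp add: norm_Pair)
  also have "\<dots> \<longleftrightarrow> complex_of_real ((norm (fst y))\<^sup>2 + (norm (snd y))\<^sup>2) = 1"
    using of_real_eq_1_iff by blast
  also have "\<dots> \<longleftrightarrow> fst y * cnj (fst y) + snd y * cnj (snd y) = 1"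
    by (simp only: of_real_add complex_norm_square)
  finally show ?thesis by simp
qed

lemma qmult_S3:
  assumes "s \<in> S3" "y \<in> S3"
  shows "qmult s y \<in> S3"
proof -
  have "fst (qmult s y) * cnj (fst (qmult s y)) + snd (qmult s y) * cnj (snd (qmult s y))
      = (fst s * cnj (fst s) + snd s * cnj (snd s)) * (fst y * cnj (fst y) + snd y * cnj (snd y))"
    by (simp add: qmult_def algebra_simps)
  then show ?thesis using assms unfolding mem_S3 by simp
qed

lemma qinv_S3: "s \<in> S3 \<Longrightarrow> qinv s \<in> S3"
  unfolding mem_S3 by (simp add: qinv_def mult.commute)

lemma qmult_qinv:
  assumes "s \<in> S3"
  shows "qmult (qinv s) (qmult s y) = y" "qmult s (qmult (qinv s) y) = y"
proof -
  have e: "fst s * cnj (fst s) + snd s * cnj (snd s) = 1" using assms unfolding mem_S3 .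
  have "qmult (qinv s) (qmult s y) = scale (fst s * cnj (fst s) + snd s * cnj (snd s)) y"
    "qmult s (qmult (qinv s) y) = scale (fst s * cnj (fst s) + snd s * cnj (snd s)) y"
    by (simp_all add: qmult_def qinv_def scale_def algebra_simps)
  then show "qmult (qinv s) (qmult s y) = y" "qmult s (qmult (qinv s) y) = y"
    unfolding e by simp_all
qed

lemma qmult_one: "qmult (1, 0) y = y" "qmult s (1, 0) = s"
  by (simp_all add: qmult_def)

lemma continuous_on_qmult:
  assumes "continuous_on A f" "continuous_on A g"
  shows "continuous_on A (\<lambda>z. qmult (f z) (g z))"
  unfolding qmult_def by (intro continuous_intros assms)

lemma path_connected_S3: "path_connected S3"
  by (rule path_connected_sphere) simp

text \<open>The fibres of this map on the unit sphere are the orbits of the scalar \<open>p\<close>-th roots of unity, so its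
  image is a model of the lens space \<open>L(p,1)\<close>.\<close>

definition lens_map :: "nat \<Rightarrow> complex \<times> complex \<Rightarrow> complex \<times> complex \<times> complex" where
  "lens_map p y = (fst y ^ p, snd y ^ p, fst y * cnj (snd y))"

lemma second_countable_top_of_set:
  fixes S :: "'a::second_countable_topology set"
  shows "second_countable (top_of_set S)"
proof -
  obtain B :: "'a set set" where B: "countable B" "topological_basis B"
    using ex_countable_basis by blast
  have "second_countable (euclidean :: 'a topology)"
    unfolding second_countable_def
  proof (intro exI conjI ballI allI impI)
    show "countable B" by (rule B(1))
    show "openin euclidean V" if "V \<in> B" for V
      using topological_basis_open[OF B(2) that] by simp
    show "\<exists>V\<in>B. x \<in> V \<and> V \<subseteq> U" if "openin euclidean U \<and> x \<in> U" for U x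
      using topological_basisE[OF B(2), of U x] that by (metis open_openin)
  qed
  then show ?thesis by (rule second_countable_subtopology)
qed

lemma closed_connected_manifold_top_of_set:
  fixes S :: "'a::euclidean_space set"
  assumes S: "S \<noteq> {}" "compact S" "connected S"
    and chart: "\<And>x. x \<in> topspace (top_of_set S) \<Longrightarrow> euclidean_chart n (top_of_set S) x"
  shows "closed_connected_manifold n (top_of_set S)"
  unfolding closed_connected_manifold_def
proof (intro conjI ballI)
  show "topspace (top_of_set S) \<noteq> {}" using S(1) by simp
  show "Hausdorff_space (top_of_set S)" by (simp add: Hausdorff_space_subtopology)
  show "second_countable (top_of_set S)" by (rule second_countable_top_of_set)
  show "compact_space (top_of_set S)" using S(2) by (simp add: compact_space_subtopology)
  show "connected_space (top_of_set S)" using S(3) by (simp add: connected_space_subtopology)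
  show "\<exists>U V. openin (top_of_set S) U \<and> x \<in> U \<and> openin (Euclidean_space n) V \<and>
      subtopology (top_of_set S) U homeomorphic_space subtopology (Euclidean_space n) V"
    if "x \<in> topspace (top_of_set S)" for x
    using chart[OF that] unfolding euclidean_chart_def .
qed

section \<open>The lens spaces L(p,1)\<close>

locale lens =
  fixes p :: nat
  assumes p: "2 \<le> p"
begin

abbreviation roots :: "complex set" where
  "roots \<equiv> {\<zeta>. \<zeta> ^ p = 1}"

abbreviation X :: "(complex \<times> complex \<times> complex) topology" where
  "X \<equiv> top_of_set (lens_map p ` S3)"

lemma root_norm: "\<zeta> \<in> roots \<Longrightarrow> norm \<zeta> = 1"
  using power_eq_1_iff[of \<zeta> p] p by simp

lemma root_cnj: "\<zeta> \<in> roots \<Longrightarrow> \<zeta> * cnj \<zeta> = 1"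
  using root_norm complex_norm_square[of \<zeta>] by simp

lemma root_mult: "\<zeta> \<in> roots \<Longrightarrow> \<eta> \<in> roots \<Longrightarrow> \<zeta> * \<eta> \<in> roots"
  by (simp add: power_mult_distrib)

lemma root_cnj_mem: "\<zeta> \<in> roots \<Longrightarrow> cnj \<zeta> \<in> roots"
  by (simp flip: complex_cnj_power)

lemma finite_roots: "finite roots" and card_roots: "card roots = p"
  using finite_roots_unity[of p] card_roots_unity_eq[of p] p by auto

lemma scale_S3: "\<zeta> \<in> roots \<Longrightarrow> y \<in> S3 \<Longrightarrow> scale \<zeta> y \<in> S3"
  using root_norm by (simp add: norm_scale)

lemma scale_root_cancel: "\<zeta> \<in> roots \<Longrightarrow> scale \<zeta> (scale (cnj \<zeta>) y) = y" "\<zeta> \<in> roots \<Longrightarrow> scale (cnj \<zeta>) (scale \<zeta> y) = y"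
  using root_cnj by (simp_all only: scale_scale mult.commute scale_1)

lemma lens_map_scale: "\<zeta> \<in> roots \<Longrightarrow> lens_map p (scale \<zeta> y) = lens_map p y"
proof -
  assume z: "\<zeta> \<in> roots"
  have "\<zeta> * fst y * cnj (\<zeta> * snd y) = (\<zeta> * cnj \<zeta>) * (fst y * cnj (snd y))" by (simp add: algebra_simps)
  then show ?thesis
    using z root_cnj[OF z] by (simp add: lens_map_def scale_def power_mult_distrib)
qed

text \<open>Equal powers determine each coordinate up to a root of unity, and the mixed coordinate
  \<open>fst y * cnj (snd y)\<close> forces the two roots to coincide. If \<open>fst y\<close>
  vanishes, the root is taken from the second coordinate.\<close>

lemma lens_map_eq_iff:
  assumes "y \<in> S3" "y' \<in> S3"
  shows "lens_map p y = lens_map p y' \<longleftrightarrow> (\<exists>\<zeta>\<in>roots. y' = scale \<zeta> y)"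
proof
  assume "lens_map p y = lens_map p y'"
  then have e: "fst y' ^ p = fst y ^ p" "snd y' ^ p = snd y ^ p" "fst y' * cnj (snd y') = fst y * cnj (snd y)"
    by (simp_all add: lens_map_def)
  show "\<exists>\<zeta>\<in>roots. y' = scale \<zeta> y"
  proof (cases "fst y = 0")
    case False
    define \<zeta> where "\<zeta> = fst y' / fst y"
    have z: "\<zeta> \<in> roots" using False e(1) by (simp add: \<zeta>_def power_divide)
    have f: "fst y' = \<zeta> * fst y" using False by (simp add: \<zeta>_def)
    have "fst y * (\<zeta> * cnj (snd y')) = fst y * cnj (snd y)" using e(3) f by (simp add: algebra_simps)
    then have "\<zeta> * cnj (snd y') = cnj (snd y)" using False by simp
    then have "cnj (\<zeta> * cnj (snd y')) = snd y" by simp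
    then have "cnj \<zeta> * snd y' = snd y" by simp
    then have "(\<zeta> * cnj \<zeta>) * snd y' = \<zeta> * snd y" by (metis mult.assoc)
    then have "snd y' = \<zeta> * snd y" using root_cnj[OF z] by simp
    then show ?thesis using z f by (auto simp: scale_def prod_eq_iff)
  next
    case True
    then have y0: "snd y \<noteq> 0" using assms(1) unfolding mem_S3 by auto
    define \<zeta> where "\<zeta> = snd y' / snd y"
    have z: "\<zeta> \<in> roots" using y0 e(2) by (simp add: \<zeta>_def power_divide)
    have "fst y' ^ p = 0" using e(1) True p by (simp add: zero_power)
    then have "fst y' = 0" by (rule power_eq_0_iff[THEN iffD1, THEN conjunct1])
    then show ?thesis using z y0 True by (intro bexI[of _ \<zeta>]) (auto simp: scale_def prod_eq_iff \<zeta>_def)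
  qed
next
  assume "\<exists>\<zeta>\<in>roots. y' = scale \<zeta> y"
  then show "lens_map p y = lens_map p y'" using lens_map_scale by metis
qed

lemma continuous_on_lens_map: "continuous_on A (lens_map p)"
  unfolding lens_map_def by (intro continuous_intros)

lemma continuous_lens_map: "continuous_map (top_of_set S3) X (lens_map p)"
  using continuous_on_lens_map by auto

lemma quotient_lens_map: "quotient_map (top_of_set S3) X (lens_map p)"
  by (rule continuous_imp_quotient_map[OF continuous_lens_map]) (auto simp: compact_space_subtopology Hausdorff_space_subtopology)

lemma openin_scale:
  assumes "\<zeta> \<in> roots" "openin (top_of_set S3) V"
  shows "openin (top_of_set S3) (scale \<zeta> ` V)"
proof -
  have VS: "V \<subseteq> S3" using assms(2) openin_imp_subset by blast
  have "scale \<zeta> ` V = S3 \<inter> scale (cnj \<zeta>) -` V"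
  proof
    show "scale \<zeta> ` V \<subseteq> S3 \<inter> scale (cnj \<zeta>) -` V"
      using VS scale_S3[OF assms(1)] scale_root_cancel[OF assms(1)] by auto
    show "S3 \<inter> scale (cnj \<zeta>) -` V \<subseteq> scale \<zeta> ` V"
      using scale_root_cancel[OF assms(1)] by (metis IntD2 image_eqI subsetI vimageD)
  qed
  moreover have "openin (top_of_set S3) (S3 \<inter> scale (cnj \<zeta>) -` V)"
    by (rule continuous_openin_preimage[OF continuous_on_scale _ assms(2)])
      (use scale_S3[OF root_cnj_mem[OF assms(1)]] in blast)
  ultimately show ?thesis by simp
qed

lemma lens_map_saturation:
  assumes "V \<subseteq> S3"
  shows "{y \<in> S3. lens_map p y \<in> lens_map p ` V} = (\<Union>\<zeta>\<in>roots. scale \<zeta> ` V)"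
proof
  show "{y \<in> S3. lens_map p y \<in> lens_map p ` V} \<subseteq> (\<Union>\<zeta>\<in>roots. scale \<zeta> ` V)"
  proof
    fix y assume "y \<in> {y \<in> S3. lens_map p y \<in> lens_map p ` V}"
    then obtain v where "y \<in> S3" "v \<in> V" "lens_map p v = lens_map p y" by auto
    then show "y \<in> (\<Union>\<zeta>\<in>roots. scale \<zeta> ` V)" using lens_map_eq_iff[of v y] assms by blast
  qed
  show "(\<Union>\<zeta>\<in>roots. scale \<zeta> ` V) \<subseteq> {y \<in> S3. lens_map p y \<in> lens_map p ` V}"
    using assms scale_S3 lens_map_scale by fastforce
qed

text \<open>The preimage of the image is the union of the translates of \<open>V\<close>, all of
  which are open.\<close>

lemma openin_lens_map:
  assumes "openin (top_of_set S3) V"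
  shows "openin X (lens_map p ` V)"
proof -
  have VS: "V \<subseteq> S3" using assms openin_imp_subset by blast
  have "openin (top_of_set S3) (\<Union>\<zeta>\<in>roots. scale \<zeta> ` V)"
    using openin_scale assms by blast
  then have "openin (top_of_set S3) {y \<in> topspace (top_of_set S3). lens_map p y \<in> lens_map p ` V}"
    using lens_map_saturation[OF VS] by simp
  moreover have "lens_map p ` V \<subseteq> topspace X" using VS by auto
  ultimately show ?thesis using quotient_lens_map unfolding quotient_map_def by blast
qed

lemma roots_separated: "\<exists>e>0. \<forall>\<zeta>\<in>roots. \<forall>\<eta>\<in>roots. \<zeta> \<noteq> \<eta> \<longrightarrow> 2 * e \<le> norm (\<zeta> - \<eta>)"
proof -
  \<comment> \<open>The element 2, inserted in the next line, makes the finite set visibly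
    non-empty, so that its minimum is one of its elements.\<close>
  let ?D = "(\<lambda>z. norm (fst z - snd z)) ` {z \<in> roots \<times> roots. fst z \<noteq> snd z}"
  have fin: "finite (insert 2 ?D)" using finite_roots by simp
  have "0 < Min (insert 2 ?D)" using fin by (subst Min_gr_iff) auto
  moreover have "2 * (Min (insert 2 ?D) / 2) \<le> norm (\<zeta> - \<eta>)" if "\<zeta> \<in> roots" "\<eta> \<in> roots" "\<zeta> \<noteq> \<eta>" for \<zeta> \<eta>
  proof -
    have "norm (\<zeta> - \<eta>) \<in> insert 2 ?D" using that by force
    then show ?thesis using Min_le[OF fin] by simp
  qed
  ultimately show ?thesis by (intro exI[of _ "Min (insert 2 ?D) / 2"]) auto
qed

text \<open>The sheets are the translates of a ball of radius \<open>e\<close> in the sphere.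
  Distinct roots move its centre to points at distance at least \<open>2 * e\<close>, so the
  translates are disjoint, and \<open>lens_map p\<close> is open and injective on each.\<close>

lemma covering_lens_map: "covering_space S3 (lens_map p) (lens_map p ` S3)"
proof
  show "continuous_on S3 (lens_map p)" by (rule continuous_on_lens_map)
  show "lens_map p ` S3 = lens_map p ` S3" ..
  fix x assume "x \<in> lens_map p ` S3"
  then obtain y where y: "y \<in> S3" "x = lens_map p y" by blast
  obtain e where e: "0 < e" "\<And>\<zeta> \<eta>. \<zeta> \<in> roots \<Longrightarrow> \<eta> \<in> roots \<Longrightarrow> \<zeta> \<noteq> \<eta> \<Longrightarrow> 2 * e \<le> norm (\<zeta> - \<eta>)"
    using roots_separated by blast
  define U where "U = S3 \<inter> ball y e"
  have US: "U \<subseteq> S3" and yU: "y \<in> U" using y e(1) by (auto simp: U_def)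
  have oU: "openin (top_of_set S3) U" unfolding U_def by (rule openin_open_Int) simp
  have same: "\<zeta> = \<eta>" if "\<zeta> \<in> roots" "\<eta> \<in> roots" "u \<in> U" "v \<in> U" "scale \<zeta> u = scale \<eta> v" for \<zeta> \<eta> u v
  proof (rule ccontr)
    assume "\<zeta> \<noteq> \<eta>"
    have "dist (scale \<zeta> y) (scale \<eta> y) = norm (\<zeta> - \<eta>)"
      using y(1) by (simp add: dist_scale_left)
    moreover have "dist (scale \<zeta> y) (scale \<zeta> u) < e" "dist (scale \<eta> y) (scale \<eta> v) < e"
      using that(3,4) by (simp_all only: dist_scale root_norm[OF that(1)] root_norm[OF that(2)] U_def) simp_all
    ultimately show False
      using e(2)[OF that(1,2) \<open>\<zeta> \<noteq> \<eta>\<close>] dist_triangle2[of "scale \<zeta> y" "scale \<eta> y" "scale \<zeta> u"] that(5) by simp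
  qed
  have hom: "\<exists>q. homeomorphism (scale \<zeta> ` U) (lens_map p ` U) (lens_map p) q" if z: "\<zeta> \<in> roots" for \<zeta>
  proof -
    have oz: "openin (top_of_set S3) (scale \<zeta> ` U)" by (rule openin_scale[OF z oU])
    have im: "lens_map p ` scale \<zeta> ` U = lens_map p ` U"
      using lens_map_scale[OF z] by (simp add: image_image)
    have inj: "inj_on (lens_map p) (scale \<zeta> ` U)"
    proof (rule inj_onI)
      fix a b assume ab: "a \<in> scale \<zeta> ` U" "b \<in> scale \<zeta> ` U" "lens_map p a = lens_map p b"
      then obtain u v where uv: "u \<in> U" "a = scale \<zeta> u" "v \<in> U" "b = scale \<zeta> v" by blast
      have "a \<in> S3" "b \<in> S3" using ab oz openin_imp_subset by blast+
      then obtain \<eta> where \<eta>: "\<eta> \<in> roots" "b = scale \<eta> a" using ab(3) lens_map_eq_iff by blast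
      have "scale \<zeta> v = scale (\<eta> * \<zeta>) u" using \<eta>(2) uv by (simp add: scale_scale)
      then have e: "\<zeta> = \<eta> * \<zeta>" using same[OF z root_mult[OF \<eta>(1) z] uv(3,1)] by blast
      have "b = scale (\<eta> * \<zeta>) u" unfolding \<eta>(2) uv(2) by (simp only: scale_scale)
      then show "a = b" using uv(2) e by (simp only: e[symmetric])
    qed
    have op: "openin (top_of_set (lens_map p ` U)) (lens_map p ` W)" if W: "openin (top_of_set (scale \<zeta> ` U)) W" for W
    proof -
      have "openin (top_of_set S3) W" using openin_trans[OF W oz] .
      then have "openin X (lens_map p ` W)" by (rule openin_lens_map)
      moreover have "lens_map p ` W \<subseteq> lens_map p ` U" using openin_imp_subset[OF W] im by blast
      ultimately show ?thesis using US by (meson image_mono openin_subset_trans)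
    qed
    show ?thesis
      using homeomorphism_injective_open_map[OF continuous_on_lens_map im inj op] by blast
  qed
  show "\<exists>T. x \<in> T \<and> openin X T \<and> (\<exists>v. \<Union>v = S3 \<inter> lens_map p -` T \<and> (\<forall>u\<in>v. openin (top_of_set S3) u) \<and>
      pairwise disjnt v \<and> (\<forall>u\<in>v. \<exists>q. homeomorphism u T (lens_map p) q))"
  proof (rule exI[of _ "lens_map p ` U"], intro conjI, rule_tac [3] exI[of _ "(\<lambda>\<zeta>. scale \<zeta> ` U) ` roots"],
      rule_tac [3] conjI, rule_tac [4] conjI, rule_tac [5] conjI)
    show "x \<in> lens_map p ` U" using y(2) yU by blast
    show "openin X (lens_map p ` U)" by (rule openin_lens_map[OF oU])
    show "\<Union>((\<lambda>\<zeta>. scale \<zeta> ` U) ` roots) = S3 \<inter> lens_map p -` (lens_map p ` U)"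
    proof -
      have "S3 \<inter> lens_map p -` (lens_map p ` U) = {y \<in> S3. lens_map p y \<in> lens_map p ` U}" by blast
      then show ?thesis unfolding lens_map_saturation[OF US] by blast
    qed
    show "\<forall>u\<in>(\<lambda>\<zeta>. scale \<zeta> ` U) ` roots. openin (top_of_set S3) u"
      using openin_scale[OF _ oU] by blast
    show "pairwise disjnt ((\<lambda>\<zeta>. scale \<zeta> ` U) ` roots)"
      unfolding pairwise_def disjnt_def using same by blast
    show "\<forall>u\<in>(\<lambda>\<zeta>. scale \<zeta> ` U) ` roots. \<exists>q. homeomorphism u (lens_map p ` U) (lens_map p) q"
      using hom by blast
  qed
qed

lemma one_zero_S3: "(1, 0) \<in> S3"
  by (simp add: mem_S3)

text \<open>Left multiplication by unit quaternions along a path from the unit \<open>(1, 0)\<close>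
  to \<open>s\<close> commutes with the scalar roots of unity, so it descends to the
  quotient.\<close>

lemma isotopic_lens:
  assumes x: "x \<in> topspace X"
  shows "isotopic_to_id X (lens_map p (1, 0)) x"
proof -
  obtain s where s: "s \<in> S3" "x = lens_map p s" using x by auto
  obtain g where g: "path g" "path_image g \<subseteq> S3" "pathstart g = (1, 0)" "pathfinish g = s"
    using path_connected_S3 s(1) one_zero_S3 unfolding path_connected_def by blast
  have gS: "g t \<in> S3" if "t \<in> {0..1}" for t using g(2) that unfolding path_image_def by blast
  have cg: "continuous_on {0..1} g" using g(1) unfolding path_def .
  have g01: "g 0 = (1, 0)" "g 1 = s" using g(3,4) unfolding pathstart_def pathfinish_def by auto
  have equi: "lens_map p (qmult a y) = lens_map p (qmult a y')"
    if yy: "y \<in> S3" "y' \<in> S3" "lens_map p y = lens_map p y'" for a y y'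
  proof -
    obtain \<zeta> where "\<zeta> \<in> roots" "y' = scale \<zeta> y" using lens_map_eq_iff[OF yy(1,2)] yy(3) by blast
    then show ?thesis by (simp only: qmult_scale lens_map_scale)
  qed
  let ?F = "\<lambda>z. qmult (g (fst z)) (snd z)"
  have "isotopic_to_id X (lens_map p (1, 0)) (lens_map p (?F (1, (1, 0))))"
  proof (rule isotopic_to_id_quotient[OF continuous_lens_map, where G = "qmult (qinv s)"])
    have "continuous_on ({0..1::real} \<times> S3) ?F"
      by (intro continuous_on_qmult continuous_on_compose2[OF cg] continuous_on_fst continuous_on_snd continuous_on_id) auto
    moreover have "?F \<in> {0..1} \<times> S3 \<rightarrow> S3"
    proof
      fix z assume "z \<in> {0..1::real} \<times> S3"
      then have "fst z \<in> {0..1}" "snd z \<in> S3" by (simp_all only: mem_Times_iff)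
      then show "?F z \<in> S3" by (intro qmult_S3 gS)
    qed
    ultimately show "continuous_map (prod_topology (top_of_set {0..1::real}) (top_of_set S3)) (top_of_set S3) ?F"
      unfolding prod_topology_top_of_set by (simp add: image_subset_iff_funcset)
    have "continuous_on S3 (qmult (qinv s))"
      by (rule continuous_on_qmult[OF continuous_on_const continuous_on_id])
    then show "continuous_map (top_of_set S3) (top_of_set S3) (qmult (qinv s))"
      using qmult_S3[OF qinv_S3[OF s(1)]] by auto
    show "lens_map p ` topspace (top_of_set S3) = topspace X" by simp
    show "compact_space (top_of_set S3)" by (simp add: compact_space_subtopology)
    show "Hausdorff_space X" by (simp add: Hausdorff_space_subtopology)
    show "?F (0, y) = y" for y by (simp only: fst_conv snd_conv g01 qmult_one)
    show "lens_map p (?F (t, y)) = lens_map p (?F (t, y'))"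
      if "y \<in> topspace (top_of_set S3)" "y' \<in> topspace (top_of_set S3)" "lens_map p y = lens_map p y'" for t y y'
      unfolding fst_conv snd_conv by (rule equi[OF that[unfolded topspace_euclidean_subtopology]])
    show "qmult (qinv s) (?F (1, y)) = y" "?F (1, qmult (qinv s) y) = y" for y
      by (simp_all only: fst_conv snd_conv g01 qmult_qinv[OF s(1)])
    show "lens_map p (qmult (qinv s) y) = lens_map p (qmult (qinv s) y')"
      if "y \<in> topspace (top_of_set S3)" "y' \<in> topspace (top_of_set S3)" "lens_map p y = lens_map p y'" for y y'
      by (rule equi[OF that[unfolded topspace_euclidean_subtopology]])
    show "(1, 0) \<in> topspace (top_of_set S3)" using one_zero_S3 by simp
  qed
  then show ?thesis by (simp add: g01 qmult_one s(2))
qed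

lemma closed_connected_manifold_lens: "closed_connected_manifold 3 X"
proof -
  let ?y = "(0, 1) :: complex \<times> complex"
  have yS: "?y \<in> S3" by (simp add: mem_S3)
  obtain T U q where T: "?y \<in> T" "openin (top_of_set S3) T" and U: "lens_map p ?y \<in> U" "openin X U"
    and h: "homeomorphism T U (lens_map p) q"
    by (rule covering_space_local_homeomorphism[OF covering_lens_map yS])
  have "euclidean_chart 3 X (lens_map p ?y)"
    by (rule euclidean_chart_local_homeomorphism[OF sphere_chart[of 1, OF norm_one] T(2) U(2) h T(1)]) (use yS in simp)
  then have chart: "euclidean_chart 3 X x" if "x \<in> topspace X" for x
    by (intro euclidean_chart_homogeneous[OF isotopic_lens _ _ _ that, of "lens_map p ?y"])
      (simp_all only: topspace_euclidean_subtopology imageI one_zero_S3 yS)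
  show ?thesis
    by (rule closed_connected_manifold_top_of_set)
      (use yS path_connected_imp_connected[OF path_connected_S3] chart in
        \<open>simp_all add: compact_continuous_image connected_continuous_image continuous_on_lens_map\<close>)
qed

section \<open>Deck translates and the transfer\<close>

definition deck_related :: "((nat \<Rightarrow> real) \<Rightarrow> complex \<times> complex) \<Rightarrow> ((nat \<Rightarrow> real) \<Rightarrow> complex \<times> complex) \<Rightarrow> bool" where
  "deck_related f g \<longleftrightarrow> (\<exists>\<zeta>\<in>roots. f = simplex_map 2 (scale \<zeta>) g)"

lemma simplex_map_lens_map_scale:
  "\<zeta> \<in> roots \<Longrightarrow> simplex_map n (lens_map p) (simplex_map n (scale \<zeta>) g) = simplex_map n (lens_map p) g"
  by (simp add: simplex_map_def fun_eq_iff lens_map_scale)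

lemma simplex_map_scale_scale: "simplex_map n (scale \<eta>) (simplex_map n (scale \<zeta>) g) = simplex_map n (scale (\<eta> * \<zeta>)) g"
  by (simp add: simplex_map_def fun_eq_iff scale_scale)

lemma deck_related_lens_map: "deck_related f g \<Longrightarrow> simplex_map 2 (lens_map p) f = simplex_map 2 (lens_map p) g"
  unfolding deck_related_def using simplex_map_lens_map_scale by blast

text \<open>The transfer turns a chain whose faces cancel only up to deck transformations into a
  cycle of the sphere itself.\<close>

definition transfer :: "nat \<Rightarrow> (complex \<times> complex) chain \<Rightarrow> (complex \<times> complex) chain" where
  "transfer n c = (\<Sum>\<eta>\<in>roots. chain_map n (scale \<eta>) c)"

lemma transfer_add: "transfer n (a + b) = transfer n a + transfer n b"
  by (simp add: transfer_def chain_map_add sum.distrib)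

lemma transfer_diff: "transfer n (a - b) = transfer n a - transfer n b"
  by (simp add: transfer_def chain_map_diff sum_subtractf)

text \<open>Multiplication by \<zeta> permutes the roots, so both sums consist of the same
  simplices.\<close>

lemma deck_related_transfer:
  assumes "deck_related f g"
  shows "transfer 2 (frag_of f) = transfer 2 (frag_of g)"
proof -
  obtain \<zeta> where z: "\<zeta> \<in> roots" and f: "f = simplex_map 2 (scale \<zeta>) g" using assms unfolding deck_related_def by blast
  have c: "\<zeta> * cnj \<zeta> = 1" by (rule root_cnj[OF z])
  show ?thesis
    unfolding transfer_def chain_map_of f simplex_map_scale_scale
  proof (rule sum.reindex_bij_witness[of _ "\<lambda>\<eta>. \<eta> * cnj \<zeta>" "\<lambda>\<eta>. \<eta> * \<zeta>"])
    show "\<eta> * \<zeta> * cnj \<zeta> = \<eta>" "\<eta> * cnj \<zeta> * \<zeta> = \<eta>" for \<eta>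
      using c by (simp_all add: mult.assoc mult.commute)
    show "\<eta> * \<zeta> \<in> roots" "\<eta> * cnj \<zeta> \<in> roots" if "\<eta> \<in> roots" for \<eta>
      using root_mult[OF that z] root_mult[OF that root_cnj_mem[OF z]] by blast+
  qed simp
qed

lemma chain_boundary_transfer:
  assumes "singular_chain n (top_of_set S3) c"
  shows "chain_boundary n (transfer n c) = transfer (n - Suc 0) (chain_boundary n c)"
proof -
  have "chain_boundary n (transfer n c) = (\<Sum>\<eta>\<in>roots. chain_boundary n (chain_map n (scale \<eta>) c))"
    unfolding transfer_def chain_boundary_sum comp_def ..
  then show ?thesis
    unfolding transfer_def chain_boundary_chain_map[OF assms] .
qed

lemma singular_chain_transfer:
  assumes "singular_chain n (top_of_set S3) c"
  shows "singular_chain n (top_of_set S3) (transfer n c)"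
proof -
  have "continuous_map (top_of_set S3) (top_of_set S3) (scale \<eta>)" if "\<eta> \<in> roots" for \<eta>
    using continuous_on_scale scale_S3[OF that] by auto
  then show ?thesis
    unfolding transfer_def by (intro singular_chain_sum singular_chain_chain_map[OF assms])
qed

lemma lens_map_transfer:
  assumes "singular_chain n (top_of_set S3) c"
  shows "chain_map n (lens_map p) (transfer n c) = frag_cmul (int p) (chain_map n (lens_map p) c)"
proof -
  have "chain_map n (lens_map p) (chain_map n (scale \<eta>) c) = chain_map n (lens_map p) c" if "\<eta> \<in> roots" for \<eta>
  proof -
    have "chain_map n (lens_map p) (chain_map n (scale \<eta>) c) = chain_map n (lens_map p \<circ> scale \<eta>) c"
      by (simp only: chain_map_compose comp_apply)
    also have "\<dots> = chain_map n (lens_map p) c"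
      by (rule chain_map_eq[OF assms]) (simp add: lens_map_scale[OF that])
    finally show ?thesis .
  qed
  then have "chain_map n (lens_map p) (transfer n c) = (\<Sum>\<eta>\<in>roots. chain_map n (lens_map p) c)"
    unfolding transfer_def chain_map_sum[OF finite_roots] by (intro sum.cong) auto
  also have "\<dots> = frag_cmul (int (card roots)) (chain_map n (lens_map p) c)"
  proof -
    have "(\<Sum>x\<in>A. c) = frag_cmul (int (card A)) c" if "finite A" for A :: "complex set" and c :: "'d chain"
      using that by (induction A rule: finite_induct) (auto simp: frag_cmul_distrib)
    then show ?thesis using finite_roots by blast
  qed
  finally show ?thesis unfolding card_roots .
qed

end

section \<open>From local to absolute homology of the 3-sphere\<close>

lemma contractible_S3_minus: 
  assumes "y \<in> S3"
  shows "contractible (S3 - {y})"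
proof -
  have "(S3 - {y}) homeomorphic {x :: complex \<times> complex. (1, 0) \<bullet> x = 0}"
    by (rule homeomorphic_punctured_sphere_hyperplane) (use assms in \<open>auto simp: zero_prod_def\<close>)
  moreover have "contractible {x :: complex \<times> complex. (1, 0) \<bullet> x = 0}"
    by (intro convex_imp_contractible convex_hyperplane)
  ultimately show ?thesis using homeomorphic_contractible_eq by blast
qed

lemma cycle_bounds_if_trivial_homology:
  assumes "trivial_group (reduced_homology_group 3 T)" "singular_relcycle 3 T {} e"
  shows "singular_relboundary 3 T {} e"
proof -
  have "trivial_group (homology_group (int 3) T)"
    using assms(1) un_reduced_homology_group[of 3 T] by simp
  then have c: "carrier (homology_group (int 3) T) = {singular_relboundary_set 3 T {}}"
    unfolding trivial_group_def one_relative_homology_group by (rule conjunct2)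
  have "homologous_rel_set 3 T {} e \<in> {singular_relboundary_set 3 T {}}"
    using homologous_rel_set_carrier[OF assms(2)] unfolding c .
  then have "homologous_rel_set 3 T {} e = singular_relboundary_set 3 T {}"
    by (rule singletonD)
  then show ?thesis unfolding homologous_rel_set_eq_relboundary .
qed

lemma S3_minus_cycle_bounds:
  assumes "y \<in> S3" "singular_relcycle 3 (top_of_set (S3 - {y})) {} e"
  shows "singular_relboundary 3 (top_of_set (S3 - {y})) {} e"
proof (rule cycle_bounds_if_trivial_homology[OF _ assms(2)])
  show "trivial_group (reduced_homology_group 3 (top_of_set (S3 - {y})))"
    by (rule trivial_reduced_homology_group_contractible_space) (simp add: contractible_S3_minus[OF assms(1)])
qed

text \<open>The relative homology leaves an error term \<open>e\<close> off \<open>y\<close>. It is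
  a cycle, because \<open>a\<close> and \<open>b\<close> are, and so it bounds in the contractible
  punctured sphere; subtracting the bounding chain removes it.\<close>

lemma homologous_rel_S3_absolute:
  assumes y: "y \<in> S3" and a: "singular_relcycle 3 (top_of_set S3) {} a" "singular_relcycle 3 (top_of_set S3) {} b"
    and h: "homologous_rel 3 (top_of_set S3) (S3 - {y}) a b"
  shows "homologous_rel 3 (top_of_set S3) {} a b"
proof -
  have sub: "subtopology (top_of_set S3) (S3 - {y}) = top_of_set (S3 - {y})"
    by (simp add: subtopology_subtopology Int_absorb1)
  obtain d e where d: "singular_chain 4 (top_of_set S3) d" and e: "singular_chain 3 (top_of_set (S3 - {y})) e"
    and de: "chain_boundary 4 d = (a - b) + e"
    using h unfolding homologous_rel_def singular_relboundary_alt sub by (auto simp: eval_nat_numeral)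
  have "chain_boundary 3 (chain_boundary 4 d) = 0"
    using chain_boundary_boundary_alt[of 3 "top_of_set S3" d] d by (simp add: eval_nat_numeral)
  moreover have "chain_boundary 3 a = 0" "chain_boundary 3 b = 0"
    using a unfolding singular_cycle by blast+
  ultimately have "chain_boundary 3 e = 0"
    unfolding de chain_boundary_add chain_boundary_diff by simp
  then have "singular_relcycle 3 (top_of_set (S3 - {y})) {} e"
    using e unfolding singular_cycle by blast
  then have "singular_relboundary 3 (top_of_set (S3 - {y})) {} e"
    by (rule S3_minus_cycle_bounds[OF y])
  then obtain f where f: "singular_chain 4 (top_of_set (S3 - {y})) f" "chain_boundary 4 f = e"
    unfolding singular_boundary by (auto simp: eval_nat_numeral)
  have "singular_chain 4 (top_of_set S3) f"
    using f(1) singular_chain_mono[of 4 euclidean "S3 - {y}" f S3] by blast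
  then have "singular_chain 4 (top_of_set S3) (d - f)"
    using d singular_chain_diff by blast
  moreover have "chain_boundary 4 (d - f) = a - b"
    unfolding chain_boundary_diff de f(2) by simp
  ultimately show ?thesis
    unfolding homologous_rel_def singular_boundary by (auto simp: eval_nat_numeral)
qed

lemma homologous_rel_add_chain:
  assumes "singular_chain n (subtopology X S) r"
  shows "homologous_rel n X S (c + r) c"
  using singular_chain_imp_relboundary[OF assms] unfolding homologous_rel_def by simp

lemma sgn_scale: "norm \<zeta> = 1 \<Longrightarrow> sgn (scale \<zeta> v) = scale \<zeta> (sgn v)"
  by (simp add: sgn_div_norm norm_scale) (simp add: scale_def)

lemma standard_simplex_2D:
  assumes "t \<in> standard_simplex 2"
  shows "0 \<le> t 0" "0 \<le> t 1" "0 \<le> t 2" "t 0 + t 1 + t 2 = 1"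
proof -
  have "(\<Sum>i\<le>2. t i) = 1" and nn: "\<And>i. 0 \<le> t i" using assms by (auto simp: standard_simplex_def)
  then show "t 0 + t 1 + t 2 = 1" by (simp add: eval_nat_numeral)
  show "0 \<le> t 0" "0 \<le> t 1" "0 \<le> t 2" by (rule nn)+
qed

lemma standard_simplex_3D:
  assumes "t \<in> standard_simplex 3"
  shows "0 \<le> t 0" "0 \<le> t 1" "0 \<le> t 2" "0 \<le> t 3" "t 0 + t 1 + t 2 + t 3 = 1"
proof -
  have "(\<Sum>i\<le>3. t i) = 1" and nn: "\<And>i. 0 \<le> t i" using assms by (auto simp: standard_simplex_def)
  then show "t 0 + t 1 + t 2 + t 3 = 1" by (simp add: eval_nat_numeral)
  show "0 \<le> t 0" "0 \<le> t 1" "0 \<le> t 2" "0 \<le> t 3" by (rule nn)+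
qed

lemma simplex_frontier_3D:
  assumes "t \<in> simplex_frontier 3"
  shows "t \<in> standard_simplex 3" "t 0 = 0 \<or> t 1 = 0 \<or> t 2 = 0 \<or> t 3 = 0"
proof -
  show "t \<in> standard_simplex 3" using assms by (simp add: simplex_frontier_def)
  obtain i where "i \<le> 3" "t i = 0" using assms unfolding simplex_frontier_def by blast
  then show "t 0 = 0 \<or> t 1 = 0 \<or> t 2 = 0 \<or> t 3 = 0" unfolding le_3_cases by auto
qed

lemma simplical_face_3:
  fixes t :: "nat \<Rightarrow> real"
  shows "simplical_face 0 t 0 = 0" "simplical_face 0 t 1 = t 0" "simplical_face 0 t 2 = t 1" "simplical_face 0 t 3 = t 2"
    "simplical_face 1 t 0 = t 0" "simplical_face 1 t 1 = 0" "simplical_face 1 t 2 = t 1" "simplical_face 1 t 3 = t 2"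
    "simplical_face 2 t 0 = t 0" "simplical_face 2 t 1 = t 1" "simplical_face 2 t 2 = 0" "simplical_face 2 t 3 = t 2"
    "simplical_face 3 t 0 = t 0" "simplical_face 3 t 1 = t 1" "simplical_face 3 t 2 = t 2" "simplical_face 3 t 3 = 0"
  by (simp_all add: simplical_face_def)

lemma singular_face_3_restrict:
  assumes "k \<le> 3"
  shows "singular_face 3 k (restrict f (standard_simplex 3)) = restrict (\<lambda>t. f (simplical_face k t)) (standard_simplex 2)"
proof -
  have "singular_face 3 k (restrict f (standard_simplex 3)) = singular_face 3 k f"
    by (rule singular_face_restrict) (use assms in auto)
  then show ?thesis by (simp add: singular_face_def comp_def)
qed

lemma singular_simplex_sgn:
  fixes F :: "(nat \<Rightarrow> real) \<Rightarrow> complex \<times> complex"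
  assumes "continuous_on (standard_simplex n) F" "\<And>t. t \<in> standard_simplex n \<Longrightarrow> F t \<noteq> 0"
  shows "singular_simplex n (top_of_set S3) (restrict (\<lambda>t. sgn (F t)) (standard_simplex n))"
proof -
  have "continuous_on (standard_simplex n) (\<lambda>t. sgn (F t))"
    by (rule continuous_on_sgn) (use assms in auto)
  moreover have "sgn (F t) \<in> S3" if "t \<in> standard_simplex n" for t
    using assms(2)[OF that] by (simp add: norm_sgn)
  ultimately show ?thesis by (simp add: singular_simplex_top_of_set Pi_iff)
qed

lemma singular_simplex_shrink:
  assumes "singular_simplex n (top_of_set S) \<rho>" "\<And>t. t \<in> standard_simplex n \<Longrightarrow> \<rho> t \<in> T"
  shows "singular_simplex n (top_of_set T) \<rho>"
  using assms by (simp add: singular_simplex_top_of_set Pi_iff)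

lemma singular_relcycle_simplex_subset:
  assumes "singular_relcycle n (top_of_set S) (S - {y}) (frag_of \<tau>)" "singular_simplex n (top_of_set Y) \<tau>"
  shows "singular_relcycle n (top_of_set Y) (Y - {y}) (frag_of \<tau>)"
proof -
  have "singular_chain (n - 1) (top_of_set Y) (chain_boundary n (frag_of \<tau>))"
    using singular_chain_boundary[of n "top_of_set Y" "frag_of \<tau>"] assms(2) by (simp add: singular_chain_of)
  moreover have "singular_chain (n - 1) (top_of_set (S - {y})) (chain_boundary n (frag_of \<tau>))"
    using assms(1) unfolding singular_relcycle by (simp add: subtopology_subtopology Int_absorb1 Diff_subset)
  ultimately have "singular_chain (n - 1) (top_of_set (Y - {y})) (chain_boundary n (frag_of \<tau>))"
    unfolding singular_chain_subtopology[of _ euclidean] by blast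
  then show ?thesis
    using assms(2) unfolding singular_relcycle singular_chain_of by (simp add: subtopology_subtopology Int_absorb1 Diff_subset)
qed

text \<open>There may be further preimages of \<open>q y\<close>, so
  \<open>homology_generator_open_embedding\<close> does not fit \<open>S\<close> itself. But \<tau>
  avoids these points and thus lies in the open set \<open>Y\<close> from which they are removed;
  there it is a generator by excision, and \<open>y\<close> is the only preimage.\<close>

lemma homology_generator_local_homeomorphism:
  fixes q :: "'a::t1_space \<Rightarrow> 'b::t1_space"
  assumes q: "continuous_on S q" "q ` S \<subseteq> R" and U: "openin (top_of_set S) U" "y \<in> U"
    and V: "openin (top_of_set R) V" and h: "homeomorphism U V q r"
    and gen: "homology_generator n (top_of_set S) (S - {y}) (frag_of \<tau>)"
    and av: "\<And>t. \<lbrakk>t \<in> standard_simplex n; q (\<tau> t) = q y\<rbrakk> \<Longrightarrow> \<tau> t = y"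
  shows "homology_generator n (top_of_set R) (R - {q y}) (frag_of (simplex_map n q \<tau>))"
proof -
  have cl: "closedin (top_of_set A) {a}" if "a \<in> A" for A :: "'x::t1_space set" and a
    using that by (intro closed_subset) auto
  have US: "U \<subseteq> S" and VR: "V \<subseteq> R" using U(1) V openin_imp_subset by blast+
  have y: "y \<in> S" using U US by blast
  define Y where "Y = S - ({z \<in> S. q z = q y} - U)"
  have injU: "z = y" if "z \<in> U" "q z = q y" for z
    using homeomorphism_apply1[OF h] that U(2) by metis
  have YS: "Y \<subseteq> S" and UY: "U \<subseteq> Y" using US by (auto simp: Y_def)
  have yY: "y \<in> Y" using UY U(2) by blast
  have inj: "z = y" if "z \<in> Y" "q z = q y" for z using that injU unfolding Y_def by blast
  have oY: "openin (top_of_set S) Y"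
    unfolding Y_def
    by (intro openin_diff openin_subtopology_self closedin_diff continuous_closedin_preimage_constant q(1) U(1))
  have rc0: "singular_relcycle n (top_of_set S) (S - {y}) (frag_of \<tau>)" using gen unfolding homology_generator_def by blast
  then have \<tau>: "singular_simplex n (top_of_set S) \<tau>"
    by (simp add: singular_relcycle_def singular_chain_of)
  have \<tau>Y: "singular_simplex n (top_of_set Y) \<tau>"
  proof (rule singular_simplex_shrink[OF \<tau>])
    fix t assume t: "t \<in> standard_simplex n"
    have "\<tau> t \<in> S" using \<tau> t unfolding singular_simplex_top_of_set by blast
    then show "\<tau> t \<in> Y" using av[OF t] U(2) unfolding Y_def by blast
  qed
  have rc: "singular_relcycle n (top_of_set Y) (topspace (top_of_set Y) - {y}) (frag_of \<tau>)"
    using singular_relcycle_simplex_subset[OF rc0 \<tau>Y] by simp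
  have subY: "subtopology (top_of_set Y) Y = top_of_set Y" "subtopology (top_of_set S) Y = top_of_set Y"
    using YS by (simp_all add: subtopology_subtopology Int_absorb1)
  have clY: "closedin (top_of_set Y) {y}" by (rule cl[OF yY])
  have genY: "homology_generator n (top_of_set Y) (topspace (top_of_set Y) - {y}) (frag_of \<tau>)"
  proof (rule homology_generator_open_embedding[of "top_of_set Y" "top_of_set S" id Y y Y n "frag_of \<tau>", THEN iffD2])
    show "homology_generator n (top_of_set S) (topspace (top_of_set S) - {id y}) (chain_map n id (frag_of \<tau>))"
      using gen chain_map_ident[of n "top_of_set S" "frag_of \<tau>"] \<tau> by (simp add: singular_chain_of)
    show "homeomorphic_map (subtopology (top_of_set Y) Y) (subtopology (top_of_set S) Y) id"
      unfolding subY by (simp add: homeomorphic_map_id)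
    show "closedin (top_of_set S) {id y}" using cl[OF y] by simp
    show "openin (top_of_set S) Y" by (rule oY)
    show "closedin (top_of_set Y) {y}" by (rule clY)
    show "singular_relcycle n (top_of_set Y) (topspace (top_of_set Y) - {y}) (frag_of \<tau>)" by (rule rc)
  qed (use YS yY in auto)
  have "homology_generator n (top_of_set R) (topspace (top_of_set R) - {q y}) (chain_map n q (frag_of \<tau>))"
  proof (rule homology_generator_open_embedding[of "top_of_set Y" "top_of_set R" q U y V n "frag_of \<tau>", THEN iffD1])
    show "continuous_map (top_of_set Y) (top_of_set R) q"
      using continuous_on_subset[OF q(1) YS] q(2) YS by auto
    show "openin (top_of_set Y) U" by (rule openin_subset_trans[OF U(1) UY YS])
    have "homeomorphic_maps (top_of_set U) (top_of_set V) q r"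
      using h by (simp only: homeomorphic_maps_iff_homeomorphism)
    moreover have "subtopology (top_of_set Y) U = top_of_set U" "subtopology (top_of_set R) V = top_of_set V"
      using UY VR by (simp_all add: subtopology_subtopology Int_absorb1)
    ultimately show "homeomorphic_map (subtopology (top_of_set Y) U) (subtopology (top_of_set R) V) q"
      unfolding homeomorphic_map_maps by metis
    show "closedin (top_of_set R) {q y}" by (rule cl) (use y q(2) in blast)
    show "z = y" if "z \<in> topspace (top_of_set Y)" "q z = q y" for z
      using inj that by simp
  qed (rule U(2) V clY rc genY)+
  then show ?thesis by (simp add: chain_map_of)
qed

context lens
begin

lemma deck_related_sgn:
  assumes z: "\<zeta> \<in> roots" and k: "k \<le> 3" and j: "j \<le> 3"
    and e: "\<And>t. t \<in> standard_simplex 2 \<Longrightarrow> F (simplical_face k t) = scale \<zeta> (G (simplical_face j t))"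
  shows "deck_related (singular_face 3 k (restrict (\<lambda>t. sgn (F t)) (standard_simplex 3)))
     (singular_face 3 j (restrict (\<lambda>t. sgn (G t)) (standard_simplex 3)))"
  unfolding deck_related_def singular_face_3_restrict[OF k] singular_face_3_restrict[OF j]
proof (rule bexI[OF _ z], rule ext)
  fix t
  show "restrict (\<lambda>t. sgn (F (simplical_face k t))) (standard_simplex 2) t =
    simplex_map 2 (scale \<zeta>) (restrict (\<lambda>t. sgn (G (simplical_face j t))) (standard_simplex 2)) t"
    using e[of t] sgn_scale[OF root_norm[OF z]] by (simp add: simplex_map_def)
qed

lemma local_generator_lens:
  assumes y: "y \<in> S3" and \<tau>: "singular_simplex 3 (top_of_set S3) \<tau>"
    and gen: "homology_generator 3 (top_of_set S3) (S3 - {y}) (frag_of \<tau>)"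
    and av: "\<And>t \<zeta>. \<lbrakk>t \<in> standard_simplex 3; \<zeta> \<in> roots; \<zeta> \<noteq> 1\<rbrakk> \<Longrightarrow> \<tau> t \<noteq> scale \<zeta> y"
  shows "homology_generator 3 X (topspace X - {lens_map p y}) (frag_of (simplex_map 3 (lens_map p) \<tau>))"
proof -
  obtain T V q where T: "y \<in> T" "openin (top_of_set S3) T" and V: "lens_map p y \<in> V" "openin X V"
    and h: "homeomorphism T V (lens_map p) q"
    by (rule covering_space_local_homeomorphism[OF covering_lens_map y])
  have "homology_generator 3 X (lens_map p ` S3 - {lens_map p y}) (frag_of (simplex_map 3 (lens_map p) \<tau>))"
  proof (rule homology_generator_local_homeomorphism[OF continuous_on_lens_map subset_refl T(2,1) V(2) h gen])
    fix t assume t: "t \<in> standard_simplex 3" and e: "lens_map p (\<tau> t) = lens_map p y"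
    have "\<tau> t \<in> S3" using \<tau> t unfolding singular_simplex_top_of_set by blast
    then obtain \<zeta> where "\<zeta> \<in> roots" "\<tau> t = scale \<zeta> y" using lens_map_eq_iff[OF y] e by metis
    then show "\<tau> t = y" using av[OF t] scale_1 by metis
  qed
  then show ?thesis by simp
qed

text \<open>By \<open>bd\<close> and \<open>rel\<close> the faces cancel in pairs up to deck
  transformations, so the projection of \<open>?b\<close> is a cycle of the lens space and its
  transfer is one of the sphere. At \<open>lens_map p y\<close> and at \<open>y\<close>,
  respectively, both reduce to the contribution of \<tau>, since everything else avoids the
  point.\<close>

lemma volume_two_lens:
  assumes y: "y \<in> S3" and \<tau>: "singular_simplex 3 (top_of_set S3) \<tau>" and \<sigma>: "singular_simplex 3 (top_of_set S3) \<sigma>"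
    and gen: "homology_generator 3 (top_of_set S3) (S3 - {y}) (frag_of \<tau>)"
    and avt: "\<And>t \<zeta>. \<lbrakk>t \<in> standard_simplex 3; \<zeta> \<in> roots; \<zeta> \<noteq> 1\<rbrakk> \<Longrightarrow> \<tau> t \<noteq> scale \<zeta> y"
    and avs: "\<And>t \<zeta>. \<lbrakk>t \<in> standard_simplex 3; \<zeta> \<in> roots\<rbrakk> \<Longrightarrow> \<sigma> t \<noteq> scale \<zeta> y"
    and bd: "chain_boundary 3 (frag_of \<tau> + frag_of \<sigma>) =
      (frag_of f1 - frag_of g1) + (frag_of f2 - frag_of g2) + (frag_of f3 - frag_of g3) + (frag_of f4 - frag_of g4)"
    and rel: "deck_related f1 g1" "deck_related f2 g2" "deck_related f3 g3" "deck_related f4 g4"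
  shows "volume_two X"
proof -
  let ?b = "frag_of \<tau> + frag_of \<sigma>" and ?q = "lens_map p"
  let ?c = "frag_of (simplex_map 3 ?q \<tau>) + frag_cmul 1 (frag_of (simplex_map 3 ?q \<sigma>))"
  let ?T = "transfer 3 ?b"
  have ch: "singular_chain 3 (top_of_set S3) ?b"
    using \<tau> \<sigma> by (intro singular_chain_add) (simp_all add: singular_chain_of)
  have c: "chain_map 3 ?q ?b = ?c"
    by (simp only: chain_map_add chain_map_of frag_cmul_one)
  have cyc: "singular_relcycle 3 X {} ?c"
  proof -
    have "chain_boundary 3 (chain_map 3 ?q ?b) = chain_map (3 - Suc 0) ?q (chain_boundary 3 ?b)"
      by (rule chain_boundary_chain_map[OF ch])
    also have "\<dots> = 0"
      unfolding bd by (simp add: chain_map_add chain_map_diff deck_related_lens_map[OF rel(1)]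
          deck_related_lens_map[OF rel(2)] deck_related_lens_map[OF rel(3)] deck_related_lens_map[OF rel(4)])
    finally show ?thesis
      using singular_chain_chain_map[OF ch continuous_lens_map] unfolding c singular_cycle by blast
  qed
  have Tcyc: "singular_relcycle 3 (top_of_set S3) {} ?T"
  proof -
    have "chain_boundary 3 ?T = transfer (3 - Suc 0) (chain_boundary 3 ?b)"
      by (rule chain_boundary_transfer[OF ch])
    also have "\<dots> = 0"
      unfolding bd by (simp add: transfer_add transfer_diff deck_related_transfer[OF rel(1)]
          deck_related_transfer[OF rel(2)] deck_related_transfer[OF rel(3)] deck_related_transfer[OF rel(4)])
    finally show ?thesis
      using singular_chain_transfer[OF ch] unfolding singular_cycle by blast
  qed
  have subS: "subtopology (top_of_set S3) (S3 - {y}) = top_of_set (S3 - {y})"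
    by (simp add: subtopology_subtopology Int_absorb1)
  have s_off: "singular_chain 3 (subtopology (top_of_set S3) (S3 - {y})) (frag_of \<sigma>)"
    unfolding singular_chain_of subS
  proof (rule singular_simplex_shrink[OF \<sigma>])
    fix t assume t: "t \<in> standard_simplex 3"
    have "\<sigma> t \<in> S3" using \<sigma> t unfolding singular_simplex_top_of_set by blast
    moreover have "\<sigma> t \<noteq> y" using avs[OF t, of 1] by simp
    ultimately show "\<sigma> t \<in> S3 - {y}" by blast
  qed
  \<comment> \<open>A translate by \<eta> passes through \<open>y\<close> only where the simplex
    passes through the translate of \<open>y\<close> by \<open>cnj \<eta>\<close>, the inverse
    root.\<close>
  have rot_off: "singular_chain 3 (subtopology (top_of_set S3) (S3 - {y})) (chain_map 3 (scale \<eta>) ?b)"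
    if \<eta>: "\<eta> \<in> roots - {1}" for \<eta>
  proof -
    have r: "\<eta> \<in> roots" "\<eta> \<noteq> 1" "cnj \<eta> \<noteq> 1" using \<eta> by auto
    have off: "scale \<eta> z \<noteq> y" if "z \<noteq> scale (cnj \<eta>) y" for z
      using that scale_root_cancel(2)[OF r(1), of z] by metis
    have cm: "continuous_map (top_of_set S3) (top_of_set S3) (scale \<eta>)"
      using continuous_on_scale scale_S3[OF r(1)] by auto
    have rot: "singular_simplex 3 (subtopology (top_of_set S3) (S3 - {y})) (simplex_map 3 (scale \<eta>) \<rho>)"
      if \<rho>: "singular_simplex 3 (top_of_set S3) \<rho>" "\<And>t. t \<in> standard_simplex 3 \<Longrightarrow> \<rho> t \<noteq> scale (cnj \<eta>) y" for \<rho>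
      unfolding subS
    proof (rule singular_simplex_shrink[OF singular_simplex_simplex_map[OF \<rho>(1) cm]])
      fix t assume t: "t \<in> standard_simplex 3"
      have "\<rho> t \<in> S3" using \<rho>(1) t unfolding singular_simplex_top_of_set by blast
      then have "scale \<eta> (\<rho> t) \<in> S3 - {y}" using scale_S3[OF r(1)] off[OF \<rho>(2)[OF t]] by blast
      then show "simplex_map 3 (scale \<eta>) \<rho> t \<in> S3 - {y}" using t by (simp add: simplex_map_def)
    qed
    show ?thesis
      unfolding chain_map_add chain_map_of
    proof (intro singular_chain_add)
      show "singular_chain 3 (subtopology (top_of_set S3) (S3 - {y})) (frag_of (simplex_map 3 (scale \<eta>) \<tau>))"
        unfolding singular_chain_of by (rule rot[OF \<tau>], rule avt[OF _ root_cnj_mem[OF r(1)] r(3)])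
      show "singular_chain 3 (subtopology (top_of_set S3) (S3 - {y})) (frag_of (simplex_map 3 (scale \<eta>) \<sigma>))"
        unfolding singular_chain_of by (rule rot[OF \<sigma>], rule avs[OF _ root_cnj_mem[OF r(1)]])
    qed
  qed
  have Tgen: "homology_generator 3 (top_of_set S3) (S3 - {y}) ?T"
  proof -
    have one: "chain_map 3 (scale 1) ?b = ?b" by (rule chain_map_id_gen[OF ch]) simp
    have "?T = chain_map 3 (scale 1) ?b + (\<Sum>\<eta>\<in>roots - {1}. chain_map 3 (scale \<eta>) ?b)"
      unfolding transfer_def by (rule sum.remove[OF finite_roots]) simp
    then have "?T = frag_of \<tau> + (frag_of \<sigma> + (\<Sum>\<eta>\<in>roots - {1}. chain_map 3 (scale \<eta>) ?b))"
      unfolding one by (simp only: add.assoc)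
    moreover have "singular_chain 3 (subtopology (top_of_set S3) (S3 - {y})) (frag_of \<sigma> + (\<Sum>\<eta>\<in>roots - {1}. chain_map 3 (scale \<eta>) ?b))"
      by (intro singular_chain_add s_off singular_chain_sum rot_off)
    ultimately have "homologous_rel 3 (top_of_set S3) (S3 - {y}) ?T (frag_of \<tau>)"
      using homologous_rel_add_chain by metis
    then show ?thesis
      using homology_generator_homologous[OF gen] homologous_rel_sym by blast
  qed
  have xgen: "homology_generator 3 X (topspace X - {?q y}) ?c"
  proof -
    have "?q (\<sigma> t) \<noteq> ?q y" if t: "t \<in> standard_simplex 3" for t
    proof
      assume e: "?q (\<sigma> t) = ?q y"
      have "\<sigma> t \<in> S3" using \<sigma> t unfolding singular_simplex_top_of_set by blast
      then show False using lens_map_eq_iff[OF y] e avs[OF t] by metis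
    qed
    then have av: "simplex_map 3 ?q \<sigma> t \<in> lens_map p ` S3 - {?q y}" if "t \<in> standard_simplex 3" for t
      using \<sigma> that by (simp add: simplex_map_def singular_simplex_top_of_set Pi_iff)
    have subX: "subtopology X (topspace X - {?q y}) = top_of_set (lens_map p ` S3 - {?q y})"
      by (simp add: subtopology_subtopology Int_absorb1)
    have "singular_chain 3 (subtopology X (topspace X - {?q y})) (frag_cmul 1 (frag_of (simplex_map 3 ?q \<sigma>)))"
      unfolding frag_cmul_one singular_chain_of subX
      by (rule singular_simplex_shrink[OF singular_simplex_simplex_map[OF \<sigma> continuous_lens_map] av])
    from homologous_rel_add_chain[OF this]
    have "homologous_rel 3 X (topspace X - {?q y}) (frag_of (simplex_map 3 ?q \<tau>)) ?c"
      using homologous_rel_sym by blast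
    moreover have "homology_generator 3 X (topspace X - {?q y}) (frag_of (simplex_map 3 ?q \<tau>))"
      by (rule local_generator_lens[OF y \<tau> gen]) (rule avt)
    ultimately show ?thesis
      using homology_generator_homologous by blast
  qed
  have qyX: "?q y \<in> topspace X" and qoneX: "?q (1, 0) \<in> topspace X" using y one_zero_S3 by auto
  have allgen: "homology_generator 3 X (topspace X - {x}) ?c" if "x \<in> topspace X" for x
    by (rule homology_generator_homogeneous[OF cyc isotopic_lens qoneX qyX xgen that])
  \<comment> \<open>The lifted cycle is \<open>k\<close> times the transfer, first locally at
    \<open>y\<close> and hence absolutely. Projecting the transfer gives \<open>p\<close> times
    \<open>?c\<close>, so the multiple downstairs is divisible by \<open>p\<close> and is no
    sign.\<close>
  have low: "\<exists>k. k \<noteq> 1 \<and> k \<noteq> - 1 \<and> homologous_rel 3 X (topspace X - {?q y}) (frag_of \<rho>) (frag_cmul k ?c)"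
    if \<rho>: "singular_relcycle 3 X {} (frag_of \<rho>)" for \<rho>
  proof -
    obtain r where r: "singular_relcycle 3 (top_of_set S3) {} (frag_of r)" "simplex_map 3 ?q r = \<rho>"
      using singular_3_simplex_cycle_lift[OF covering_lens_map \<rho>] by blast
    obtain k where k: "homologous_rel 3 (top_of_set S3) (S3 - {y}) (frag_of r) (frag_cmul k ?T)"
      using Tgen relcycle_weaken[OF r(1), of "S3 - {y}"] unfolding homology_generator_def by blast
    have "homologous_rel 3 (top_of_set S3) {} (frag_of r) (frag_cmul k ?T)"
      by (rule homologous_rel_S3_absolute[OF y r(1) singular_relcycle_cmul[OF Tcyc] k])
    then have "singular_relboundary 3 X {} (chain_map 3 ?q (frag_of r - frag_cmul k ?T))"
      unfolding homologous_rel_def by (rule singular_relboundary_chain_map[OF _ continuous_lens_map]) simp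
    then have "homologous_rel 3 X {} (frag_of \<rho>) (frag_cmul (k * int p) ?c)"
      unfolding chain_map_diff chain_map_cmul lens_map_transfer[OF ch] c chain_map_of r(2) frag_cmul_cmul homologous_rel_def .
    then have "homologous_rel 3 X (topspace X - {?q y}) (frag_of \<rho>) (frag_cmul (k * int p) ?c)"
      by (rule homologous_rel_weaken) simp
    moreover have "k * int p \<noteq> 1" "k * int p \<noteq> - 1"
    proof -
      have "\<not> int p dvd 1" using p by (simp add: zdvd_not_zless)
      then show "k * int p \<noteq> 1" "k * int p \<noteq> - 1"
        by (metis dvd_triv_right, metis dvd_minus_iff dvd_triv_right)
    qed
    ultimately show ?thesis by blast
  qed
  show ?thesis
    unfolding volume_two_def
    using closed_connected_manifold_lens cyc allgen low qyX by blast
qed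

end

text \<open>Measured along \<open>u\<close>, the second coordinate has non-negative real part on the
  left and negative real part on the right. Square and cube roots of unity other than 1 have
  negative real part, so this covers the non-trivial translates of the point for p = 2 and p =
  3.\<close>

lemma sgn_chart_avoids:
  assumes u: "norm u = 1" and a: "0 \<le> a" and z: "Re \<zeta> < 0"
  shows "sgn (Z, Complex a b * u) \<noteq> scale \<zeta> (0, u)"
proof
  let ?r = "norm (Z, Complex a b * u)"
  assume "sgn (Z, Complex a b * u) = scale \<zeta> (0, u)"
  then have "snd ((Z, Complex a b * u) /\<^sub>R ?r) = snd (scale \<zeta> (0, u))" by (simp only: sgn_div_norm)
  then have "(Complex a b /\<^sub>R ?r) * u = \<zeta> * u" by (simp only: scale_def snd_scaleR snd_conv mult_scaleR_left)
  moreover have "u \<noteq> 0" using u by auto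
  ultimately have e: "Complex a b /\<^sub>R ?r = \<zeta>" using mult_right_cancel by blast
  have "0 \<le> inverse ?r * a" using a by (simp only: mult_nonneg_nonneg inverse_nonnegative_iff_nonnegative norm_ge_zero)
  moreover have "Re (Complex a b /\<^sub>R ?r) = inverse ?r * a" by (simp only: scaleR_complex.simps complex.sel)
  ultimately show False using z unfolding e by linarith
qed

section \<open>Explicit simplices for p = 2\<close>

interpretation lens2: lens 2 by unfold_locales simp

interpretation lens3: lens 3 by unfold_locales simp

text \<open>On each face the forms \<open>F2\<close> and \<open>G2\<close> below agree, up to sign, with one of them on another face, so their
  projectivisations fit together to a cycle. The redundant factor \<open>1\<close> is the \<open>\<kappa>\<close> of
  \<open>homology_generator_sphere\<close>; likewise for the factor \<open>- 1\<close> in \<open>F3\<close>.\<close>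

definition F2 :: "(nat \<Rightarrow> real) \<Rightarrow> complex \<times> complex" where
  "F2 t = (Complex (- (t 0 * t 1 - t 1 * t 2 + t 2 * t 3 + t 0 * t 3)) (t 0 - t 1 + t 2 - t 3),
     Complex (t 0 * t 1 * t 2 * t 3) (1 * (t 1 * t 2 * (t 3 - t 0))) * \<i>)"

text \<open>As \<open>t 1\<close> and \<open>t 2\<close> enter through their sum only, faces 1 and 2
  coincide. The second coordinate is real, so after normalization the simplex lies in a 2-sphere
  that misses \<open>(0, \<i>)\<close> and its antipode.\<close>

definition G2 :: "(nat \<Rightarrow> real) \<Rightarrow> complex \<times> complex" where
  "G2 t = (Complex (- (t 0 * (t 1 + t 2) - (t 1 + t 2) * t 3)) (t 0 - (t 1 + t 2) + t 3),
     complex_of_real (t 0 * (t 1 + t 2) * t 3))"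

text \<open>The two equations say that the first coordinate of \<open>F2\<close> vanishes; the
  alternatives are what the vanishing of the second one leaves. In each of them the linear equation
  makes two complementary sums of coordinates equal to 1/2, while the quadratic one makes their
  product zero.\<close>

lemma F2_nonvanishing:
  assumes t: "t \<in> standard_simplex 3" and z: "t 0 - t 1 + t 2 - t 3 = 0" "t 0 * t 1 - t 1 * t 2 + t 2 * t 3 + t 0 * t 3 = 0"
    "t 1 = 0 \<or> t 2 = 0 \<or> t 0 = 0 \<and> t 3 = 0"
  shows False
proof -
  note s = standard_simplex_3D[OF t]
  from z(3) consider "t 1 = 0" | "t 2 = 0" | "t 0 = 0" "t 3 = 0" by blast
  then show False
  proof cases
    case 1
    then have "t 3 * (t 0 + t 2) = 0" using z(2) by (simp add: algebra_simps)
    then show False using z(1) 1 s(5) by auto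
  next
    case 2
    then have "t 0 * (t 1 + t 3) = 0" using z(2) by (simp add: algebra_simps)
    then show False using z(1) 2 s(5) by auto
  next
    case 3
    then show False using z s(5) by auto
  qed
qed

lemma volume_two_lens2: "volume_two lens2.X"
proof -
  let ?D = "standard_simplex 3"
  let ?\<tau> = "restrict (\<lambda>t. sgn (F2 t)) ?D" and ?\<sigma> = "restrict (\<lambda>t. sgn (G2 t)) ?D"
  have ci: "continuous_on A (\<lambda>t::nat \<Rightarrow> real. t i)" for A i by (rule continuous_on_coordinate)
  have two: "\<zeta> = 1 \<or> \<zeta> = - 1" if "\<zeta> \<in> lens2.roots" for \<zeta> using that by (simp add: power2_eq_1_iff)
  have gen: "homology_generator 3 (top_of_set S3) (S3 - {(0, \<i>)}) (frag_of ?\<tau>)"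
    unfolding F2_def
  proof (rule homology_generator_sphere)
    show "norm \<i> = 1" "(1::real) = 1 \<or> (1::real) = - 1" by simp_all
    show "continuous_on ?D (\<lambda>t. Complex (- (t 0 * t 1 - t 1 * t 2 + t 2 * t 3 + t 0 * t 3)) (t 0 - t 1 + t 2 - t 3))"
      "continuous_on ?D (\<lambda>t. t 0 * t 1 * t 2 * t 3)" "continuous_on ?D (\<lambda>t. t 1 * t 2 * (t 3 - t 0))"
      by (intro continuous_intros continuous_on_Complex ci)+
    show "0 \<le> t 0 * t 1 * t 2 * t 3" if "t \<in> ?D" for t using standard_simplex_3D[OF that] by simp
    show "Complex (- (t 0 * t 1 - t 1 * t 2 + t 2 * t 3 + t 0 * t 3)) (t 0 - t 1 + t 2 - t 3) \<noteq> 0 \<or> t 0 * t 1 * t 2 * t 3 \<noteq> 0 \<or> t 1 * t 2 * (t 3 - t 0) \<noteq> 0"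
      if t: "t \<in> ?D" for t
    proof (rule ccontr)
      assume "\<not> ?thesis"
      then have a: "t 0 - t 1 + t 2 - t 3 = 0" "t 0 * t 1 - t 1 * t 2 + t 2 * t 3 + t 0 * t 3 = 0"
        and b: "t 0 * t 1 * t 2 * t 3 = 0" "t 1 * t 2 * (t 3 - t 0) = 0"
        by (simp_all only: Complex_eq_0 de_Morgan_disj not_not neg_equal_0_iff_equal)
      have "t 1 = 0 \<or> t 2 = 0 \<or> t 0 = 0 \<and> t 3 = 0" using b by auto
      then show False using F2_nonvanishing[OF t a] by blast
    qed
    show "(1 - s) *\<^sub>R (Complex (- (t 0 * t 1 - t 1 * t 2 + t 2 * t 3 + t 0 * t 3)) (t 0 - t 1 + t 2 - t 3), t 1 * t 2 * (t 3 - t 0)) + s *\<^sub>R reference_map t \<noteq> 0"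
      if t: "t \<in> simplex_frontier 3" and s: "0 \<le> s" "s \<le> 1" for t s
    proof
      note tD = simplex_frontier_3D(1)[OF t]
      note T = standard_simplex_3D[OF tD]
      assume "(1 - s) *\<^sub>R (Complex (- (t 0 * t 1 - t 1 * t 2 + t 2 * t 3 + t 0 * t 3)) (t 0 - t 1 + t 2 - t 3), t 1 * t 2 * (t 3 - t 0)) + s *\<^sub>R reference_map t = 0"
      then have re: "(1 - s) * (- (t 0 * t 1 - t 1 * t 2 + t 2 * t 3 + t 0 * t 3)) + s * (t 1 + t 2 - t 0 - t 3) = 0"
        and im: "(1 - s) * (t 0 - t 1 + t 2 - t 3) + s * (t 2 - t 1) = 0"
        and th: "(1 - s) * (t 1 * t 2 * (t 3 - t 0)) + s * (t 3 - t 0) = 0"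
        by (simp_all add: reference_map_def zero_prod_def complex_eq_iff)
      \<comment> \<open>A vanishing second factor forces \<open>s = 0\<close>, and
        \<open>F2_nonvanishing\<close> applies. If \<open>t 3 = t 0\<close>, the imaginary part
        gives \<open>t 1 = t 2\<close>, and on the frontier only the midpoint of the edge from
        vertex 1 to vertex 2 and that of the edge from vertex 0 to vertex 3 remain. There the real
        parts of the two maps are 1/4 and 1, or -1/4 and -1: equal signs, so no convex combination
        vanishes.\<close>
      have "(t 3 - t 0) * ((1 - s) * (t 1 * t 2) + s) = 0" using th by (simp add: algebra_simps)
      then consider "t 3 = t 0" | "(1 - s) * (t 1 * t 2) + s = 0" by force
      then show False
      proof cases
        case 2
        have "0 \<le> (1 - s) * (t 1 * t 2)" using s T by simp
        then have "s = 0" using 2 s by linarith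
        have c: "t 1 = 0 \<or> t 2 = 0 \<or> t 0 = 0 \<and> t 3 = 0" using 2 \<open>s = 0\<close> by auto
        have a: "t 0 - t 1 + t 2 - t 3 = 0" using im \<open>s = 0\<close> by simp
        have b: "t 0 * t 1 - t 1 * t 2 + t 2 * t 3 + t 0 * t 3 = 0" using re unfolding \<open>s = 0\<close>
          by (simp only: diff_zero mult_1_left mult_zero_left add_0_right neg_equal_0_iff_equal)
        show False by (rule F2_nonvanishing[OF tD a b c])
      next
        case 1
        then have t12: "t 1 = t 2" using im by (simp add: algebra_simps)
        have half: "t 0 = 1/2 - t 1" using T(5) 1 t12 by simp
        have "t 0 = 0 \<or> t 1 = 0" using simplex_frontier_3D(2)[OF t] 1 t12 by auto
        then show False
        proof
          assume "t 0 = 0"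
          then have h: "t 1 = 1/2" "t 2 = 1/2" "t 3 = 0" using half 1 t12 by simp_all
          show False using re s unfolding h \<open>t 0 = 0\<close> by (simp add: field_simps)
        next
          assume t1: "t 1 = 0"
          have h: "t 2 = 0" "t 0 = 1/2" "t 3 = 1/2" using half 1 t12 t1 by simp_all
          have "1 + 3 * s = 0" using re unfolding h t1 by (simp add: field_simps)
          then show False using s by linarith
        qed
      qed
    qed
  qed
  have F0: "F2 t \<noteq> 0" if t: "t \<in> ?D" for t
  proof
    assume "F2 t = 0"
    then have e: "Complex (- (t 0 * t 1 - t 1 * t 2 + t 2 * t 3 + t 0 * t 3)) (t 0 - t 1 + t 2 - t 3) = 0"
      "Complex (t 0 * t 1 * t 2 * t 3) (1 * (t 1 * t 2 * (t 3 - t 0))) = 0"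
      by (simp_all add: F2_def zero_prod_def)
    then have a: "t 0 - t 1 + t 2 - t 3 = 0" "t 0 * t 1 - t 1 * t 2 + t 2 * t 3 + t 0 * t 3 = 0"
      and b: "t 0 * t 1 * t 2 * t 3 = 0" "t 1 * t 2 * (t 3 - t 0) = 0"
      by (simp_all only: Complex_eq_0 neg_equal_0_iff_equal mult_1)
    have "t 1 = 0 \<or> t 2 = 0 \<or> t 0 = 0 \<and> t 3 = 0" using b by auto
    then show False using F2_nonvanishing[OF t a] by blast
  qed
  have G0: "G2 t \<noteq> 0" if t: "t \<in> ?D" for t
  proof
    assume "G2 t = 0"
    then have a: "t 0 - (t 1 + t 2) + t 3 = 0" "t 0 * (t 1 + t 2) - (t 1 + t 2) * t 3 = 0" "t 0 * (t 1 + t 2) * t 3 = 0"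
      by (simp_all only: G2_def zero_prod_def prod.inject Complex_eq_0 of_real_eq_0_iff neg_equal_0_iff_equal)
    have h: "t 1 + t 2 = 1/2" using a(1) standard_simplex_3D(5)[OF t] by simp
    then have "t 0 = t 3" using a(2) by simp
    then show False using a(1,3) h by simp
  qed
  have cF: "continuous_on ?D F2" and cG: "continuous_on ?D G2"
    unfolding F2_def G2_def by (intro continuous_intros continuous_on_Complex ci)+
  have m1: "(- 1 :: complex) \<in> lens2.roots" and o1: "(1 :: complex) \<in> lens2.roots" by simp_all
  show ?thesis
  proof (rule lens2.volume_two_lens[where y = "(0, \<i>)" and \<tau> = ?\<tau> and \<sigma> = ?\<sigma>])
    show "(0, \<i>) \<in> S3" by (simp add: mem_S3)
    show "singular_simplex 3 (top_of_set S3) ?\<tau>" by (rule singular_simplex_sgn[OF cF F0])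
    show "singular_simplex 3 (top_of_set S3) ?\<sigma>" by (rule singular_simplex_sgn[OF cG G0])
    show "homology_generator 3 (top_of_set S3) (S3 - {(0, \<i>)}) (frag_of ?\<tau>)" by (rule gen)
    show "?\<tau> t \<noteq> scale \<zeta> (0, \<i>)" if t: "t \<in> ?D" and z: "\<zeta> \<in> lens2.roots" "\<zeta> \<noteq> 1" for t \<zeta>
    proof -
      have "Re \<zeta> < 0" using two[OF z(1)] z(2) by auto
      moreover have "0 \<le> t 0 * t 1 * t 2 * t 3" using standard_simplex_3D[OF t] by simp
      ultimately show ?thesis using sgn_chart_avoids[of \<i>] t by (simp add: F2_def)
    qed
    show "?\<sigma> t \<noteq> scale \<zeta> (0, \<i>)" if t: "t \<in> ?D" and z: "\<zeta> \<in> lens2.roots" for t \<zeta>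
    proof
      assume "?\<sigma> t = scale \<zeta> (0, \<i>)"
      then have "Im (snd (sgn (G2 t))) = Im (snd (scale \<zeta> (0, \<i>)))" using t by simp
      then show False using two[OF z] by (auto simp: sgn_div_norm G2_def scale_def)
    qed
    show "chain_boundary 3 (frag_of ?\<tau> + frag_of ?\<sigma>) =
      (frag_of (singular_face 3 0 ?\<tau>) - frag_of (singular_face 3 3 ?\<tau>)) + (frag_of (singular_face 3 0 ?\<sigma>) - frag_of (singular_face 3 1 ?\<tau>))
      + (frag_of (singular_face 3 2 ?\<tau>) - frag_of (singular_face 3 3 ?\<sigma>)) + (frag_of (singular_face 3 2 ?\<sigma>) - frag_of (singular_face 3 1 ?\<sigma>))"
      unfolding chain_boundary_add chain_boundary_3 by (simp add: algebra_simps)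
    show "lens2.deck_related (singular_face 3 0 ?\<tau>) (singular_face 3 3 ?\<tau>)"
      by (rule lens2.deck_related_sgn[OF m1]) (simp_all add: F2_def simplical_face_3[unfolded One_nat_def] simplical_face_3 scale_def complex_eq_iff algebra_simps)
    show "lens2.deck_related (singular_face 3 0 ?\<sigma>) (singular_face 3 1 ?\<tau>)"
      by (rule lens2.deck_related_sgn[OF m1]) (simp_all add: F2_def G2_def simplical_face_3[unfolded One_nat_def] simplical_face_3 scale_def complex_eq_iff algebra_simps)
    show "lens2.deck_related (singular_face 3 2 ?\<tau>) (singular_face 3 3 ?\<sigma>)"
      by (rule lens2.deck_related_sgn[OF o1]) (simp_all add: F2_def G2_def simplical_face_3[unfolded One_nat_def] simplical_face_3 scale_def complex_eq_iff algebra_simps)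
    show "lens2.deck_related (singular_face 3 2 ?\<sigma>) (singular_face 3 1 ?\<sigma>)"
      by (rule lens2.deck_related_sgn[OF o1]) (simp_all add: F2_def G2_def simplical_face_3[unfolded One_nat_def] simplical_face_3 scale_def complex_eq_iff algebra_simps)
  qed
qed

section \<open>Explicit simplices for p = 3\<close>

text \<open>Real coordinates with respect to 1 and the primitive cube root of unity
  \<open>eis 0 1\<close>, whose square is \<open>eis (- 1) (- 1)\<close>. In these coordinates the
  deck transformations have integer coefficients.\<close>

definition eis :: "real \<Rightarrow> real \<Rightarrow> complex" where
  "eis x y = Complex (x - y / 2) (sqrt 3 / 2 * y)"

lemma eis_sel: "Re (eis x y) = x - y / 2" "Im (eis x y) = sqrt 3 / 2 * y"
  by (simp_all add: eis_def)

lemma eis_mult: "eis x y * eis x' y' = eis (x * x' - y * y') (x * y' + y * x' - y * y')"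
  by (simp add: eis_def complex_eq_iff field_simps)

lemma eis_eq_0: "eis x y = 0 \<longleftrightarrow> x = 0 \<and> y = 0"
  by (auto simp: eis_def complex_eq_iff)

lemma eis_nonzero: "0 \<le> x \<Longrightarrow> 0 \<le> y \<Longrightarrow> x + y = 1 \<Longrightarrow> eis x y \<noteq> 0"
  by (auto simp: eis_eq_0)

lemma continuous_on_eis [continuous_intros]:
  "continuous_on A f \<Longrightarrow> continuous_on A g \<Longrightarrow> continuous_on A (\<lambda>x. eis (f x) (g x))"
  unfolding eis_def by (intro continuous_intros continuous_on_Complex) auto

text \<open>\<open>A3\<close> and \<open>B3\<close> are the coefficients of \<open>Z3\<close> with
  respect to 1 and \<open>eis 0 1\<close>; some terms are grouped by their pattern of
  exponents.\<close>

definition A3 :: "real \<Rightarrow> real \<Rightarrow> real \<Rightarrow> real \<Rightarrow> real" where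
  "A3 a b c d = a^3 + d^3 + (a^2 * b + a * c^2) + 2 * (a^2 * c + b * c^2) - a * b^2 + 3 * a * b * c - 4 * a * b * d - 2 * a * c * d - 3 * a * d^2
     - b^3 + (b^2 * c + b * d^2) - (b^2 * d + c * d^2) - 2 * c^2 * d"

definition B3 :: "real \<Rightarrow> real \<Rightarrow> real \<Rightarrow> real \<Rightarrow> real" where
  "B3 a b c d = 2 * (a^2 * b + a * c^2) + (a^2 * c + b * c^2) + 3 * a^2 * d + a * b^2 + 3 * a * b * c - 2 * a * b * d + 2 * a * c * d - 3 * a * d^2
     - b^3 - (b^2 * c + b * d^2) - 2 * (b^2 * d + c * d^2) - 3 * b * c * d + c^3 - c^2 * d"

text \<open>The cubic form is determined by its restrictions to the faces: each of its monomials involves at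
  most three of the barycentric coordinates.\<close>

definition Z3 :: "real \<Rightarrow> real \<Rightarrow> real \<Rightarrow> real \<Rightarrow> complex" where
  "Z3 a b c d = eis (A3 a b c d) (B3 a b c d)"

text \<open>The factor is the square of \<open>eis 0 1\<close>, so faces 0 and 3 of the form differ
  by a deck transformation.\<close>

lemma Z3_face_0: "Z3 0 a b c = eis (- 1) (- 1) * Z3 a b c 0"
  unfolding Z3_def eis_mult A3_def B3_def
  by (rule arg_cong2[of _ _ _ _ eis]) (simp_all add: algebra_simps)

text \<open>On faces 1 and 2 the form splits into factors that run linearly from 1 to
  \<open>eis 0 1\<close>. They are the factors of \<open>G3\<close> on its faces 2 and 1, and they
  have no zero on the simplex.\<close>

lemma Z3_face_1: "Z3 a 0 b c = eis a (b + c) * eis (a + b) c * eis (a + b) c"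
  unfolding Z3_def eis_mult A3_def B3_def
  by (rule arg_cong2[of _ _ _ _ eis]) (simp_all add: algebra_simps power2_eq_square power3_eq_cube)

lemma Z3_face_2: "Z3 a b 0 c = eis a (b + c) * eis a (b + c) * eis (a + b) c"
  unfolding Z3_def eis_mult A3_def B3_def
  by (rule arg_cong2[of _ _ _ _ eis]) (simp_all add: algebra_simps power2_eq_square power3_eq_cube)

text \<open>Where \<open>t 0 = t 3\<close>, the second coordinate points in the direction
  \<open>- eis 0 1\<close>; this determines the point at which the local degree is taken.\<close>

definition F3 :: "(nat \<Rightarrow> real) \<Rightarrow> complex \<times> complex" where
  "F3 t = (Z3 (t 0) (t 1) (t 2) (t 3),
     Complex (t 1 * t 2 * (t 0 + t 3) / 2) (- 1 * (sqrt 3 / 2 * (t 1 * t 2) * (t 3 - t 0))) * (- eis 0 1))"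

text \<open>With second coordinate zero, the normalized simplex stays in a circle. Its vertices go
  to 1, \<open>eis 0 1\<close>, the square of that, and 1 again, once around the circle.\<close>

definition G3 :: "(nat \<Rightarrow> real) \<Rightarrow> complex \<times> complex" where
  "G3 t = (eis (t 0) (t 1 + t 2 + t 3) * eis (t 0 + t 1) (t 2 + t 3) * eis (t 0 + t 1 + t 2) (t 3), 0)"

text \<open>The defining form displays the component along \<open>- eis 0 1\<close>, for the local
  degree. This one displays the faces: the second coordinate is zero on faces 1 and 2, and on face 0
  it is that of face 3 times the square of \<open>eis 0 1\<close>.\<close>

lemma F3_eq: "F3 t = (Z3 (t 0) (t 1) (t 2) (t 3), eis (t 1 * t 2 * (t 0 - t 3)) (- (t 1 * t 2 * t 3)))"
proof -
  have "Complex (x * (a + d) / 2) (- 1 * (sqrt 3 / 2 * x * (d - a))) * (- eis 0 1) = eis (x * (a - d)) (- (x * d))" for x a d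
    by (simp add: eis_def complex_eq_iff field_simps)
  then show ?thesis unfolding F3_def by simp
qed

lemma norm_eis: "norm (eis 0 1) = 1" "norm (eis (- 1) (- 1)) = 1"
  by (simp_all add: eis_def cmod_def power2_eq_square field_simps)

lemma eis_roots: "eis 0 1 \<in> lens3.roots" "eis (- 1) (- 1) \<in> lens3.roots"
proof -
  have "eis 1 0 = 1" by (simp add: eis_def complex_eq_iff)
  then show "eis 0 1 \<in> lens3.roots" "eis (- 1) (- 1) \<in> lens3.roots"
    by (simp_all add: power3_eq_cube eis_mult)
qed

text \<open>Dividing \<open>\<zeta> * \<zeta> + \<zeta> + 1 = 0\<close> by \<zeta>, that is,
  multiplying by the conjugate, gives \<open>\<zeta> + 1 + cnj \<zeta> = 0\<close>; the real part is
  -1/2.\<close>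

lemma Re_root_3:
  assumes z: "\<zeta> \<in> lens3.roots" "\<zeta> \<noteq> 1"
  shows "Re \<zeta> < 0"
proof -
  have "(\<zeta> - 1) * (\<zeta> * \<zeta> + \<zeta> + 1) = \<zeta> ^ 3 - 1" by (simp add: algebra_simps power3_eq_cube)
  then have "\<zeta> * \<zeta> + \<zeta> + 1 = 0" using z by simp
  then have "(\<zeta> * \<zeta> + \<zeta> + 1) * cnj \<zeta> = 0" by simp
  then have "\<zeta> * (\<zeta> * cnj \<zeta>) + \<zeta> * cnj \<zeta> + cnj \<zeta> = 0" by (simp add: algebra_simps)
  then have "\<zeta> + 1 + cnj \<zeta> = 0" unfolding lens3.root_cnj[OF z(1)] by simp
  then have "Re (\<zeta> + 1 + cnj \<zeta>) = 0" by simp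
  then show ?thesis by simp
qed

text \<open>The factorizations settle faces 1 and 2. On the edge from vertex 1 to vertex 2,
  \<open>B3\<close> is \<open>1 - 2 * t 1\<close>, so only the midpoint could be a zero, and there
  \<open>A3\<close> is 1/4.\<close>

lemma Z3_nonvanishing:
  assumes t: "t \<in> standard_simplex 3" and z: "t 1 = 0 \<or> t 2 = 0 \<or> t 0 = 0 \<and> t 3 = 0"
  shows "Z3 (t 0) (t 1) (t 2) (t 3) \<noteq> 0"
proof -
  note s = standard_simplex_3D[OF t]
  from z consider "t 1 = 0" | "t 2 = 0" | "t 0 = 0" "t 3 = 0" by blast
  then show ?thesis
  proof cases
    case 1
    have "eis (t 0) (t 2 + t 3) \<noteq> 0" "eis (t 0 + t 2) (t 3) \<noteq> 0"
      using s 1 by (intro eis_nonzero; simp)+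
    then show ?thesis unfolding 1 Z3_face_1 by simp
  next
    case 2
    have "eis (t 0) (t 1 + t 3) \<noteq> 0" "eis (t 0 + t 1) (t 3) \<noteq> 0"
      using s 2 by (intro eis_nonzero; simp)+
    then show ?thesis unfolding 2 Z3_face_2 by simp
  next
    case 3
    then have t2: "t 2 = 1 - t 1" using s by simp
    have B: "B3 0 (t 1) (1 - t 1) 0 = 1 - 2 * t 1"
      by (simp add: B3_def algebra_simps power2_eq_square power3_eq_cube)
    show ?thesis
    proof
      assume "Z3 (t 0) (t 1) (t 2) (t 3) = 0"
      then have "B3 0 (t 1) (1 - t 1) 0 = 0" "A3 0 (t 1) (1 - t 1) 0 = 0" unfolding 3 t2 Z3_def eis_eq_0 by blast+
      moreover from this(1) have h: "t 1 = 1/2" unfolding B by simp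
      ultimately show False unfolding h by (simp add: A3_def power2_eq_square power3_eq_cube)
    qed
  qed
qed

lemma volume_two_lens3: "volume_two lens3.X"
proof -
  let ?D = "standard_simplex 3" and ?u = "- eis 0 1"
  let ?\<tau> = "restrict (\<lambda>t. sgn (F3 t)) ?D" and ?\<sigma> = "restrict (\<lambda>t. sgn (G3 t)) ?D"
  let ?Z = "\<lambda>t. Z3 (t 0) (t 1) (t 2) (t 3)" and ?a = "\<lambda>t::nat \<Rightarrow> real. t 1 * t 2 * (t 0 + t 3) / 2"
    and ?v = "\<lambda>t::nat \<Rightarrow> real. sqrt 3 / 2 * (t 1 * t 2) * (t 3 - t 0)"
  have ci: "continuous_on A (\<lambda>t::nat \<Rightarrow> real. t i)" for A i by (rule continuous_on_coordinate)
  have cZ: "continuous_on ?D ?Z"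
    unfolding Z3_def A3_def B3_def by (intro continuous_intros ci)
  have u: "norm ?u = 1" using norm_eis(1) by (simp only: norm_minus_cancel)
  have apos: "0 \<le> ?a t" if "t \<in> ?D" for t using standard_simplex_3D[OF that] by simp
  have ne: "?Z t \<noteq> 0 \<or> ?a t \<noteq> 0" if t: "t \<in> ?D" for t
  proof (rule ccontr)
    assume c: "\<not> ?thesis"
    then have "t 1 = 0 \<or> t 2 = 0 \<or> t 0 + t 3 = 0" by auto
    then have "t 1 = 0 \<or> t 2 = 0 \<or> t 0 = 0 \<and> t 3 = 0" using standard_simplex_3D[OF t] by linarith
    then show False using Z3_nonvanishing[OF t] c by blast
  qed
  have gen: "homology_generator 3 (top_of_set S3) (S3 - {(0, ?u)}) (frag_of ?\<tau>)"
    unfolding F3_def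
  proof (rule homology_generator_sphere[OF u])
    show "(- 1::real) = 1 \<or> (- 1::real) = - 1" by simp
    show "continuous_on ?D ?Z" by (rule cZ)
    show "continuous_on ?D ?a" "continuous_on ?D ?v" by (intro continuous_intros ci; simp)+
    show "0 \<le> ?a t" if "t \<in> ?D" for t by (rule apos[OF that])
    show "?Z t \<noteq> 0 \<or> ?a t \<noteq> 0 \<or> ?v t \<noteq> 0" if "t \<in> ?D" for t using ne[OF that] by blast
    show "(1 - s) *\<^sub>R (?Z t, ?v t) + s *\<^sub>R reference_map t \<noteq> 0"
      if t: "t \<in> simplex_frontier 3" and s: "0 \<le> s" "s \<le> 1" for t s
    proof
      note tD = simplex_frontier_3D(1)[OF t]
      note T = standard_simplex_3D[OF tD]
      let ?r = "sqrt 3 / 2 :: real"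
      have r: "0 < ?r" by simp
      assume e: "(1 - s) *\<^sub>R (?Z t, ?v t) + s *\<^sub>R reference_map t = 0"
      have re: "(1 - s) * Re (?Z t) + s * (t 1 + t 2 - t 0 - t 3) = 0"
        using arg_cong[OF e, of "\<lambda>z. Re (fst z)"] by (simp add: reference_map_def)
      have im: "(1 - s) * Im (?Z t) + s * (t 2 - t 1) = 0"
        using arg_cong[OF e, of "\<lambda>z. Im (fst z)"] by (simp add: reference_map_def)
      have th: "(1 - s) * ?v t + s * (t 3 - t 0) = 0"
        using arg_cong[OF e, of snd] by (simp add: reference_map_def)
      have "(t 3 - t 0) * ((1 - s) * (?r * (t 1 * t 2)) + s) = 0" using th by (simp add: algebra_simps)
      then consider "t 3 = t 0" | "(1 - s) * (?r * (t 1 * t 2)) + s = 0" by force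
      then show False
      proof cases
        case 2
        have "0 \<le> (1 - s) * (?r * (t 1 * t 2))" using s T by simp
        then have s0: "s = 0" using 2 s by linarith
        have "t 1 = 0 \<or> t 2 = 0" using 2 s0 by auto
        moreover have "?Z t = 0" using re im s0 by (simp add: complex_eq_iff)
        ultimately show False using Z3_nonvanishing[OF tD] by blast
      next
        case 1
        define x where "x = t 0"
        have t0: "t 0 = x" "t 3 = x" using 1 by (simp_all add: x_def)
        have fac: "(1 - s) * (q * (y * k)) + s * y = y * ((1 - s) * (q * k) + s)"
          "(1 - s) * (q * - (y * k)) + s * (0 - y) = - (y * ((1 - s) * (q * k) + s))" for q y k
          by (simp_all add: algebra_simps)
        \<comment> \<open>This is the factor beside \<open>1 - 2 * x\<close> in \<open>B3\<close> on
          faces 1 and 2, for \<open>t 0 = t 3 = x\<close>. By its positivity the imaginary part can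
          vanish there for \<open>x = 1/2\<close> only.\<close>
        have k: "0 < 1 - 3 * x * (1 - x)"
        proof -
          have "1 - 3 * x * (1 - x) = 3 * (x - 1/2)^2 + 1/4" by (simp add: power2_eq_square algebra_simps)
          moreover have "0 \<le> 3 * (x - 1/2)^2" by simp
          ultimately show ?thesis by linarith
        qed
        have pos: "0 < (1 - s) * (?r * (1 - 3 * x * (1 - x))) + s"
        proof (cases "s = 0")
          case True then show ?thesis using k r by simp
        next
          case False
          have "0 \<le> (1 - s) * (?r * (1 - 3 * x * (1 - x)))" using k r s by simp
          then show ?thesis using False s by linarith
        qed
        \<comment> \<open>The imaginary part leaves two candidates, the midpoint of the edge from
          vertex 1 to vertex 2 and that of the edge from vertex 0 to vertex 3. The real parts of
          \<open>?Z\<close> and \<open>reference_map\<close> there are 1/4 and 1, or -1/8 and -1, so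
          the signs agree.\<close>
        have "x = 0 \<or> t 1 = 0 \<or> t 2 = 0" using simplex_frontier_3D(2)[OF t] t0 by auto
        then consider "x = 0" | "t 1 = 0" | "t 2 = 0" by blast
        then show False
        proof cases
          case 1
          then have t2: "t 2 = 1 - t 1" using T(5) t0 by simp
          have B: "B3 0 (t 1) (1 - t 1) 0 = 1 - 2 * t 1"
            by (simp add: B3_def algebra_simps power2_eq_square power3_eq_cube)
          have "(1 - 2 * t 1) * ((1 - s) * ?r + s) = 0"
            using im unfolding t0 t2 1 Z3_def eis_sel B by (simp add: field_simps)
          moreover have "(1 - s) * ?r + s \<noteq> 0"
          proof (cases "s = 0")
            case False
            have "0 \<le> (1 - s) * ?r" using s r by simp
            then show ?thesis using False s by linarith
          qed simp
          ultimately have h: "t 1 = 1/2" by simp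
          have "(1 - s) * (1/4) + s = 0"
            using re unfolding t0 t2 1 Z3_def eis_sel h by (simp add: A3_def B3_def power2_eq_square power3_eq_cube)
          then show False using s by (simp add: field_simps)
        next
          case 2
          then have t2: "t 2 = 1 - 2 * x" using T(5) t0 by simp
          have B: "B3 x 0 (1 - 2 * x) x = (1 - 2 * x) * (1 - 3 * x * (1 - x))"
            by (simp add: B3_def algebra_simps power2_eq_square power3_eq_cube)
          have "(1 - 2 * x) * ((1 - s) * (?r * (1 - 3 * x * (1 - x))) + s) = 0"
            using im unfolding t0 t2 2 Z3_def eis_sel B diff_zero fac .
          then have h: "x = 1/2" using pos by simp
          have "- ((1 - s) / 8) = s"
            using re unfolding t0 t2 2 Z3_def eis_sel h by (simp add: A3_def B3_def power2_eq_square power3_eq_cube)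
          then show False using s by (simp add: field_simps)
        next
          case 3
          then have t1: "t 1 = 1 - 2 * x" using T(5) t0 by simp
          have B: "B3 x (1 - 2 * x) 0 x = - ((1 - 2 * x) * (1 - 3 * x * (1 - x)))"
            by (simp add: B3_def algebra_simps power2_eq_square power3_eq_cube)
          have "(1 - 2 * x) * ((1 - s) * (?r * (1 - 3 * x * (1 - x))) + s) = 0"
            using im unfolding t0 t1 3 Z3_def eis_sel B fac neg_equal_0_iff_equal .
          then have h: "x = 1/2" using pos by simp
          have "- ((1 - s) / 8) = s"
            using re unfolding t0 t1 3 Z3_def eis_sel h by (simp add: A3_def B3_def power2_eq_square power3_eq_cube)
          then show False using s by (simp add: field_simps)
        qed
      qed
    qed
  qed
  have F0: "F3 t \<noteq> 0" if t: "t \<in> ?D" for t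
  proof
    assume F: "F3 t = 0"
    have "?Z t = 0" using arg_cong[OF F, of fst] by (simp add: F3_def)
    moreover have "Complex (?a t) (- 1 * ?v t) * ?u = 0" using arg_cong[OF F, of snd] unfolding F3_def by (simp only: snd_conv snd_zero)
    moreover have "?u \<noteq> 0" by (simp add: eis_eq_0)
    ultimately have "?Z t = 0" "Complex (?a t) (- 1 * ?v t) = 0" using mult_eq_0_iff by blast+
    then show False using ne[OF t] unfolding Complex_eq_0 by blast
  qed
  have G0: "G3 t \<noteq> 0" if t: "t \<in> ?D" for t
  proof
    note T = standard_simplex_3D[OF t]
    assume G: "G3 t = 0"
    have "eis (t 0) (t 1 + t 2 + t 3) \<noteq> 0" "eis (t 0 + t 1) (t 2 + t 3) \<noteq> 0" "eis (t 0 + t 1 + t 2) (t 3) \<noteq> 0"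
      using T by (intro eis_nonzero; simp)+
    then show False using arg_cong[OF G, of fst] by (simp add: G3_def)
  qed
  have cF: "continuous_on ?D F3"
    unfolding F3_eq by (intro continuous_intros cZ ci)
  have cG: "continuous_on ?D G3"
    unfolding G3_def by (intro continuous_intros ci)
  have o1: "(1 :: complex) \<in> lens3.roots" by simp
  note sf = simplical_face_3[unfolded One_nat_def] simplical_face_3
  show ?thesis
  proof (rule lens3.volume_two_lens[where y = "(0, ?u)" and \<tau> = ?\<tau> and \<sigma> = ?\<sigma>])
    show "(0, ?u) \<in> S3" using u by (simp add: norm_Pair)
    show "singular_simplex 3 (top_of_set S3) ?\<tau>" by (rule singular_simplex_sgn[OF cF F0])
    show "singular_simplex 3 (top_of_set S3) ?\<sigma>" by (rule singular_simplex_sgn[OF cG G0])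
    show "homology_generator 3 (top_of_set S3) (S3 - {(0, ?u)}) (frag_of ?\<tau>)" by (rule gen)
    show "?\<tau> t \<noteq> scale \<zeta> (0, ?u)" if t: "t \<in> ?D" and z: "\<zeta> \<in> lens3.roots" "\<zeta> \<noteq> 1" for t \<zeta>
    proof -
      have "sgn (F3 t) \<noteq> scale \<zeta> (0, ?u)"
        unfolding F3_def by (rule sgn_chart_avoids[OF u apos[OF t] Re_root_3[OF z]])
      then show ?thesis using t by simp
    qed
    show "?\<sigma> t \<noteq> scale \<zeta> (0, ?u)" if t: "t \<in> ?D" and z: "\<zeta> \<in> lens3.roots" for t \<zeta>
    proof
      assume "?\<sigma> t = scale \<zeta> (0, ?u)"
      then have "snd (sgn (G3 t)) = snd (scale \<zeta> (0, ?u))" using t by simp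
      then have "\<zeta> * ?u = 0" by (simp add: sgn_div_norm G3_def scale_def)
      moreover have "\<zeta> \<noteq> 0" "?u \<noteq> 0" using z by (auto simp: eis_eq_0)
      ultimately show False using mult_eq_0_iff by blast
    qed
    show "chain_boundary 3 (frag_of ?\<tau> + frag_of ?\<sigma>) =
      (frag_of (singular_face 3 0 ?\<tau>) - frag_of (singular_face 3 3 ?\<tau>)) + (frag_of (singular_face 3 0 ?\<sigma>) - frag_of (singular_face 3 3 ?\<sigma>))
      + (frag_of (singular_face 3 2 ?\<sigma>) - frag_of (singular_face 3 1 ?\<tau>)) + (frag_of (singular_face 3 2 ?\<tau>) - frag_of (singular_face 3 1 ?\<sigma>))"
      unfolding chain_boundary_add chain_boundary_3 by (simp add: algebra_simps)
    show "lens3.deck_related (singular_face 3 0 ?\<tau>) (singular_face 3 3 ?\<tau>)"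
      by (rule lens3.deck_related_sgn[OF eis_roots(2)]) (simp_all add: mult_ac F3_eq sf scale_def Z3_face_0 eis_mult)
    show "lens3.deck_related (singular_face 3 0 ?\<sigma>) (singular_face 3 3 ?\<sigma>)"
    proof (rule lens3.deck_related_sgn[OF eis_roots(1)])
      fix t assume "t \<in> standard_simplex 2"
      then have s1: "t 0 + t 1 + t 2 = 1" by (rule standard_simplex_2D)
      have e1: "eis 1 0 = 1" by (simp add: eis_def complex_eq_iff)
      show "G3 (simplical_face 0 t) = scale (eis 0 1) (G3 (simplical_face 3 t))"
        by (simp add: G3_def sf scale_def s1 s1[unfolded One_nat_def] e1 mult.assoc)
    qed simp_all
    show "lens3.deck_related (singular_face 3 2 ?\<sigma>) (singular_face 3 1 ?\<tau>)"
      by (rule lens3.deck_related_sgn[OF o1]) (simp_all add: F3_eq G3_def sf Z3_face_1[unfolded One_nat_def] Z3_face_1 eis_eq_0)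
    show "lens3.deck_related (singular_face 3 2 ?\<tau>) (singular_face 3 1 ?\<sigma>)"
      by (rule lens3.deck_related_sgn[OF o1]) (simp_all add: F3_eq G3_def sf Z3_face_2 eis_eq_0)
  qed
qed

section \<open>The product of the circle and the 2-sphere\<close>

lemma nsphere_eq_top_of_set: "nsphere n = top_of_set {x. (\<forall>i>n. x i = 0) \<and> (\<Sum>i\<le>n. (x i)\<^sup>2) = 1}"
  unfolding nsphere powertop_real_eq_euclidean by (simp only: conj_commute)

abbreviation S1 :: "complex set" where
  "S1 \<equiv> sphere 0 1"

abbreviation S2 :: "(complex \<times> real) set" where
  "S2 \<equiv> sphere 0 1"

lemma mem_S2: "y \<in> S2 \<longleftrightarrow> (norm (fst y))\<^sup>2 + (snd y)\<^sup>2 = 1"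
  by (cases y) (simp add: norm_Pair)

lemma nsphere_1_homeomorphic_S1: "nsphere 1 homeomorphic_space top_of_set S1"
proof -
  let ?N = "{x :: nat \<Rightarrow> real. (\<forall>i>1. x i = 0) \<and> (\<Sum>i\<le>1. (x i)\<^sup>2) = 1}"
  let ?f = "\<lambda>x :: nat \<Rightarrow> real. Complex (x 0) (x 1)" and ?g = "\<lambda>z (i::nat). if i = 0 then Re z else if i = 1 then Im z else 0 :: real"
  have s: "(\<Sum>i\<le>1. (x i)\<^sup>2) = (x 0)\<^sup>2 + (x 1)\<^sup>2" for x :: "nat \<Rightarrow> real" by (simp add: eval_nat_numeral)
  have "homeomorphism ?N S1 ?f ?g"
  proof (rule homeomorphismI)
    show "continuous_on ?N ?f" by (intro continuous_on_Complex continuous_on_coordinate)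
    have "continuous_on S1 (\<lambda>z. ?g z i)" for i
      by (cases "i = 0"; cases "i = 1") (simp_all add: continuous_intros)
    then show "continuous_on S1 ?g" by (rule continuous_on_coordinatewise_then_product)
    show "?f ` ?N \<subseteq> S1" unfolding s by (auto simp: cmod_def)
    show "?g ` S1 \<subseteq> ?N" unfolding s by (auto simp: cmod_def)
    show "?f (?g z) = z" for z by (simp add: complex_eq_iff)
    show "?g (?f x) = x" if "x \<in> ?N" for x
    proof
      fix i :: nat
      consider "i = 0" | "i = 1" | "i > 1" by linarith
      then show "?g (?f x) i = x i" using that by cases auto
    qed
  qed
  then show ?thesis
    unfolding nsphere_eq_top_of_set homeomorphic_space_def homeomorphic_maps_iff_homeomorphism by blast
qed

lemma nsphere_2_homeomorphic_S2: "nsphere 2 homeomorphic_space top_of_set S2"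
proof -
  let ?N = "{x :: nat \<Rightarrow> real. (\<forall>i>2. x i = 0) \<and> (\<Sum>i\<le>2. (x i)\<^sup>2) = 1}"
  let ?f = "\<lambda>x :: nat \<Rightarrow> real. (Complex (x 0) (x 1), x 2)"
    and ?g = "\<lambda>z (i::nat). if i = 0 then Re (fst z) else if i = 1 then Im (fst z) else if i = 2 then snd z else 0 :: real"
  have s: "(\<Sum>i\<le>2. (x i)\<^sup>2) = (x 0)\<^sup>2 + (x 1)\<^sup>2 + (x 2)\<^sup>2" for x :: "nat \<Rightarrow> real" by (simp add: eval_nat_numeral)
  have "homeomorphism ?N S2 ?f ?g"
  proof (rule homeomorphismI)
    show "continuous_on ?N ?f" by (intro continuous_on_Pair continuous_on_Complex continuous_on_coordinate)
    have "continuous_on S2 (\<lambda>z. ?g z i)" for i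
      by (cases "i = 0"; cases "i = 1"; cases "i = 2") (simp_all add: continuous_intros)
    then show "continuous_on S2 ?g" by (rule continuous_on_coordinatewise_then_product)
    show "?f ` ?N \<subseteq> S2" unfolding s image_subset_iff mem_S2 by (auto simp: cmod_power2)
    show "?g ` S2 \<subseteq> ?N"
    proof (rule image_subsetI)
      fix z assume "z \<in> S2"
      then show "?g z \<in> ?N" unfolding mem_S2 mem_Collect_eq s by (simp add: cmod_power2)
    qed
    show "?f (?g z) = z" for z by (cases z) (simp add: complex_eq_iff)
    show "?g (?f x) = x" if "x \<in> ?N" for x
    proof
      fix i :: nat
      consider "i = 0" | "i = 1" | "i = 2" | "i > 2" by linarith
      then show "?g (?f x) i = x i" using that by cases auto
    qed
  qed
  then show ?thesis
    unfolding nsphere_eq_top_of_set homeomorphic_space_def homeomorphic_maps_iff_homeomorphism by blast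
qed

text \<open>Contracting the plane leaves the 2-sphere, whose third homology is trivial. The plane
  stands in for the line because lifts will be taken along the exponential covering of the punctured
  plane.\<close>

lemma complex_S2_cycle_bounds:
  assumes "singular_relcycle 3 (top_of_set ((UNIV :: complex set) \<times> S2)) {} e"
  shows "singular_relboundary 3 (top_of_set ((UNIV :: complex set) \<times> S2)) {} e"
proof (rule cycle_bounds_if_trivial_homology[OF _ assms])
  let ?Y = "top_of_set ((UNIV :: complex set) \<times> S2)"
  have h1: "?Y homotopy_equivalent_space top_of_set S2"
    unfolding homotopy_equivalent_space_def
  proof (intro exI conjI)
    show "continuous_map ?Y (top_of_set S2) snd" by (auto intro: continuous_intros)
    show "continuous_map (top_of_set S2) ?Y (\<lambda>s. (0, s))" by (auto intro!: continuous_intros)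
    show "homotopic_with (\<lambda>x. True) ?Y ?Y ((\<lambda>s. (0, s)) \<circ> snd) id"
      unfolding homotopic_with_def
    proof (intro exI conjI ballI allI)
      let ?h = "\<lambda>z :: real \<times> complex \<times> complex \<times> real. (fst z *\<^sub>R fst (snd z), snd (snd z))"
      have "continuous_on ({0..1} \<times> UNIV \<times> S2) ?h" by (intro continuous_intros)
      then show "continuous_map (prod_topology (top_of_set {0..1}) ?Y) ?Y ?h"
        unfolding prod_topology_top_of_set by auto
    qed auto
    show "homotopic_with (\<lambda>x. True) (top_of_set S2) (top_of_set S2) (snd \<circ> (\<lambda>s. (0 :: complex, s))) id"
      by (rule homotopic_with_equal) auto
  qed
  have h2: "top_of_set S2 homotopy_equivalent_space nsphere 2"
    by (rule homeomorphic_imp_homotopy_equivalent_space[OF nsphere_2_homeomorphic_S2[THEN homeomorphic_space_sym[THEN iffD1]]])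
  have "reduced_homology_group 3 ?Y \<cong> reduced_homology_group 3 (nsphere 2)"
    by (rule homotopy_equivalent_space_imp_isomorphic_reduced_homology_groups[OF homotopy_eqv_trans[OF h1 h2]])
  then show "trivial_group (reduced_homology_group 3 ?Y)"
    by (rule iffD2[OF isomorphic_group_triviality])
      (rule group_reduced_homology_group group_reduced_homology_group reduced_homology_group_nsphere(2), simp)+
qed

section \<open>Homogeneity via the Hopf map\<close>

definition hopf :: "complex \<times> complex \<Rightarrow> complex \<times> real" where
  "hopf y = (2 * fst y * cnj (snd y), (norm (fst y))\<^sup>2 - (norm (snd y))\<^sup>2)"

lemma norm_S3: "y \<in> S3 \<Longrightarrow> (norm (fst y))\<^sup>2 + (norm (snd y))\<^sup>2 = 1"
  by (cases y) (simp add: norm_Pair)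

lemma hopf_S3: "hopf ` S3 = S2"
proof
  show "hopf ` S3 \<subseteq> S2"
  proof (rule image_subsetI)
    fix y assume "y \<in> S3"
    then have "((norm (fst y))\<^sup>2 + (norm (snd y))\<^sup>2)\<^sup>2 = 1" by (simp add: norm_S3)
    then show "hopf y \<in> S2"
      unfolding mem_S2 by (simp add: hopf_def norm_mult power_mult_distrib) (simp add: power2_eq_square algebra_simps)
  qed
  show "S2 \<subseteq> hopf ` S3"
  proof
    fix v assume v: "v \<in> S2"
    obtain z \<rho> where vz: "v = (z, \<rho>)" by (cases v)
    have n: "(norm z)\<^sup>2 + \<rho>\<^sup>2 = 1" using v unfolding mem_S2 vz by simp
    have "\<rho>\<^sup>2 \<le> 1" using n zero_le_power2[of "norm z"] by linarith
    then have r: "- 1 \<le> \<rho>" using abs_le_square_iff[of \<rho> 1] by simp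
    show "v \<in> hopf ` S3"
    proof (cases "\<rho> = - 1")
      case True
      then have "z = 0" using n by simp
      then have "v = hopf (0, 1)" unfolding vz hopf_def using True by simp
      then show ?thesis by (simp add: mem_S3)
    next
      case False
      \<comment> \<open>The squared norms of the coordinates of a preimage are (1 + \<rho>)/2 and (1
        - \<rho>)/2. Taking the first coordinate real and positive determines the second; only the
        south pole would give \<open>a = 0\<close>.\<close>
      define a where "a = sqrt ((1 + \<rho>) / 2)"
      have a2: "a\<^sup>2 = (1 + \<rho>) / 2" and a0: "0 < a" using r False by (simp_all add: a_def)
      let ?y = "(complex_of_real a, cnj z / complex_of_real (2 * a))"
      have "(norm (snd ?y))\<^sup>2 = (norm z)\<^sup>2 / (4 * a\<^sup>2)"
        using a0 by (simp add: norm_divide power_divide power_mult_distrib)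
      also have "\<dots> = (1 - \<rho>) * (1 + \<rho>) / (2 * (1 + \<rho>))"
      proof -
        have "(norm z)\<^sup>2 = (1 - \<rho>) * (1 + \<rho>)" using n by (simp add: power2_eq_square algebra_simps)
        moreover have "4 * a\<^sup>2 = 2 * (1 + \<rho>)" unfolding a2 by simp
        ultimately show ?thesis by (simp only:)
      qed
      also have "\<dots> = (1 - \<rho>) / 2"
      proof -
        have "(1 - \<rho>) * k / (2 * k) = (1 - \<rho>) / 2" if "k \<noteq> 0" for k using that by simp
        then show ?thesis using False by (metis add.commute add_eq_0_iff)
      qed
      finally have s: "(norm (snd ?y))\<^sup>2 = (1 - \<rho>) / 2" .
      have f: "(norm (fst ?y))\<^sup>2 = (1 + \<rho>) / 2" using a2 by simp
      have "(norm ?y)\<^sup>2 = 1"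
        using s f by (simp only: norm_Pair fst_conv snd_conv real_sqrt_pow2_iff) (simp add: field_simps)
      then have "norm ?y = 1" using norm_ge_zero[of ?y] unfolding power2_eq_1_iff by linarith
      then have "?y \<in> S3" by (simp only: mem_sphere_0)
      moreover have "hopf ?y = v"
        unfolding hopf_def s f vz using a0 by (simp add: field_simps)
      ultimately show ?thesis by blast
    qed
  qed
qed

lemma hopf_eq_imp_scale:
  assumes y: "y \<in> S3" "y' \<in> S3" and e: "hopf y = hopf y'"
  shows "\<exists>\<zeta>. norm \<zeta> = 1 \<and> y' = scale \<zeta> y"
proof -
  have n: "(norm (fst y))\<^sup>2 = (norm (fst y'))\<^sup>2" "(norm (snd y))\<^sup>2 = (norm (snd y'))\<^sup>2"
  proof -
    have d: "(norm (fst y))\<^sup>2 - (norm (snd y))\<^sup>2 = (norm (fst y'))\<^sup>2 - (norm (snd y'))\<^sup>2"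
      using arg_cong[OF e, of snd] by (simp only: hopf_def snd_conv)
    show "(norm (fst y))\<^sup>2 = (norm (fst y'))\<^sup>2" "(norm (snd y))\<^sup>2 = (norm (snd y'))\<^sup>2"
      using norm_S3[OF y(1)] norm_S3[OF y(2)] d by linarith+
  qed
  have p: "fst y * cnj (snd y) = fst y' * cnj (snd y')" using e by (simp add: hopf_def)
  have p': "cnj (fst y) * snd y = cnj (fst y') * snd y'" using arg_cong[OF p, of cnj] by (simp add: mult.commute)
  have c: "fst y * cnj (fst y) = fst y' * cnj (fst y')" "snd y * cnj (snd y) = snd y' * cnj (snd y')"
    using n by (simp_all only: complex_norm_square[symmetric])
  have o: "fst y' * cnj (fst y') + snd y' * cnj (snd y') = 1" using y(2) unfolding mem_S3 .
  \<comment> \<open>The Hermitian product of \<open>y'\<close> with \<open>y\<close>: for unit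
    vectors it is the only scalar that can carry \<open>y\<close> to \<open>y'\<close>.\<close>
  define \<zeta> where "\<zeta> = fst y' * cnj (fst y) + snd y' * cnj (snd y)"
  have "\<zeta> * fst y = fst y' * (fst y * cnj (fst y)) + snd y' * (fst y * cnj (snd y))"
    by (simp add: \<zeta>_def algebra_simps)
  also have "\<dots> = fst y' * (fst y' * cnj (fst y') + snd y' * cnj (snd y'))"
    unfolding c p by (simp add: algebra_simps)
  finally have 1: "\<zeta> * fst y = fst y'" unfolding o by simp
  have "\<zeta> * snd y = fst y' * (cnj (fst y) * snd y) + snd y' * (snd y * cnj (snd y))"
    by (simp add: \<zeta>_def algebra_simps)
  also have "\<dots> = snd y' * (fst y' * cnj (fst y') + snd y' * cnj (snd y'))"
    unfolding c p' by (simp add: algebra_simps)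
  finally have 2: "\<zeta> * snd y = snd y'" unfolding o by simp
  have s: "y' = scale \<zeta> y" using 1 2 by (simp add: scale_def prod_eq_iff)
  moreover have "norm \<zeta> = 1" using norm_scale[of \<zeta> y] y unfolding s[symmetric] by simp
  ultimately show ?thesis by blast
qed

lemma hopf_scale: "norm \<zeta> = 1 \<Longrightarrow> hopf (scale \<zeta> y) = hopf y"
proof -
  assume n: "norm \<zeta> = 1"
  then have "\<zeta> * cnj \<zeta> = 1" by (simp add: complex_norm_square[symmetric])
  then have "2 * (\<zeta> * fst y) * cnj (\<zeta> * snd y) = 2 * fst y * cnj (snd y)"
    by (metis (no_types, opaque_lifting) complex_cnj_mult mult.assoc mult.left_commute mult_1_right)
  then show ?thesis using n by (simp add: hopf_def scale_def norm_mult)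
qed

lemma continuous_on_hopf: "continuous_on A f \<Longrightarrow> continuous_on A (\<lambda>x. hopf (f x))"
  unfolding hopf_def by (intro continuous_intros)

lemma continuous_map_top_of_setI:
  "continuous_on S f \<Longrightarrow> (\<And>x. x \<in> S \<Longrightarrow> f x \<in> T) \<Longrightarrow> continuous_map (top_of_set S) (top_of_set T) f"
  by auto

text \<open>The Hopf map transports the homogeneity of the unit quaternions to the 2-sphere.\<close>

lemma isotopic_S1_S2:
  assumes x: "x \<in> topspace (top_of_set (S1 \<times> S2))"
  shows "isotopic_to_id (top_of_set (S1 \<times> S2)) (1, (0, 1)) x"
proof -
  let ?X = "top_of_set (S1 \<times> S2)" and ?T = "top_of_set (S1 \<times> S3)" and ?q = "\<lambda>y. (fst y, hopf (snd y))"
  obtain u v where x': "x = (u, v)" "u \<in> S1" "v \<in> S2" using x by auto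
  obtain s where s: "s \<in> S3" "v = hopf s" using x'(3) hopf_S3 by blast
  obtain g where g: "path g" "path_image g \<subseteq> S3" "pathstart g = (1, 0)" "pathfinish g = s"
    using path_connected_S3 s(1) lens2.one_zero_S3 unfolding path_connected_def by blast
  have gS: "g t \<in> S3" if "t \<in> {0..1}" for t using g(2) that unfolding path_image_def by blast
  have cg: "continuous_on {0..1} g" using g(1) unfolding path_def .
  have g01: "g 0 = (1, 0)" "g 1 = s" using g(3,4) unfolding pathstart_def pathfinish_def by auto
  have "path_connected S1" by (rule path_connected_sphere) simp
  then obtain h where h: "path h" "path_image h \<subseteq> S1" "pathstart h = 1" "pathfinish h = u"
    using x'(2) unfolding path_connected_def by (metis mem_sphere_0 norm_one)
  have hS: "norm (h t) = 1" if "t \<in> {0..1}" for t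
  proof -
    have "h t \<in> S1" using h(2) that unfolding path_image_def by blast
    then show ?thesis by simp
  qed
  have ch: "continuous_on {0..1} h" using h(1) unfolding path_def .
  have h01: "h 0 = 1" "h 1 = u" using h(3,4) unfolding pathstart_def pathfinish_def by auto
  have u1: "norm u = 1" using x'(2) by simp
  then have uu: "u * cnj u = 1" by (simp add: complex_norm_square[symmetric])
  \<comment> \<open>The circle factor is rotated along \<open>h\<close>, and the sphere factor is
    multiplied along \<open>g\<close>, upstairs on \<open>S1 \<times> S3\<close>.\<close>
  let ?F = "\<lambda>z. (h (fst z) * fst (snd z), qmult (g (fst z)) (snd (snd z)))"
  let ?G = "\<lambda>y. (cnj u * fst y, qmult (qinv s) (snd y))"
  have equi: "(w * fst y, hopf (qmult a (snd y))) = (w * fst y', hopf (qmult a (snd y')))"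
    if yy: "y \<in> topspace ?T" "y' \<in> topspace ?T" "?q y = ?q y'" for w a y y'
  proof -
    have "snd y \<in> S3" "snd y' \<in> S3" "hopf (snd y) = hopf (snd y')" "fst y = fst y'"
      using yy by (simp_all add: mem_Times_iff)
    then obtain \<zeta> where "norm \<zeta> = 1" "snd y' = scale \<zeta> (snd y)" using hopf_eq_imp_scale by blast
    then show ?thesis using \<open>fst y = fst y'\<close> by (simp only: qmult_scale hopf_scale)
  qed
  have "isotopic_to_id ?X (?q (1, (1, 0))) (?q (?F (1, (1, (1, 0)))))"
  proof (rule isotopic_to_id_quotient[of ?T ?X ?q ?F ?G])
    show "continuous_map ?T ?X ?q"
    proof (rule continuous_map_top_of_setI)
      show "continuous_on (S1 \<times> S3) ?q"
        by (intro continuous_on_Pair continuous_on_hopf continuous_on_fst continuous_on_snd continuous_on_id)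
      fix y assume "y \<in> S1 \<times> S3"
      then have "fst y \<in> S1" "snd y \<in> S3" by (simp_all only: mem_Times_iff)
      then show "?q y \<in> S1 \<times> S2" using hopf_S3 by blast
    qed
    have "?q ` (S1 \<times> S3) = S1 \<times> hopf ` S3" by (force simp: image_iff)
    then show "?q ` topspace ?T = topspace ?X" unfolding hopf_S3 by simp
    show "compact_space ?T" by (simp add: compact_space_subtopology compact_Times)
    show "Hausdorff_space ?X" by (simp add: Hausdorff_space_subtopology)
    have "continuous_on ({0..1::real} \<times> S1 \<times> S3) ?F"
      by (intro continuous_on_Pair continuous_on_mult continuous_on_qmult continuous_on_compose2[OF cg] continuous_on_compose2[OF ch]
          continuous_on_fst continuous_on_snd continuous_on_id) auto
    moreover have "?F z \<in> S1 \<times> S3" if "z \<in> {0..1} \<times> S1 \<times> S3" for z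
    proof -
      have "fst z \<in> {0..1}" "norm (fst (snd z)) = 1" "snd (snd z) \<in> S3" using that by auto
      then show ?thesis using qmult_S3[OF gS] hS by (simp add: norm_mult)
    qed
    ultimately show "continuous_map (prod_topology (top_of_set {0..1::real}) ?T) ?T ?F"
      unfolding prod_topology_top_of_set by (rule continuous_map_top_of_setI)
    have "continuous_on (S1 \<times> S3) ?G"
      by (intro continuous_on_Pair continuous_on_mult continuous_on_qmult continuous_on_const continuous_on_fst continuous_on_snd continuous_on_id)
    moreover have "?G z \<in> S1 \<times> S3" if "z \<in> S1 \<times> S3" for z
    proof -
      have "norm (fst z) = 1" "snd z \<in> S3" using that by auto
      then show ?thesis using qmult_S3[OF qinv_S3[OF s(1)]] u1 by (simp add: norm_mult)
    qed
    ultimately show "continuous_map ?T ?T ?G"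
      by (rule continuous_map_top_of_setI)
    show "?F (0, y) = y" for y by (simp only: fst_conv snd_conv g01 h01 qmult_one mult_1 prod.collapse)
    show "?q (?F (t, y)) = ?q (?F (t, y'))"
      if "y \<in> topspace ?T" "y' \<in> topspace ?T" "?q y = ?q y'" for t y y'
      unfolding fst_conv snd_conv by (rule equi[OF that])
    show "?G (?F (1, y)) = y" "?F (1, ?G y) = y" for y
    proof -
      have "cnj u * (u * fst y) = fst y" "u * (cnj u * fst y) = fst y"
        using uu by (simp_all add: mult.assoc[symmetric] mult.commute)
      then show "?G (?F (1, y)) = y" "?F (1, ?G y) = y"
        by (simp_all only: fst_conv snd_conv g01 h01 qmult_qinv[OF s(1)] prod.collapse)
    qed
    show "?q (?G y) = ?q (?G y')"
      if "y \<in> topspace ?T" "y' \<in> topspace ?T" "?q y = ?q y'" for y y'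
      unfolding fst_conv snd_conv by (rule equi[OF that])
    show "(1, (1, 0)) \<in> topspace ?T" using lens2.one_zero_S3 by simp
  qed
  moreover have "hopf (1, 0) = (0, 1)" by (simp add: hopf_def)
  ultimately show ?thesis by (simp add: g01 h01 qmult_one s(2) x'(1))
qed

text \<open>The point of the Riemann sphere with homogeneous coordinates \<open>[z : w]\<close>, for real \<open>w\<close>.\<close>

definition projective_point :: "complex \<Rightarrow> real \<Rightarrow> complex \<times> real" where
  "projective_point z w = ((2 * w / ((norm z)\<^sup>2 + w\<^sup>2)) *\<^sub>R z, (w\<^sup>2 - (norm z)\<^sup>2) / ((norm z)\<^sup>2 + w\<^sup>2))"

lemma projective_point_denominator: "z \<noteq> 0 \<or> w \<noteq> 0 \<Longrightarrow> 0 < (norm z)\<^sup>2 + w\<^sup>2"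
  by (auto intro: add_pos_nonneg add_nonneg_pos)

lemma projective_point_S2:
  assumes "z \<noteq> 0 \<or> w \<noteq> 0"
  shows "projective_point z w \<in> S2"
proof -
  let ?N = "(norm z)\<^sup>2 + w\<^sup>2"
  note N = projective_point_denominator[OF assms]
  have "(norm (fst (projective_point z w)))\<^sup>2 + (snd (projective_point z w))\<^sup>2
      = (4 * w\<^sup>2 * (norm z)\<^sup>2 + (w\<^sup>2 - (norm z)\<^sup>2)\<^sup>2) / ?N\<^sup>2"
    by (simp add: projective_point_def power_mult_distrib power_divide add_divide_distrib)
  also have "4 * w\<^sup>2 * (norm z)\<^sup>2 + (w\<^sup>2 - (norm z)\<^sup>2)\<^sup>2 = ?N\<^sup>2"
    by (simp add: power2_eq_square algebra_simps)
  finally show ?thesis using N unfolding mem_S2 by (simp only: divide_self_if power_eq_0_iff) auto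
qed

lemma projective_point_bottom: "z \<noteq> 0 \<Longrightarrow> projective_point z 0 = (0, - 1)"
  by (simp add: projective_point_def)

lemma projective_point_top:
  assumes "z \<noteq> 0 \<or> w \<noteq> 0" 
  shows "projective_point z w = (0, 1) \<longleftrightarrow> z = 0"
proof
  assume "projective_point z w = (0, 1)"
  then have "(w\<^sup>2 - (norm z)\<^sup>2) / ((norm z)\<^sup>2 + w\<^sup>2) = 1" by (simp add: projective_point_def)
  then have "w\<^sup>2 - (norm z)\<^sup>2 = (norm z)\<^sup>2 + w\<^sup>2"
    using projective_point_denominator[OF assms] by (simp add: field_simps)
  then show "z = 0" by simp
qed (use assms in \<open>simp add: projective_point_def\<close>)

lemma projective_point_rotate:
  "norm u = 1 \<Longrightarrow> projective_point (u * z) w = (u * fst (projective_point z w), snd (projective_point z w))"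
  by (simp add: projective_point_def norm_mult)

lemma continuous_on_projective_point:
  assumes "continuous_on A f" "continuous_on A g" "\<And>x. x \<in> A \<Longrightarrow> f x \<noteq> 0 \<or> g x \<noteq> 0"
  shows "continuous_on A (\<lambda>x. projective_point (f x) (g x))"
proof -
  have "(norm (f x))\<^sup>2 + (g x)\<^sup>2 \<noteq> 0" if "x \<in> A" for x
    using assms(3)[OF that] by auto
  then show ?thesis
    unfolding projective_point_def by (intro continuous_intros assms(1,2)) auto
qed

section \<open>The cylinder and its covering of S1 x S2\<close>

text \<open>Stereographic projection from the south pole in the sphere factor. The shift puts the
  origin at height 3/2 over the north pole, the point at which the local degree is taken.\<close>

lemma cylinder_chart:
  shows "openin (top_of_set ((UNIV :: real set) \<times> S2)) {y \<in> UNIV \<times> S2. - 1 < snd (snd y)}" (is "openin _ ?V")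
    and "homeomorphism UNIV {y \<in> (UNIV :: real set) \<times> S2. - 1 < snd (snd y)}
       (\<lambda>q. (snd q + 3 / 2, projective_point (fst q) 1)) (\<lambda>y. (fst (snd y) /\<^sub>R (1 + snd (snd y)), fst y - 3 / 2))"
      (is "homeomorphism _ _ ?\<phi> ?\<psi>")
proof -
  have "open {y :: real \<times> complex \<times> real. - 1 < snd (snd y)}"
    by (intro open_Collect_less continuous_intros)
  moreover have "?V = (UNIV \<times> S2) \<inter> {y. - 1 < snd (snd y)}" by auto
  ultimately show "openin (top_of_set ((UNIV :: real set) \<times> S2)) ?V" using openin_open_Int by simp
  show "homeomorphism UNIV ?V ?\<phi> ?\<psi>"
  proof (rule homeomorphismI)
    show "continuous_on UNIV ?\<phi>" by (intro continuous_intros continuous_on_projective_point) auto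
    show "continuous_on ?V ?\<psi>" by (intro continuous_intros) auto
    have pos: "1 + snd (projective_point z 1) = 2 / ((norm z)\<^sup>2 + 1)" for z :: complex
      using projective_point_denominator[of z 1] by (simp add: projective_point_def field_simps)
    have gt: "- 1 < snd (projective_point z 1)" for z
    proof -
      have "0 < 1 + snd (projective_point z 1)"
        unfolding pos using projective_point_denominator[of z 1] by simp
      then show ?thesis by linarith
    qed
    show "?\<phi> ` UNIV \<subseteq> ?V"
    proof (rule image_subsetI)
      fix q :: "complex \<times> real"
      have "projective_point (fst q) 1 \<in> S2" by (rule projective_point_S2) simp
      then show "?\<phi> q \<in> ?V" using gt by simp
    qed
    show "?\<psi> ` ?V \<subseteq> UNIV" by simp
    show "?\<psi> (?\<phi> q) = q" for q
    proof -
      define N where "N = (norm (fst q))\<^sup>2 + 1"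
      have N: "0 < N" using projective_point_denominator[of "fst q" 1] by (simp add: N_def)
      have "fst (projective_point (fst q) 1) = (2 / N) *\<^sub>R fst q" "1 + snd (projective_point (fst q) 1) = 2 / N"
        unfolding pos N_def by (simp_all add: projective_point_def)
      then show ?thesis using N by (simp add: prod_eq_iff)
    qed
    show "?\<phi> (?\<psi> y) = y" if "y \<in> ?V" for y
    proof -
      obtain h z \<rho> where y: "y = (h, z, \<rho>)" by (cases y)
      have r: "0 < 1 + \<rho>" and n: "(norm z)\<^sup>2 = (1 - \<rho>) * (1 + \<rho>)"
        using that mem_S2[of "(z, \<rho>)"] unfolding y by (simp_all add: power2_eq_square algebra_simps)
      have "(norm (z /\<^sub>R (1 + \<rho>)))\<^sup>2 = (norm z)\<^sup>2 / ((1 + \<rho>) * (1 + \<rho>))"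
        using r by (simp add: power_mult_distrib power2_eq_square field_simps)
      also have "\<dots> = (1 - \<rho>) / (1 + \<rho>)" unfolding n using r by simp
      finally have w: "(norm (z /\<^sub>R (1 + \<rho>)))\<^sup>2 = (1 - \<rho>) / (1 + \<rho>)" .
      have d: "(1 - \<rho>) / (1 + \<rho>) + 1\<^sup>2 = 2 / (1 + \<rho>)" "1\<^sup>2 - (1 - \<rho>) / (1 + \<rho>) = 2 * \<rho> / (1 + \<rho>)"
        using r by (simp_all add: field_simps)
      have c: "2 * 1 / (2 / k) * inverse k = 1" "2 * \<rho> / k / (2 / k) = \<rho>" if "0 < k" for k using that by simp_all
      have "projective_point (z /\<^sub>R (1 + \<rho>)) 1 = (z, \<rho>)"
        unfolding projective_point_def w d scaleR_scaleR c[OF r] by simp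
      then show ?thesis unfolding y by simp
    qed
  qed
qed

text \<open>The covering of \<open>S\<^sup>1 \<times> S\<^sup>2\<close> by the cylinder, twisted by a rotation of order three so that the top and
  the bottom face of the simplex of local degree one project to the same simplex.\<close>

definition wind :: "real \<times> complex \<times> real \<Rightarrow> complex \<times> complex \<times> real" where
  "wind y = (cis (2 * pi * fst y), cis (- (2 * pi / 3) * fst y) * fst (snd y), snd (snd y))"

lemma wind_mem: "y \<in> UNIV \<times> S2 \<Longrightarrow> wind y \<in> S1 \<times> S2"
  using mem_S2[of "snd y"] mem_S2[of "snd (wind y)"] by (auto simp: wind_def norm_mult)

lemma continuous_on_wind: "continuous_on A wind"
  unfolding wind_def by (intro continuous_intros)

lemma eis_cis: "eis 0 1 = cis (2 * pi / 3)"
  by (simp add: eis_def complex_eq_iff cos_120 sin_120)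

lemma wind_shift: "wind (h + 1, eis 0 1 * \<zeta>, \<rho>) = wind (h, \<zeta>, \<rho>)"
proof -
  have "cis (2 * pi * (h + 1)) = cis (2 * pi * h)"
    by (simp add: distrib_left cis_mult[symmetric])
  moreover have "cis (- (2 * pi / 3) * (h + 1)) * (cis (2 * pi / 3) * \<zeta>) = cis (- (2 * pi / 3) * h) * \<zeta>"
  proof -
    have "- (2 * pi / 3) * (h + 1) + 2 * pi / 3 = - (2 * pi / 3) * h" by (simp add: distrib_left)
    then show ?thesis by (simp only: mult.assoc[symmetric] cis_mult)
  qed
  ultimately show ?thesis by (simp only: wind_def eis_cis fst_conv snd_conv)
qed

text \<open>The slab of heights between 1 and 2 is one sheet over the circle without 1. The argument
  in the open interval from 0 to 2 pi recovers the height, and the height tells how much twist to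
  undo.\<close>

lemma wind_local_homeomorphism:
  shows "openin (top_of_set ((UNIV :: real set) \<times> S2)) {y \<in> UNIV \<times> S2. 1 < fst y \<and> fst y < 2}" (is "openin _ ?U")
    and "openin (top_of_set (S1 \<times> S2)) {x \<in> S1 \<times> S2. fst x \<noteq> 1}" (is "openin _ ?V")
    and "\<exists>r. homeomorphism {y \<in> (UNIV :: real set) \<times> S2. 1 < fst y \<and> fst y < 2} {x \<in> S1 \<times> S2. fst x \<noteq> 1} wind r"
proof -
  have "open ({y :: real \<times> complex \<times> real. 1 < fst y} \<inter> {y. fst y < 2})"
    by (intro open_Int open_Collect_less continuous_intros)
  moreover have "?U = (UNIV \<times> S2) \<inter> ({y. 1 < fst y} \<inter> {y. fst y < 2})" by auto
  ultimately show "openin (top_of_set ((UNIV :: real set) \<times> S2)) ?U" using openin_open_Int by simp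
  have "open {x :: complex \<times> complex \<times> real. fst x \<noteq> 1}"
    by (intro open_Collect_neq continuous_intros)
  moreover have "?V = (S1 \<times> S2) \<inter> {x. fst x \<noteq> 1}" by auto
  ultimately show "openin (top_of_set (S1 \<times> S2)) ?V" using openin_open_Int by simp
  let ?h = "\<lambda>x :: complex \<times> complex \<times> real. 1 + Arg2pi (fst x) / (2 * pi)"
  let ?r = "\<lambda>x. (?h x, cis (2 * pi / 3 * ?h x) * fst (snd x), snd (snd x))"
  have nr: "fst x \<notin> \<real>\<^sub>\<ge>\<^sub>0" if "x \<in> ?V" for x
  proof
    assume "fst x \<in> \<real>\<^sub>\<ge>\<^sub>0"
    then obtain a where "fst x = of_real a" "0 \<le> a" by (rule nonneg_Reals_cases)
    then show False using that by auto
  qed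
  have Arg: "0 < Arg2pi (fst x)" "Arg2pi (fst x) < 2 * pi" "cis (Arg2pi (fst x)) = fst x" if "x \<in> ?V" for x
  proof -
    have "fst x \<notin> \<real> \<or> Re (fst x) < 0" using nr[OF that] by (auto simp: complex_nonneg_Reals_iff complex_is_Real_iff)
    then have "Arg2pi (fst x) \<noteq> 0" unfolding Arg2pi_eq_0 by auto
    then show "0 < Arg2pi (fst x)" "Arg2pi (fst x) < 2 * pi" using Arg2pi[of "fst x"] by auto
    show "cis (Arg2pi (fst x)) = fst x"
      using that complex_norm_eq_1_exp[of "fst x"] by (auto simp: cis_conv_exp)
  qed
  have "homeomorphism ?U ?V wind ?r"
  proof (rule homeomorphismI)
    show "continuous_on ?U wind" by (rule continuous_on_wind)
    have "continuous_on ?V (\<lambda>x. Arg2pi (fst x))"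
    proof (rule continuous_on_compose2[of "fst ` ?V" Arg2pi])
      show "continuous_on (fst ` ?V) Arg2pi"
        using nr continuous_at_Arg2pi by (intro continuous_at_imp_continuous_on) blast
    qed (auto intro: continuous_intros)
    then show "continuous_on ?V ?r" by (intro continuous_intros) auto
    have Arg_cis: "Arg2pi (cis (2 * pi * h)) = 2 * pi * (h - 1)" if "1 < h" "h < 2" for h
    proof (rule Arg2pi_unique[of 1])
      have "cis (2 * pi * (h - 1)) = cis (2 * pi * h)" by (simp add: right_diff_distrib cis_divide[symmetric])
      then show "complex_of_real 1 * exp (\<i> * complex_of_real (2 * pi * (h - 1))) = cis (2 * pi * h)"
        by (simp only: cis_conv_exp of_real_1 mult_1)
      show "0 \<le> 2 * pi * (h - 1)" using that by simp
      have "2 * pi * (h - 1) < 2 * pi * 1" using that by (intro mult_strict_left_mono) auto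
      then show "2 * pi * (h - 1) < 2 * pi" by simp
    qed simp
    show "wind ` ?U \<subseteq> ?V"
    proof (rule image_subsetI)
      fix y assume y: "y \<in> ?U"
      then have "Arg2pi (fst (wind y)) = 2 * pi * (fst y - 1)" by (simp add: wind_def Arg_cis)
      moreover have "0 < 2 * pi * (fst y - 1)" using y by simp
      ultimately have "fst (wind y) \<noteq> 1" using Arg2pi_of_real[of 1] by auto
      then show "wind y \<in> ?V" using wind_mem[of y] y by blast
    qed
    show "?r ` ?V \<subseteq> ?U"
    proof (rule image_subsetI)
      fix x assume x: "x \<in> ?V"
      have "0 < Arg2pi (fst x) / (2 * pi)" "Arg2pi (fst x) / (2 * pi) < 1" using Arg[OF x] by (simp_all add: field_simps)
      moreover have "snd (?r x) \<in> S2"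
      proof -
        have "snd x \<in> S2" using x by auto
        then show ?thesis unfolding mem_S2 by (simp add: norm_mult)
      qed
      ultimately show "?r x \<in> ?U" by simp
    qed
    have cc: "cis (2 * pi / 3 * h) * (cis (- (2 * pi / 3) * h) * z) = z" "cis (- (2 * pi / 3) * h) * (cis (2 * pi / 3 * h) * z) = z" for h z
      by (simp_all add: mult.assoc[symmetric] cis_mult)
    show "?r (wind y) = y" if "y \<in> ?U" for y
    proof -
      have "?h (wind y) = fst y" using that by (simp add: wind_def Arg_cis)
      then show ?thesis by (simp only: wind_def fst_conv snd_conv cc prod.collapse)
    qed
    show "wind (?r x) = x" if "x \<in> ?V" for x
    proof -
      have "2 * pi * ?h x = 2 * pi + Arg2pi (fst x)" by (simp add: field_simps)
      then have "cis (2 * pi * ?h x) = fst x" using Arg(3)[OF that] by (simp add: cis_mult[symmetric])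
      then show ?thesis by (simp only: wind_def fst_conv snd_conv cc prod.collapse)
    qed
  qed
  then show "\<exists>r. homeomorphism ?U ?V wind r" by blast
qed

lemma closed_connected_manifold_S1_S2: "closed_connected_manifold 3 (top_of_set (S1 \<times> S2))"
proof -
  let ?X = "top_of_set (S1 \<times> S2)"
  let ?y = "(3 / 2, (0, 1)) :: real \<times> complex \<times> real"
  obtain r where h: "homeomorphism {y \<in> UNIV \<times> S2. 1 < fst y \<and> fst y < 2} {x \<in> S1 \<times> S2. fst x \<noteq> 1} wind r"
    using wind_local_homeomorphism(3) by blast
  have "euclidean_chart 3 ?X (wind ?y)"
    by (rule euclidean_chart_local_homeomorphism[OF cylinder_chart wind_local_homeomorphism(1,2) h]) (simp_all add: mem_S2)
  moreover have "wind ?y \<in> topspace ?X" using wind_mem[of ?y] by (simp add: mem_S2)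
  ultimately have chart: "euclidean_chart 3 ?X x" if "x \<in> topspace ?X" for x
    by (intro euclidean_chart_homogeneous[OF isotopic_S1_S2 _ _ _ that, of "wind ?y"]) (simp_all add: mem_S2)
  show ?thesis
  proof (rule closed_connected_manifold_top_of_set)
    show "connected (S1 \<times> S2)"
      by (intro connected_Times path_connected_imp_connected path_connected_sphere) simp_all
    have "(1, 0, 1) \<in> S1 \<times> S2" by (simp add: mem_S2)
    then show "S1 \<times> S2 \<noteq> {}" by blast
  qed (use chart in \<open>simp_all add: compact_Times\<close>)
qed

section \<open>The two simplices for S1 x S2\<close>

text \<open>Linear, with the vertices going to -1, \<open>- eis 0 1\<close>, minus the square of
  \<open>eis 0 1\<close>, and -1. Passing from face 3 to face 0 advances each vertex by one, which
  is multiplication by \<open>eis 0 1\<close>.\<close>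

definition zeta :: "(nat \<Rightarrow> real) \<Rightarrow> complex" where
  "zeta t = eis (t 2 - t 0 - t 3) (t 2 - t 1)"

text \<open>As second homogeneous coordinate it is positive at the zeros of \<open>zeta\<close>, the
  same on faces 0 and 3, and zero on faces 1 and 2, which are thereby sent to the south
  pole.\<close>

definition bump :: "(nat \<Rightarrow> real) \<Rightarrow> real" where
  "bump t = t 1 * t 2 * (t 0 + t 3)"

text \<open>Vertex \<open>i\<close> is at height \<open>i\<close>, so face 0 lies one unit above
  face 3, which is the period in \<open>wind_shift\<close>.\<close>

definition height :: "(nat \<Rightarrow> real) \<Rightarrow> real" where
  "height t = t 1 + 2 * t 2 + 3 * t 3"

lemma zeta_eq_0:
  assumes "t \<in> standard_simplex 3" "zeta t = 0"
  shows "t 1 = 1 / 3" "t 2 = 1 / 3" "t 0 + t 3 = 1 / 3"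
  using assms(2) standard_simplex_3D[OF assms(1)] by (simp_all add: zeta_def eis_eq_0)

text \<open>At a zero of \<open>zeta\<close> the value of \<open>bump\<close> is 1/27, and every
  convex combination of it with 1 is positive.\<close>

lemma zeta_or_bump:
  assumes t: "t \<in> standard_simplex 3" and s: "0 \<le> s" "s \<le> 1"
  shows "zeta t \<noteq> 0 \<or> (1 - s) + s * bump t \<noteq> 0"
proof (cases "zeta t = 0")
  case True
  have b: "bump t = 1 / 27" unfolding bump_def zeta_eq_0[OF t True] by simp
  have "(1 - s) + s * bump t = 1 - 26 / 27 * s" unfolding b by (simp add: field_simps)
  then have "0 < (1 - s) + s * bump t" using s by linarith
  then show ?thesis by simp
qed simp

lemma continuous_on_zeta: "continuous_on A zeta" and continuous_on_bump: "continuous_on A bump"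
  and continuous_on_height: "continuous_on A height"
  unfolding zeta_def bump_def height_def by (intro continuous_intros continuous_on_coordinate)+

text \<open>Replacing \<open>bump\<close> by 1 turns the simplex into the chart image of
  \<open>(zeta t, height t - 3 / 2)\<close>, an affine map that can be compared with
  \<open>reference_map\<close>. During the replacement the north pole is attained exactly at the
  zeros of \<open>zeta\<close>, and frontier points at height 3/2 have
  \<open>zeta t \<noteq> 0\<close>.\<close>

lemma homology_generator_cylinder:
  "homology_generator 3 (top_of_set (UNIV \<times> S2)) (UNIV \<times> S2 - {(3 / 2, (0, 1))})
     (frag_of (restrict (\<lambda>t. (height t, projective_point (zeta t) (bump t))) (standard_simplex 3)))"
proof -
  let ?D = "standard_simplex 3" and ?F = "simplex_frontier 3"
  let ?S = "(UNIV :: real set) \<times> S2"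
  let ?\<phi> = "\<lambda>q :: complex \<times> real. (snd q + 3 / 2, projective_point (fst q) 1)"
  let ?f = "\<lambda>t. (zeta t, height t - 3 / 2)"
  have FD: "?F \<subseteq> ?D" by (auto simp: simplex_frontier_def)
  have \<phi>0: "?\<phi> 0 = (3 / 2, (0, 1))" by (simp add: projective_point_def)
  have ne: "(1 - s) *\<^sub>R ?f t + s *\<^sub>R reference_map t \<noteq> 0" if t: "t \<in> ?F" and s: "0 \<le> s" "s \<le> 1" for t s
  proof
    note tD = simplex_frontier_3D(1)[OF t]
    note T = standard_simplex_3D[OF tD]
    assume e: "(1 - s) *\<^sub>R ?f t + s *\<^sub>R reference_map t = 0"
    have re: "(1 - s) * Re (zeta t) + s * (t 1 + t 2 - t 0 - t 3) = 0"
      using arg_cong[OF e, of "\<lambda>z. Re (fst z)"] by (simp add: reference_map_def)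
    have im: "(1 - s) * Im (zeta t) + s * (t 2 - t 1) = 0"
      using arg_cong[OF e, of "\<lambda>z. Im (fst z)"] by (simp add: reference_map_def)
    have th: "(1 - s) * (height t - 3 / 2) + s * (t 3 - t 0) = 0"
      using arg_cong[OF e, of snd] by (simp add: reference_map_def)
    have fac: "(1 - s) * (k * y) + s * y = y * ((1 - s) * k + s)" for k y by (simp add: algebra_simps)
    have nz: "(1 - s) * k + s \<noteq> 0" if "0 < k" for k
    proof (cases "s = 0")
      case False
      have "0 \<le> (1 - s) * k" using s that by simp
      then show ?thesis using False s by linarith
    qed (use that in simp)
    have "(t 2 - t 1) * ((1 - s) * (sqrt 3 / 2) + s) = 0"
      using im unfolding zeta_def eis_sel fac .
    then have t12: "t 1 = t 2" using nz[of "sqrt 3 / 2"] by simp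
    \<comment> \<open>The constant is written as 3/2 times the sum of the barycentric
      coordinates.\<close>
    have "height t - 3 / 2 = 3 / 2 * (t 3 - t 0)"
      using T(5) unfolding height_def t12 by simp
    then have "(t 3 - t 0) * ((1 - s) * (3 / 2) + s) = 0" using th by (simp only: fac)
    then have t03: "t 3 = t 0" using nz[of "3 / 2"] by simp
    have half: "t 2 = 1 / 2 - t 0" using T(5) t12 t03 by simp
    \<comment> \<open>On the frontier only the midpoints of two opposite edges are left. The real
      parts of \<open>zeta\<close> and \<open>reference_map\<close> there are 1/2 and 1, or -1 and
      -1.\<close>
    have "t 0 = 0 \<or> t 0 = 1 / 2" using simplex_frontier_3D(2)[OF t] t12 t03 half by auto
    then show False
    proof
      assume t0: "t 0 = 0"
      have "(1 - s) * (1 / 2) + s = 0"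
        using re unfolding zeta_def eis_sel t12 t03 half t0 by simp
      then show False using nz[of "1 / 2"] by simp
    next
      assume t0: "t 0 = 1 / 2"
      have "(1 - s) * (- 1) - s = 0"
        using re unfolding zeta_def eis_sel t12 t03 half t0 by simp
      then show False by simp
    qed
  qed
  let ?H = "\<lambda>z. (height (snd z), projective_point (zeta (snd z)) ((1 - fst z) + fst z * bump (snd z)))"
  have c: "continuous_on ({0..1::real} \<times> ?D) (\<lambda>z. zeta (snd z))" "continuous_on ({0..1::real} \<times> ?D) (\<lambda>z. bump (snd z))"
    "continuous_on ({0..1::real} \<times> ?D) (\<lambda>z. height (snd z))"
    by (rule continuous_on_compose2[OF _ continuous_on_snd[OF continuous_on_id]],
        rule continuous_on_zeta continuous_on_bump continuous_on_height, rule subset_UNIV)+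
  have "homotopic_with (\<lambda>h. h \<in> ?F \<rightarrow> ?S - {?\<phi> 0}) (top_of_set ?D) (top_of_set ?S)
     (?\<phi> \<circ> ?f) (\<lambda>t. (height t, projective_point (zeta t) (bump t)))"
    unfolding homotopic_with_def
  proof (intro exI conjI ballI allI)
    show "continuous_map (prod_topology (top_of_set {0..1}) (top_of_set ?D)) (top_of_set ?S) ?H"
      unfolding prod_topology_top_of_set
    proof (rule continuous_map_top_of_setI)
      show "continuous_on ({0..1} \<times> ?D) ?H"
        by (intro continuous_on_Pair continuous_on_projective_point continuous_intros c) (use zeta_or_bump in auto)
      show "?H z \<in> ?S" if "z \<in> {0..1} \<times> ?D" for z
      proof -
        have "zeta (snd z) \<noteq> 0 \<or> (1 - fst z) + fst z * bump (snd z) \<noteq> 0"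
          by (rule zeta_or_bump) (use that in auto)
        then show ?thesis using projective_point_S2 by blast
      qed
    qed
    show "(\<lambda>x. ?H (s, x)) \<in> ?F \<rightarrow> ?S - {?\<phi> 0}" if s: "s \<in> {0..1}" for s
    proof
      fix t assume t: "t \<in> ?F"
      then have tD: "t \<in> ?D" using FD by blast
      have n: "zeta t \<noteq> 0 \<or> (1 - s) + s * bump t \<noteq> 0"
        by (rule zeta_or_bump[OF tD]) (use s in auto)
      have "?H (s, t) \<noteq> (3 / 2, (0, 1))"
      proof
        assume "?H (s, t) = (3 / 2, (0, 1))"
        then have "height t = 3 / 2" "projective_point (zeta t) ((1 - s) + s * bump t) = (0, 1)"
          by (simp_all only: fst_conv snd_conv prod.inject)
        then have "height t = 3 / 2" "zeta t = 0" using projective_point_top[OF n] by blast+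
        then show False using ne[OF t, of 0] by (simp add: zero_prod_def)
      qed
      moreover have "projective_point (zeta t) ((1 - s) + s * bump t) \<in> S2"
        by (rule projective_point_S2[OF n])
      ultimately show "?H (s, t) \<in> ?S - {?\<phi> 0}" unfolding \<phi>0 fst_conv snd_conv by blast
    qed
  qed simp_all
  moreover have "continuous_on ?D ?f"
    by (intro continuous_on_Pair continuous_on_zeta continuous_intros continuous_on_height)
  ultimately have "homology_generator 3 (top_of_set ?S) (?S - {?\<phi> 0})
     (frag_of (restrict (\<lambda>t. (height t, projective_point (zeta t) (bump t))) ?D))"
    by (intro homology_generator_chart[OF cylinder_chart _ ne])
  then show ?thesis unfolding \<phi>0 .
qed

lemma height_face:
  assumes "t \<in> standard_simplex 2"
  shows "height (simplical_face 0 t) = height (simplical_face 3 t) + 1"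
  using standard_simplex_2D(4)[OF assms] by (simp add: height_def simplical_face_3[unfolded One_nat_def] simplical_face_3)

lemma zeta_face: "zeta (simplical_face 0 t) = eis 0 1 * zeta (simplical_face 3 t)"
  by (simp add: zeta_def simplical_face_3[unfolded One_nat_def] simplical_face_3 eis_mult)

lemma bump_face: "bump (simplical_face 0 t) = bump (simplical_face 3 t)" "bump (simplical_face 1 t) = 0" "bump (simplical_face 2 t) = 0"
  by (simp_all add: bump_def simplical_face_3[unfolded One_nat_def] simplical_face_3)

lemma simplical_face_mem:
  assumes "t \<in> standard_simplex 2" "k \<le> 3"
  shows "simplical_face k t \<in> standard_simplex 3"
  using simplical_face_in_standard_simplex[of 3 k t] assms by simp

lemma volume_two_S1_S2: "volume_two (top_of_set (S1 \<times> S2))"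
proof -
  let ?D = "standard_simplex 3" and ?X = "top_of_set (S1 \<times> S2)" and ?Y = "(UNIV :: real set) \<times> S2"
  let ?f = "\<lambda>t. (height t, projective_point (zeta t) (bump t))" and ?g = "\<lambda>t. (height t, (0, - 1)) :: real \<times> complex \<times> real"
  let ?\<tau> = "restrict ?f ?D" and ?\<sigma> = "restrict ?g ?D"
  let ?y = "(3 / 2, (0, 1)) :: real \<times> complex \<times> real"
  let ?c = "frag_of (simplex_map 3 wind ?\<tau>) + frag_cmul (- 1) (frag_of (simplex_map 3 wind ?\<sigma>))"
  have cw: "continuous_map (top_of_set ?Y) ?X wind"
    by (rule continuous_map_top_of_setI[OF continuous_on_wind wind_mem])
  have nz: "zeta t \<noteq> 0 \<or> bump t \<noteq> 0" if "t \<in> ?D" for t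
    using zeta_or_bump[OF that, of 1] by simp
  have \<tau>: "singular_simplex 3 (top_of_set ?Y) ?\<tau>"
  proof -
    have "continuous_on ?D ?f"
      by (intro continuous_on_Pair continuous_on_projective_point continuous_on_zeta continuous_on_bump continuous_on_height nz)
    moreover have "?f t \<in> ?Y" if "t \<in> ?D" for t using projective_point_S2[OF nz[OF that]] by blast
    ultimately show ?thesis unfolding singular_simplex_top_of_set by (auto cong: continuous_on_cong)
  qed
  have \<sigma>: "singular_simplex 3 (top_of_set ?Y) ?\<sigma>"
  proof -
    have "continuous_on ?D ?g" by (intro continuous_on_Pair continuous_on_height continuous_on_const)
    moreover have "?g t \<in> ?Y" for t by (simp add: mem_S2)
    ultimately show ?thesis unfolding singular_simplex_top_of_set by (auto cong: continuous_on_cong)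
  qed
  have wface: "singular_face 3 k (simplex_map 3 wind (restrict h ?D)) = restrict (\<lambda>t. wind (h (simplical_face k t))) (standard_simplex 2)"
    if "k \<le> 3" for h k
  proof -
    have "simplex_map 3 wind (restrict h ?D) = restrict (\<lambda>t. wind (h t)) ?D"
      by (auto simp: simplex_map_def restrict_def)
    then show ?thesis by (simp only: singular_face_3_restrict[OF that])
  qed
  have top: "singular_face 3 0 (simplex_map 3 wind ?\<tau>) = singular_face 3 3 (simplex_map 3 wind ?\<tau>)"
    "singular_face 3 0 (simplex_map 3 wind ?\<sigma>) = singular_face 3 3 (simplex_map 3 wind ?\<sigma>)"
  proof -
    have "wind (?f (simplical_face 0 t)) = wind (?f (simplical_face 3 t))" if t: "t \<in> standard_simplex 2" for t
    proof -
      have "?f (simplical_face 0 t) = (height (simplical_face 3 t) + 1,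
          eis 0 1 * fst (projective_point (zeta (simplical_face 3 t)) (bump (simplical_face 3 t))),
          snd (projective_point (zeta (simplical_face 3 t)) (bump (simplical_face 3 t))))"
        by (simp only: height_face[OF t] zeta_face bump_face projective_point_rotate[OF norm_eis(1)])
      then show ?thesis by (simp only: wind_shift prod.collapse)
    qed
    then show "singular_face 3 0 (simplex_map 3 wind ?\<tau>) = singular_face 3 3 (simplex_map 3 wind ?\<tau>)"
      unfolding wface[OF le0] wface[OF order_refl] by (rule restrict_ext)
    have "wind (?g (simplical_face 0 t)) = wind (?g (simplical_face 3 t))" if t: "t \<in> standard_simplex 2" for t
      using wind_shift[of "height (simplical_face 3 t)" 0 "- 1"] by (simp only: height_face[OF t] mult_zero_right)
    then show "singular_face 3 0 (simplex_map 3 wind ?\<sigma>) = singular_face 3 3 (simplex_map 3 wind ?\<sigma>)"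
      unfolding wface[OF le0] wface[OF order_refl] by (rule restrict_ext)
  qed
  \<comment> \<open>On these two faces \<open>bump\<close> is zero, which puts \<tau> at the south
    pole, where all of \<sigma> lives. The heights agree, so the faces cancel in the difference;
    this is why the coefficient of \<sigma> in \<open>?c\<close> is -1.\<close>
  have side: "singular_face 3 k (simplex_map 3 wind ?\<tau>) = singular_face 3 k (simplex_map 3 wind ?\<sigma>)" if k: "k = 1 \<or> k = 2" for k
  proof -
    have k3: "k \<le> 3" using k by auto
    have "?f (simplical_face k t) = ?g (simplical_face k t)" if t: "t \<in> standard_simplex 2" for t
    proof -
      have b: "bump (simplical_face k t) = 0" using k bump_face by blast
      then have "zeta (simplical_face k t) \<noteq> 0" using nz[OF simplical_face_mem[OF t k3]] by simp
      then show ?thesis unfolding b by (simp add: projective_point_bottom)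
    qed
    from restrict_ext[OF arg_cong[OF this, of _ wind]]
    show ?thesis unfolding wface[OF k3] .
  qed
  have wX: "singular_simplex 3 ?X (simplex_map 3 wind ?\<tau>)" "singular_simplex 3 ?X (simplex_map 3 wind ?\<sigma>)"
    by (rule singular_simplex_simplex_map[OF \<tau> cw], rule singular_simplex_simplex_map[OF \<sigma> cw])
  have cyc: "singular_relcycle 3 ?X {} ?c"
  proof -
    have "chain_boundary 3 ?c = 0"
      unfolding chain_boundary_add chain_boundary_cmul chain_boundary_3 top side[OF disjI1[OF refl]] side[OF disjI2[OF refl]]
      by (rule poly_mapping_eqI) (simp add: lookup_minus lookup_add)
    moreover have "singular_chain 3 ?X ?c"
      by (intro singular_chain_add singular_chain_cmul) (simp_all add: singular_chain_of wX)
    ultimately show ?thesis unfolding singular_cycle by blast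
  qed
  have yX: "wind ?y \<in> S1 \<times> S2" by (rule wind_mem) (simp add: mem_S2)
  have wy: "wind ?y = (- 1, (0, 1))"
  proof -
    have "cis (2 * pi * (3 / 2)) = cis (2 * pi + pi)" by (rule arg_cong[of _ _ cis]) simp
    also have "\<dots> = - 1" by (simp only: cis_mult[symmetric] cis_2pi cis_pi mult_1)
    finally show ?thesis by (simp only: wind_def fst_conv snd_conv mult_zero_right)
  qed
  have gen: "homology_generator 3 ?X (topspace ?X - {wind ?y}) (frag_of (simplex_map 3 wind ?\<tau>))"
  proof -
    obtain r where h: "homeomorphism {y \<in> ?Y. 1 < fst y \<and> fst y < 2} {x \<in> S1 \<times> S2. fst x \<noteq> 1} wind r"
      using wind_local_homeomorphism(3) by blast
    have "homology_generator 3 ?X (S1 \<times> S2 - {wind ?y}) (frag_of (simplex_map 3 wind ?\<tau>))"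
    proof (rule homology_generator_local_homeomorphism[OF continuous_on_wind _ wind_local_homeomorphism(1) _ wind_local_homeomorphism(2) h homology_generator_cylinder])
      show "wind ` ?Y \<subseteq> S1 \<times> S2" using wind_mem by blast
      show "?y \<in> {y \<in> ?Y. 1 < fst y \<and> fst y < 2}" by (simp add: mem_S2)
      fix t assume t: "t \<in> ?D" and "wind (?\<tau> t) = wind ?y"
      then have e: "wind (?f t) = (- 1, (0, 1))" unfolding wy by simp
      then have c1: "cis (2 * pi * height t) = - 1"
        and p: "cis (- (2 * pi / 3) * height t) * fst (projective_point (zeta t) (bump t)) = 0"
          "snd (projective_point (zeta t) (bump t)) = 1"
        by (simp_all only: wind_def fst_conv snd_conv prod.inject)
      have "projective_point (zeta t) (bump t) = (0, 1)" using p by (simp add: prod_eq_iff)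
      moreover from this have z: "zeta t = 0" using projective_point_top[OF nz[OF t]] by blast
      \<comment> \<open>A hit is a zero of \<open>zeta\<close>, so its height is
        \<open>1 + 3 * t 3\<close> and lies between 1 and 2. The circle coordinate -1 makes the
        height half an odd integer, which leaves 3/2 only.\<close>
      moreover have "height t = 3 / 2"
      proof -
        have h3: "height t = 1 + 3 * t 3" unfolding height_def zeta_eq_0[OF t z] by simp
        then have b: "1 \<le> height t" "height t \<le> 2" using zeta_eq_0(3)[OF t z] standard_simplex_3D[OF t] by linarith+
        have "cis (2 * pi * height t - 3 * pi) = cis (2 * pi * height t) * cis (- (2 * pi) - pi)"
          by (simp only: cis_mult) (rule arg_cong[of _ _ cis], simp)
        also have "\<dots> = 1" unfolding c1 by (simp add: complex_eq_iff)
        finally have "cos (2 * pi * height t - 3 * pi) = 1" by (metis cis.simps(1) one_complex.simps(1))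
        then obtain m :: int where "2 * pi * height t - 3 * pi = real_of_int m * 2 * pi" unfolding cos_one_2pi_int by blast
        then have "pi * (2 * height t - 3) = pi * (2 * real_of_int m)" by (simp add: algebra_simps)
        then have m: "2 * height t - 3 = 2 * real_of_int m" by simp
        then have "- 1 \<le> 2 * real_of_int m" "2 * real_of_int m \<le> 1" using b by linarith+
        then have "m = 0" by linarith
        then show ?thesis using m by simp
      qed
      ultimately show "?\<tau> t = ?y" using t by simp
    qed
    then show ?thesis by simp
  qed
  have xgen: "homology_generator 3 ?X (topspace ?X - {wind ?y}) ?c"
  proof -
    have subX: "subtopology ?X (topspace ?X - {wind ?y}) = top_of_set (S1 \<times> S2 - {wind ?y})"
      by (simp add: subtopology_subtopology Int_absorb1)
    have "simplex_map 3 wind ?\<sigma> t \<in> S1 \<times> S2 - {wind ?y}" if t: "t \<in> ?D" for t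
    proof -
      have "simplex_map 3 wind ?\<sigma> t = wind (?g t)" using t by (simp add: simplex_map_def)
      moreover have "wind (?g t) \<in> S1 \<times> S2" by (rule wind_mem) (simp add: mem_S2)
      moreover have "snd (snd (wind (?g t))) \<noteq> snd (snd (wind ?y))" by (simp add: wind_def)
      ultimately show ?thesis by (metis Diff_iff singletonD)
    qed
    then have "singular_chain 3 (subtopology ?X (topspace ?X - {wind ?y})) (frag_cmul (- 1) (frag_of (simplex_map 3 wind ?\<sigma>)))"
      unfolding subX by (intro singular_chain_cmul) (simp only: singular_chain_of singular_simplex_shrink[OF wX(2)])
    from homologous_rel_add_chain[OF this]
    have "homologous_rel 3 ?X (topspace ?X - {wind ?y}) (frag_of (simplex_map 3 wind ?\<tau>)) ?c"
      using homologous_rel_sym by blast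
    then show ?thesis by (rule homology_generator_homologous[OF gen])
  qed
  have allgen: "homology_generator 3 ?X (topspace ?X - {x}) ?c" if "x \<in> topspace ?X" for x
    by (rule homology_generator_homogeneous[OF cyc isotopic_S1_S2 _ _ xgen that]) (use yX in \<open>simp_all add: mem_S2\<close>)
  \<comment> \<open>The simplex is regarded in the punctured plane times S2 and lifted along
    \<open>exp\<close> to a cycle of the plane times S2, where it bounds. Composing with
    \<open>sgn\<close> leads back to S1 x S2 and reproduces the simplex, so it bounds there and the
    multiple 0 serves.\<close>
  have low: "homologous_rel 3 ?X (topspace ?X - {wind ?y}) (frag_of \<rho>) (frag_cmul 0 ?c)"
    if \<rho>: "singular_relcycle 3 ?X {} (frag_of \<rho>)" for \<rho>
  proof -
    let ?e = "\<lambda>z. (exp (fst z), snd z) :: complex \<times> complex \<times> real"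
    let ?s = "\<lambda>z. (sgn (exp (fst z)), snd z) :: complex \<times> complex \<times> real"
    have \<rho>s: "singular_simplex 3 ?X \<rho>" using \<rho> by (simp add: singular_cycle singular_chain_of)
    have "singular_simplex 3 (top_of_set ((- {0}) \<times> S2)) \<rho>"
      using \<rho>s unfolding singular_simplex_top_of_set by (auto simp: Pi_iff mem_Times_iff)
    then have "singular_relcycle 3 (top_of_set ((- {0}) \<times> S2)) {} (frag_of \<rho>)"
      using \<rho> by (simp add: singular_cycle singular_chain_of)
    then obtain r where r: "singular_relcycle 3 (top_of_set (UNIV \<times> S2)) {} (frag_of r)" "simplex_map 3 ?e r = \<rho>"
      using singular_3_simplex_cycle_lift[OF covering_space_Times_id[OF covering_space_exp_punctured_plane]] by blast
    have rs: "singular_simplex 3 (top_of_set (UNIV \<times> S2)) r" using r(1) by (simp add: singular_cycle singular_chain_of)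
    have "simplex_map 3 ?s r t = \<rho> t" for t
    proof (cases "t \<in> ?D")
      case True
      have "\<rho> t \<in> S1 \<times> S2" using \<rho>s True unfolding singular_simplex_top_of_set by blast
      moreover have rt: "\<rho> t = ?e (r t)" using r(2) True by (auto simp: simplex_map_def)
      ultimately have "norm (exp (fst (r t))) = 1" by (simp add: mem_Times_iff)
      then show ?thesis unfolding rt using True by (simp add: simplex_map_def sgn_div_norm)
    next
      case False
      then show ?thesis using r(2) by (auto simp: simplex_map_def)
    qed
    then have rho: "simplex_map 3 ?s r = \<rho>" by blast
    have "continuous_map (top_of_set (UNIV \<times> S2)) ?X ?s"
    proof (rule continuous_map_top_of_setI)
      show "continuous_on (UNIV \<times> S2) ?s" by (intro continuous_intros) auto
      show "?s z \<in> S1 \<times> S2" if "z \<in> UNIV \<times> S2" for z using that by (auto simp: norm_sgn)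
    qed
    then have "singular_relboundary 3 ?X {} (chain_map 3 ?s (frag_of r))"
      by (rule singular_relboundary_chain_map[OF complex_S2_cycle_bounds[OF r(1)]]) simp
    then have "homologous_rel 3 ?X {} (frag_of \<rho>) (frag_cmul 0 ?c)"
      by (simp add: homologous_rel_def chain_map_of rho)
    then show ?thesis by (rule homologous_rel_weaken) simp
  qed
  show ?thesis
    unfolding volume_two_def
  proof (intro conjI exI)
    show "closed_connected_manifold 3 ?X" by (rule closed_connected_manifold_S1_S2)
    show "- 1 = (1::int) \<or> - 1 = (- 1::int)" by simp
    show "singular_relcycle 3 ?X {} ?c" by (rule cyc)
    show "\<forall>x\<in>topspace ?X. homology_generator 3 ?X (topspace ?X - {x}) ?c" using allgen by blast
    show "\<exists>x\<in>topspace ?X. \<forall>\<rho>. singular_relcycle 3 ?X {} (frag_of \<rho>) \<longrightarrow>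
          (\<exists>k. k \<noteq> 1 \<and> k \<noteq> - 1 \<and> homologous_rel 3 ?X (topspace ?X - {x}) (frag_of \<rho>) (frag_cmul k ?c))"
    proof (rule bexI[of _ "wind ?y"], intro allI impI)
      fix \<rho> assume "singular_relcycle 3 ?X {} (frag_of \<rho>)"
      from low[OF this] show "\<exists>k. k \<noteq> 1 \<and> k \<noteq> - 1 \<and> homologous_rel 3 ?X (topspace ?X - {wind ?y}) (frag_of \<rho>) (frag_cmul k ?c)"
        by (intro exI[of _ "0::int"]) simp
    qed (use yX in simp)
  qed simp
qed

section \<open>Comparison with the models\<close>

text \<open>Both \<open>f\<close> and \<open>q\<close> are quotient maps out of \<open>X\<close>
  with the same fibres, hence each factors through the other. For \<open>f\<close> this is because a
  continuous map from a compact to a Hausdorff space is closed.\<close>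

lemma quotient_topology_homeomorphic:
  assumes X: "compact_space X" and Y: "Hausdorff_space Y" and f: "continuous_map X Y f" "f ` topspace X = topspace Y"
    and fib: "\<And>x y. \<lbrakk>x \<in> topspace X; y \<in> topspace X\<rbrakk> \<Longrightarrow> f x = f y \<longleftrightarrow> q x = q y"
  shows "quotient_topology X q homeomorphic_space Y"
proof -
  have qm: "quotient_map X Y f"
    by (rule continuous_closed_imp_quotient_map[OF f(1) continuous_imp_closed_map_gen[OF X Hausdorff_imp_kc_space[OF Y] f(1)] f(2)])
  have qq: "quotient_map X (quotient_topology X q) q" by (rule quotient_map_quotient_topology)
  obtain g where g: "continuous_map (quotient_topology X q) Y g" "\<And>x. x \<in> topspace X \<Longrightarrow> g (q x) = f x"
    using quotient_map_lift_exists[OF qq f(1)] fib by metis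
  obtain h where h: "continuous_map Y (quotient_topology X q) h" "\<And>x. x \<in> topspace X \<Longrightarrow> h (f x) = q x"
    using quotient_map_lift_exists[OF qm quotient_imp_continuous_map[OF qq]] fib by metis
  have "homeomorphic_maps (quotient_topology X q) Y g h"
    unfolding homeomorphic_maps_def
  proof (intro conjI ballI g(1) h(1))
    fix z assume "z \<in> topspace (quotient_topology X q)"
    then obtain x where "x \<in> topspace X" "z = q x" by auto
    then show "h (g z) = z" using g(2) h(2) by simp
  next
    fix z assume "z \<in> topspace Y"
    then obtain x where "x \<in> topspace X" "z = f x" using f(2) by blast
    then show "g (h z) = z" using g(2) h(2) by simp
  qed
  then show ?thesis unfolding homeomorphic_space_def by blast
qed

lemma lens_space_homeomorphic: "lens_space 3 1 homeomorphic_space lens3.X"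
proof -
  let ?S = "{(z, w). (norm z)\<^sup>2 + (norm w)\<^sup>2 = 1} :: (complex \<times> complex) set"
  have S: "?S = S3"
    by (auto simp: norm_Pair)
  \<comment> \<open>For \<open>q = 1\<close> both coordinates are multiplied by the same number, and
    the numbers that occur are all cube roots of unity.\<close>
  have orbit: "lens_orbit 3 1 y = (\<lambda>\<zeta>. scale \<zeta> y) ` lens3.roots" for y
  proof -
    have "lens3.roots = (\<lambda>k. cis (2 * pi * real k / real 3)) ` {..<3}"
      using Complex.bij_betw_roots_unity[of 3] by (simp add: bij_betw_def)
    then have "(\<lambda>\<zeta>. scale \<zeta> y) ` lens3.roots = (\<lambda>k. scale (cis (2 * pi * real k / real 3)) y) ` {..<3}"
      by (simp only: image_image)
    also have "\<dots> = lens_orbit 3 1 y"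
      by (cases y) (auto simp: lens_orbit_def scale_def image_iff)
    finally show ?thesis by simp
  qed
  have one: "1 \<in> lens3.roots" by simp
  have "quotient_topology (top_of_set S3) (lens_orbit 3 1) homeomorphic_space lens3.X"
  proof (rule quotient_topology_homeomorphic[OF _ _ lens3.continuous_lens_map])
    show "compact_space (top_of_set S3)" by (simp add: compact_space_subtopology)
    show "Hausdorff_space lens3.X" by (simp add: Hausdorff_space_subtopology)
    show "lens_map 3 ` topspace (top_of_set S3) = topspace lens3.X" by simp
    fix x y assume xy: "x \<in> topspace (top_of_set S3)" "y \<in> topspace (top_of_set S3)"
    show "lens_map 3 x = lens_map 3 y \<longleftrightarrow> lens_orbit 3 1 x = lens_orbit 3 1 y"
    proof
      assume "lens_map 3 x = lens_map 3 y"
      then obtain \<zeta> where z: "\<zeta> \<in> lens3.roots" "y = scale \<zeta> x"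
        using lens3.lens_map_eq_iff[of x y] xy by auto
      \<comment> \<open>Translation by a group element is a bijection, so a point and its translate
        have the same orbit.\<close>
      have "(\<lambda>\<eta>. \<eta> * \<zeta>) ` lens3.roots = lens3.roots"
      proof
        show "(\<lambda>\<eta>. \<eta> * \<zeta>) ` lens3.roots \<subseteq> lens3.roots" using lens3.root_mult z(1) by blast
        show "lens3.roots \<subseteq> (\<lambda>\<eta>. \<eta> * \<zeta>) ` lens3.roots"
        proof
          fix \<eta> assume e: "\<eta> \<in> lens3.roots"
          have "\<eta> = (\<eta> * cnj \<zeta>) * \<zeta>" using lens3.root_cnj[OF z(1)] by (simp add: mult.assoc mult.commute)
          then show "\<eta> \<in> (\<lambda>\<eta>. \<eta> * \<zeta>) ` lens3.roots"
            using lens3.root_mult[OF e lens3.root_cnj_mem[OF z(1)]] by (rule image_eqI)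
        qed
      qed
      then show "lens_orbit 3 1 x = lens_orbit 3 1 y"
        unfolding orbit z(2) scale_scale using image_image[of "\<lambda>\<eta>. scale \<eta> x" "\<lambda>\<eta>. \<eta> * \<zeta>" lens3.roots] by (simp only:)
    next
      assume "lens_orbit 3 1 x = lens_orbit 3 1 y"
      moreover have "y \<in> lens_orbit 3 1 y" unfolding orbit by (rule image_eqI[where x = 1]) (simp_all only: scale_1 one)
      ultimately have "y \<in> lens_orbit 3 1 x" by simp
      then obtain \<zeta> where "\<zeta> \<in> lens3.roots" "y = scale \<zeta> x" unfolding orbit by blast
      then show "lens_map 3 x = lens_map 3 y" by (simp only: lens3.lens_map_scale)
    qed
  qed
  then show ?thesis unfolding lens_space_def S .
qed

text \<open>The square roots of unity act by the identity and the antipodal map, so the antipodal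
  pairs are the fibres of \<open>lens_map 2\<close>, once R^4 is read as C^2.\<close>

lemma real_projective_space_homeomorphic: "real_projective_space 3 homeomorphic_space lens2.X"
proof -
  let ?N = "{x :: nat \<Rightarrow> real. (\<forall>i>3. x i = 0) \<and> (\<Sum>i\<le>3. (x i)\<^sup>2) = 1}"
  let ?f = "\<lambda>x :: nat \<Rightarrow> real. (Complex (x 0) (x 1), Complex (x 2) (x 3))"
    and ?g = "\<lambda>z (i::nat). if i = 0 then Re (fst z) else if i = 1 then Im (fst z) else if i = 2 then Re (snd z) else if i = 3 then Im (snd z) else 0 :: real"
  have s: "(\<Sum>i\<le>3. (x i)\<^sup>2) = (x 0)\<^sup>2 + (x 1)\<^sup>2 + (x 2)\<^sup>2 + (x 3)\<^sup>2" for x :: "nat \<Rightarrow> real" by (simp add: eval_nat_numeral)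
  have N: "nsphere 3 = top_of_set ?N" by (rule nsphere_eq_top_of_set)
  have norm_f: "(norm (?f x))\<^sup>2 = (x 0)\<^sup>2 + (x 1)\<^sup>2 + (x 2)\<^sup>2 + (x 3)\<^sup>2" for x
    by (simp add: norm_Pair cmod_power2)
  have fS: "?f x \<in> S3" if "x \<in> ?N" for x
  proof -
    have "(norm (?f x))\<^sup>2 = 1" using that unfolding norm_f mem_Collect_eq s by (rule conjunct2)
    then have "norm (?f x) = 1" using norm_ge_zero[of "?f x"] unfolding power2_eq_1_iff by linarith
    then show ?thesis by (simp only: mem_sphere_0)
  qed
  have fg: "?f (?g z) = z" for z by (cases z) (simp add: complex_eq_iff)
  have gN: "?g z \<in> ?N" if "z \<in> S3" for z
  proof -
    have n: "norm z = 1" using that by simp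
    have "(norm z)\<^sup>2 = (?g z 0)\<^sup>2 + (?g z 1)\<^sup>2 + (?g z 2)\<^sup>2 + (?g z 3)\<^sup>2"
      using norm_f[of "?g z"] unfolding fg .
    then show ?thesis unfolding mem_Collect_eq s n by simp
  qed
  have eqI: "x = y" if "x \<in> ?N" "y \<in> ?N" "?f x = ?f y" for x y
  proof
    fix i :: nat
    consider "i = 0" | "i = 1" | "i = 2" | "i = 3" | "i > 3" by linarith
    then show "x i = y i" using that by cases auto
  qed
  have fN: "?f ` ?N = S3" 
  proof
    show "?f ` ?N \<subseteq> S3" using fS by (rule image_subsetI)
    show "S3 \<subseteq> ?f ` ?N"
    proof
      fix z assume "z \<in> S3"
      from imageI[OF gN[OF this], of ?f] show "z \<in> ?f ` ?N" unfolding fg .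
    qed
  qed
  have cf: "continuous_map (nsphere 3) (top_of_set S3) ?f"
    unfolding N by (rule continuous_map_top_of_setI[OF _ fS]) (intro continuous_on_Pair continuous_on_Complex continuous_on_coordinate)
  have "quotient_topology (nsphere 3) (\<lambda>x. {x, \<lambda>i. - x i}) homeomorphic_space lens2.X"
  proof (rule quotient_topology_homeomorphic[where f = "lens_map 2 \<circ> ?f"])
    \<comment> \<open>Exhibits the sphere of sequences as a continuous image of the compact unit
      sphere in C^2.\<close>
    have "?N = ?g ` S3" 
    proof
      show "?g ` S3 \<subseteq> ?N" using gN by (rule image_subsetI)
      show "?N \<subseteq> ?g ` S3"
      proof
        fix x assume x: "x \<in> ?N"
        have "x = ?g (?f x)" by (rule eqI[OF x gN[OF fS[OF x]] fg[symmetric]])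
        then show "x \<in> ?g ` S3" by (rule image_eqI[OF _ fS[OF x]])
      qed
    qed
    moreover have "continuous_on S3 ?g"
    proof (rule continuous_on_coordinatewise_then_product)
      show "continuous_on S3 (\<lambda>z. ?g z i)" for i
        by (cases "i = 0"; cases "i = 1"; cases "i = 2"; cases "i = 3") (simp_all add: continuous_intros)
    qed
    ultimately have "compact ?N" by (simp only: compact_continuous_image compact_sphere)
    then show "compact_space (nsphere 3)" unfolding N by (simp only: compact_space_subtopology compactin_euclidean_iff)
    show "Hausdorff_space lens2.X" by (simp add: Hausdorff_space_subtopology)
    show "continuous_map (nsphere 3) lens2.X (lens_map 2 \<circ> ?f)"
      by (rule continuous_map_compose[OF cf lens2.continuous_lens_map])
    show "(lens_map 2 \<circ> ?f) ` topspace (nsphere 3) = topspace lens2.X"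
      unfolding N topspace_euclidean_subtopology image_comp[symmetric] fN ..
    fix x y assume "x \<in> topspace (nsphere 3)" "y \<in> topspace (nsphere 3)"
    then have xy: "x \<in> ?N" "y \<in> ?N" unfolding N topspace_euclidean_subtopology by blast+
    have roots: "lens2.roots = {1, - 1}" by (auto simp: power2_eq_1_iff)
    have neg: "scale (- 1) (?f x) = ?f (\<lambda>i. - x i)" for x
      by (simp add: scale_def complex_eq_iff)
    have nN: "(\<lambda>i. - x i) \<in> ?N" using xy(1) by simp
    have "(lens_map 2 \<circ> ?f) x = (lens_map 2 \<circ> ?f) y \<longleftrightarrow> (?f y = ?f x \<or> ?f y = ?f (\<lambda>i. - x i))"
      unfolding o_def lens2.lens_map_eq_iff[OF fS[OF xy(1)] fS[OF xy(2)]]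
      by (simp only: roots bex_simps scale_1 neg simp_thms)
    also have "?f y = ?f x \<longleftrightarrow> y = x"
    proof
      assume "?f y = ?f x"
      then show "y = x" by (rule eqI[OF xy(2) xy(1)])
    qed (simp only:)
    also have "?f y = ?f (\<lambda>i. - x i) \<longleftrightarrow> y = (\<lambda>i. - x i)"
    proof
      assume "?f y = ?f (\<lambda>i. - x i)"
      then show "y = (\<lambda>i. - x i)" by (rule eqI[OF xy(2) nN])
    qed (simp only:)
    also have "y = x \<or> y = (\<lambda>i. - x i) \<longleftrightarrow> {x, \<lambda>i. - x i} = {y, \<lambda>i. - y i}"
    proof
      assume "y = x \<or> y = (\<lambda>i. - x i)"
      then show "{x, \<lambda>i. - x i} = {y, \<lambda>i. - y i}"
      proof
        assume y: "y = (\<lambda>i. - x i)"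
        show ?thesis unfolding y minus_minus by (rule insert_commute)
      qed (simp only:)
    next
      assume e: "{x, \<lambda>i. - x i} = {y, \<lambda>i. - y i}"
      have "y \<in> {x, \<lambda>i. - x i}" unfolding e by (rule insertI1)
      then show "y = x \<or> y = (\<lambda>i. - x i)" by (simp only: insert_iff empty_iff simp_thms)
    qed
    finally show "(lens_map 2 \<circ> ?f) x = (lens_map 2 \<circ> ?f) y \<longleftrightarrow> {x, \<lambda>i. - x i} = {y, \<lambda>i. - y i}" .
  qed
  then show ?thesis unfolding real_projective_space_def .
qed

lemma S1_S2_homeomorphic: "prod_topology (nsphere 1) (nsphere 2) homeomorphic_space top_of_set (S1 \<times> S2)"
  unfolding prod_topology_top_of_set[symmetric]
  using nsphere_1_homeomorphic_S1 nsphere_2_homeomorphic_S2 unfolding homeomorphic_space_def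
  by (metis homeomorphic_maps_prod)

lemma volume_two_homeomorphic_model:
  assumes "X homeomorphic_space Y" "volume_two Y"
  shows "(\<exists>\<mu>. oriented_closed_connected_manifold 3 X \<mu>) \<and>
    (\<forall>\<mu>. oriented_closed_connected_manifold 3 X \<mu> \<longrightarrow> integral_simplicial_volume 3 X \<mu> = 2)"
  by (rule volume_two_imp_integral_simplicial_volume[OF volume_two_homeomorphic[OF homeomorphic_space_sym[THEN iffD1, OF assms(1)] assms(2)]])

theorem proposition4p4:
  shows "((\<exists>\<mu>. oriented_closed_connected_manifold 3 (prod_topology (nsphere 1) (nsphere 2)) \<mu>) \<and>
          (\<forall>\<mu>. oriented_closed_connected_manifold 3 (prod_topology (nsphere 1) (nsphere 2)) \<mu> \<longrightarrow>
             integral_simplicial_volume 3 (prod_topology (nsphere 1) (nsphere 2)) \<mu> = 2)) \<and>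
         ((\<exists>\<mu>. oriented_closed_connected_manifold 3 (real_projective_space 3) \<mu>) \<and>
          (\<forall>\<mu>. oriented_closed_connected_manifold 3 (real_projective_space 3) \<mu> \<longrightarrow>
             integral_simplicial_volume 3 (real_projective_space 3) \<mu> = 2)) \<and>
         ((\<exists>\<mu>. oriented_closed_connected_manifold 3 (lens_space 3 1) \<mu>) \<and>
          (\<forall>\<mu>. oriented_closed_connected_manifold 3 (lens_space 3 1) \<mu> \<longrightarrow>
             integral_simplicial_volume 3 (lens_space 3 1) \<mu> = 2))"
  by (rule conjI[OF volume_two_homeomorphic_model[OF S1_S2_homeomorphic volume_two_S1_S2]
      conjI[OF volume_two_homeomorphic_model[OF real_projective_space_homeomorphic volume_two_lens2]
      volume_two_homeomorphic_model[OF lens_space_homeomorphic volume_two_lens3]]])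

end
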